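(* Let $\{\mathcal T_h\}_{h\in(0,h_0)}$ be conforming triangulations of $\Omega$, let $\alpha\in[0,1]$, and assume that for all $u\in H^2(\Omega)$ and all $h\in(0,h_0)$ the discrete solution $U$ satisfies $|u-U|_{H^1(\Omega)}\le C(u)h^\alpha$ with $C(u)$ independent of $h$. Let $C_K,C_\alpha>0$ be given, and let $C_L>0$ be sufficiently large with respect to the constant $C(u)$ for $u(x_1,x_2)=x_1^2+x_2^2$. Then there is a constant $C>0$, independent of $h$ and of the set of bands, such that every set $\mathbb B=\bigcup_{b=1}^{N_{\mathcal B}}\mathcal B_b\subset\mathcal T_h$, $h\in(0,h_0)$, of disjoint bands $\mathcal B_b=(\bigcup_{i=0}^{N_b}K_i^b)\cup(\bigcup_{i=1}^{N_b}\tilde K_i^b)$ satisfying $L_b\ge C_Lh^{2\alpha/5}$ for all $b$ and $$|\tilde K_i^b|\le C_K|K_i^b|,\qquad |\tilde K_i^b|\le C_K|K_{i-1}^b|,\qquad \sin(\pi-\alpha_{i-1}^b)\le C_\alpha\sin(\pi-\tilde\alpha_i^b)$$ for all $b=1,\dots,N_{\mathcal B}$, $i=1,\dots,N_b$, must satisfy $$\Big(\sum_{b=1}^{N_{\mathcal B}}\min_{i=1,\dots,N_b}\frac{1}{\sin^2(\pi-\tilde\alpha_i^b)}\ \min_{i=1,\dots,N_b}|\tilde K_i^b|\,L_b^2N_b^{-1}\Big)^{1/2}\le Ch^\alpha.$$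
   Context: $\Omega\subset\mathbb R^2$ is a bounded polygonal domain with Lipschitz boundary; $h$ is the maximal diameter of elements of $\mathcal T_h$; $X_h\subset H^1(\Omega)$ is the space of globally continuous functions that are linear on every $K\in\mathcal T_h$. The discrete solution $U\in X_h$ associated with $u$ is the piecewise linear conforming finite element solution of Poisson's problem with exact solution $u$, with Dirichlet data imposed by piecewise linear Lagrange interpolation of $u$ on $\partial\Omega$. $|K|$ is the area of $K$. Band: for $N\ge1$, a band $\mathcal B\subset\mathcal T_h$ is a union of distinct elements $K_0,\dots,K_N,\tilde K_1,\dots,\tilde K_N$ of $\mathcal T_h$ of the following form. There are consecutive points $P_0,\dots,P_{N+1}$ on a straight line and points $Q_0,\dots,Q_N$ on one side of it such that $K_i$ is the triangle $P_iP_{i+1}Q_i$, whose longest edge is $P_iP_{i+1}$ (so its maximum angle is at $Q_i$), and $\tilde K_i$ is the triangle $Q_{i-1}Q_iP_i$, whose maximum angle is at $P_i$. $\alpha_i,\tilde\alpha_i$ denote the maximum angles of $K_i,\tilde K_i$; $\Gamma=\bigcup_{i=0}^N P_iP_{i+1}$ and $L$ is the length of $\Gamma$. For the band $\mathcal B_b$ all these quantities carry the index $b$. Disjoint bands are bands having no element in common. "$C_L$ sufficiently large with respect to $C(u)$" means: larger than a threshold that depends only on $\Omega$, $h_0$, $\alpha$ and the constant $C(u)$ of the error estimate for $u=x_1^2+x_2^2$. *)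

theory Defs
  imports "HOL-Analysis.Analysis"
begin

section \<open>Polygonal Lipschitz domains in the plane\<close>

definition polygonal_domain :: "(real^2) set \<Rightarrow> bool" where
  "polygonal_domain \<Omega> \<longleftrightarrow>
     open \<Omega> \<and> connected \<Omega> \<and> \<Omega> \<noteq> {} \<and> bounded \<Omega> \<and>
     (\<exists>S. finite S \<and> frontier \<Omega> = (\<Union>(a, b)\<in>S. closed_segment a b))"

text \<open>Near every boundary point the domain is, in some Cartesian coordinate system, the set of
  points strictly above the graph of a Lipschitz function.\<close>

definition lipschitz_boundary :: "(real^2) set \<Rightarrow> bool" where
  "lipschitz_boundary \<Omega> \<longleftrightarrow>
     (\<forall>z\<in>frontier \<Omega>. \<exists>r>0. \<exists>e1 e2 g M.
        norm e1 = 1 \<and> norm e2 = 1 \<and> e1 \<bullet> e2 = 0 \<and> M-lipschitz_on (UNIV :: real set) g \<and>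
        \<Omega> \<inter> ball z r = {x \<in> ball z r. x \<bullet> e2 > g (x \<bullet> e1)})"


section \<open>Sobolev spaces\<close>

definition partial :: "2 \<Rightarrow> (real^2 \<Rightarrow> real) \<Rightarrow> (real^2 \<Rightarrow> real)" where
  "partial i f = (\<lambda>x. frechet_derivative f (at x) (axis i 1))"

text \<open>All iterated partial derivatives exist and are (totally) differentiable, hence continuous:
  this is the class of infinitely differentiable functions.\<close>

definition smooth :: "(real^2 \<Rightarrow> real) \<Rightarrow> bool" where
  "smooth f \<longleftrightarrow> (\<forall>is x. foldr partial is f differentiable (at x))"

definition test_functions :: "(real^2) set \<Rightarrow> (real^2 \<Rightarrow> real) set" where
  "test_functions \<Omega> =
     {\<phi>. smooth \<phi> \<and> compact (closure {x. \<phi> x \<noteq> 0}) \<and> closure {x. \<phi> x \<noteq> 0} \<subseteq> \<Omega>}"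

definition L2 :: "(real^2) set \<Rightarrow> (real^2 \<Rightarrow> real) set" where
  "L2 \<Omega> = {f. f \<in> borel_measurable (lebesgue_on \<Omega>) \<and> integrable (lebesgue_on \<Omega>) (\<lambda>x. (f x)\<^sup>2)}"

definition is_weak_partial ::
    "(real^2) set \<Rightarrow> 2 \<Rightarrow> (real^2 \<Rightarrow> real) \<Rightarrow> (real^2 \<Rightarrow> real) \<Rightarrow> bool" where
  "is_weak_partial \<Omega> i f g \<longleftrightarrow>
     (\<forall>\<phi>\<in>test_functions \<Omega>.
        (LINT x|lebesgue_on \<Omega>. f x * partial i \<phi> x) = - (LINT x|lebesgue_on \<Omega>. g x * \<phi> x))"

definition H1 :: "(real^2) set \<Rightarrow> (real^2 \<Rightarrow> real) set" where
  "H1 \<Omega> = {f \<in> L2 \<Omega>. \<forall>i. \<exists>g\<in>L2 \<Omega>. is_weak_partial \<Omega> i f g}"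

text \<open>Elements of these spaces are functions rather than classes modulo null sets; their values
  outside \<open>\<Omega>\<close> are irrelevant. On \<open>H1 \<Omega>\<close> the following choice is unique up to null sets.\<close>

definition weak_partial :: "(real^2) set \<Rightarrow> 2 \<Rightarrow> (real^2 \<Rightarrow> real) \<Rightarrow> (real^2 \<Rightarrow> real)" where
  "weak_partial \<Omega> i f = (SOME g. g \<in> L2 \<Omega> \<and> is_weak_partial \<Omega> i f g)"

definition H2 :: "(real^2) set \<Rightarrow> (real^2 \<Rightarrow> real) set" where
  "H2 \<Omega> = {f \<in> H1 \<Omega>. \<forall>i. weak_partial \<Omega> i f \<in> H1 \<Omega>}"

definition H1_seminorm :: "(real^2) set \<Rightarrow> (real^2 \<Rightarrow> real) \<Rightarrow> real" where
  "H1_seminorm \<Omega> f = sqrt (\<Sum>i\<in>UNIV. LINT x|lebesgue_on \<Omega>. (weak_partial \<Omega> i f x)\<^sup>2)"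

definition grad_product :: "(real^2) set \<Rightarrow> (real^2 \<Rightarrow> real) \<Rightarrow> (real^2 \<Rightarrow> real) \<Rightarrow> real" where
  "grad_product \<Omega> f g =
     (\<Sum>i\<in>UNIV. LINT x|lebesgue_on \<Omega>. weak_partial \<Omega> i f x * weak_partial \<Omega> i g x)"

definition weak_laplacian :: "(real^2) set \<Rightarrow> (real^2 \<Rightarrow> real) \<Rightarrow> (real^2 \<Rightarrow> real)" where
  "weak_laplacian \<Omega> u = (\<lambda>x. \<Sum>i\<in>UNIV. weak_partial \<Omega> i (weak_partial \<Omega> i u) x)"


section \<open>Triangulations and the finite element solution\<close>

definition conforming_triangulation :: "(real^2) set \<Rightarrow> (real^2) set set \<Rightarrow> bool" where
  "conforming_triangulation \<Omega> \<T> \<longleftrightarrow>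
     triangulation \<T> \<and> (\<forall>K\<in>\<T>. 2 simplex K) \<and> \<Union>\<T> = closure \<Omega>"

definition mesh_size :: "(real^2) set set \<Rightarrow> real" where
  "mesh_size \<T> = Max (diameter ` \<T>)"

definition mesh_vertices :: "(real^2) set set \<Rightarrow> (real^2) set" where
  "mesh_vertices \<T> = {v. \<exists>K\<in>\<T>. v extreme_point_of K}"

definition fe_space :: "(real^2) set \<Rightarrow> (real^2) set set \<Rightarrow> (real^2 \<Rightarrow> real) set" where
  "fe_space \<Omega> \<T> =
     {v. continuous_on (closure \<Omega>) v \<and> (\<forall>K\<in>\<T>. \<exists>a c. \<forall>x\<in>K. v x = a \<bullet> x + c)}"

definition lagrange_interpolant ::
    "(real^2) set \<Rightarrow> (real^2) set set \<Rightarrow> (real^2 \<Rightarrow> real) \<Rightarrow> (real^2 \<Rightarrow> real) \<Rightarrow> bool" where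
  "lagrange_interpolant \<Omega> \<T> w v \<longleftrightarrow>
     v \<in> fe_space \<Omega> \<T> \<and> (\<forall>p\<in>mesh_vertices \<T>. v p = w p)"

definition continuous_representative ::
    "(real^2) set \<Rightarrow> (real^2 \<Rightarrow> real) \<Rightarrow> (real^2 \<Rightarrow> real) \<Rightarrow> bool" where
  "continuous_representative \<Omega> u w \<longleftrightarrow>
     continuous_on (closure \<Omega>) w \<and> (AE x in lebesgue_on \<Omega>. w x = u x)"

text \<open>\<open>U\<close> solves the discrete Poisson problem whose exact solution is \<open>u\<close>, i.e. with right-hand
  side \<open>- \<Delta>u\<close> and with the interpolated trace of \<open>u\<close> as Dirichlet data. A function in \<open>H2 \<Omega>\<close>
  has boundary and vertex values only through its continuous representative, which exists
  by the Sobolev embedding and is unique on the closure of \<open>\<Omega>\<close>.\<close>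

definition discrete_solution ::
    "(real^2) set \<Rightarrow> (real^2) set set \<Rightarrow> (real^2 \<Rightarrow> real) \<Rightarrow> (real^2 \<Rightarrow> real) \<Rightarrow> bool" where
  "discrete_solution \<Omega> \<T> u U \<longleftrightarrow>
     U \<in> fe_space \<Omega> \<T> \<and>
     (\<exists>w I. continuous_representative \<Omega> u w \<and> lagrange_interpolant \<Omega> \<T> w I \<and>
            (\<forall>x\<in>frontier \<Omega>. U x = I x)) \<and>
     (\<forall>V\<in>fe_space \<Omega> \<T>. (\<forall>x\<in>frontier \<Omega>. V x = 0) \<longrightarrow>
        grad_product \<Omega> U V = (LINT x|lebesgue_on \<Omega>. - weak_laplacian \<Omega> u x * V x))"


section \<open>Bands\<close>

text \<open>\<open>angle_at a b c\<close> is the interior angle at \<open>b\<close> of the triangle \<open>a b c\<close>.\<close>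

definition angle_at :: "real^2 \<Rightarrow> real^2 \<Rightarrow> real^2 \<Rightarrow> real" where
  "angle_at a b c = arccos (((a - b) \<bullet> (c - b)) / (norm (a - b) * norm (c - b)))"

definition max_angle :: "real^2 \<Rightarrow> real^2 \<Rightarrow> real^2 \<Rightarrow> real" where
  "max_angle a b c = Max {angle_at b a c, angle_at a b c, angle_at a c b}"

text \<open>A band is given by the points \<open>P 0, \<dots>, P (N + 1)\<close> and \<open>Q 0, \<dots>, Q N\<close>; its elements are
  \<open>band_tri P Q i\<close> for \<open>i \<le> N\<close> (the \<open>K\<^sub>i\<close>) and \<open>band_tri' P Q i\<close> for \<open>1 \<le> i \<le> N\<close>
  (the \<open>K\<^sub>i\<close> with a tilde); the maximum angles carry the analogous names.\<close>

definition band_tri :: "(nat \<Rightarrow> real^2) \<Rightarrow> (nat \<Rightarrow> real^2) \<Rightarrow> nat \<Rightarrow> (real^2) set" where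
  "band_tri P Q i = convex hull {P i, P (i + 1), Q i}"

definition band_tri' :: "(nat \<Rightarrow> real^2) \<Rightarrow> (nat \<Rightarrow> real^2) \<Rightarrow> nat \<Rightarrow> (real^2) set" where
  "band_tri' P Q i = convex hull {Q (i - 1), Q i, P i}"

definition band_angle :: "(nat \<Rightarrow> real^2) \<Rightarrow> (nat \<Rightarrow> real^2) \<Rightarrow> nat \<Rightarrow> real" where
  "band_angle P Q i = max_angle (P i) (P (i + 1)) (Q i)"

definition band_angle' :: "(nat \<Rightarrow> real^2) \<Rightarrow> (nat \<Rightarrow> real^2) \<Rightarrow> nat \<Rightarrow> real" where
  "band_angle' P Q i = max_angle (Q (i - 1)) (Q i) (P i)"

definition band_elements :: "nat \<Rightarrow> (nat \<Rightarrow> real^2) \<Rightarrow> (nat \<Rightarrow> real^2) \<Rightarrow> (real^2) set set" where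
  "band_elements N P Q = band_tri P Q ` {0..N} \<union> band_tri' P Q ` {1..N}"

definition band_length :: "nat \<Rightarrow> (nat \<Rightarrow> real^2) \<Rightarrow> real" where
  "band_length N P = (\<Sum>i=0..N. dist (P i) (P (i + 1)))"

definition is_band ::
    "(real^2) set set \<Rightarrow> nat \<Rightarrow> (nat \<Rightarrow> real^2) \<Rightarrow> (nat \<Rightarrow> real^2) \<Rightarrow> bool" where
  "is_band \<T> N P Q \<longleftrightarrow>
     N \<ge> 1 \<and>
     (\<exists>a d n t. norm d = 1 \<and> norm n = 1 \<and> d \<bullet> n = 0 \<and>
        (\<forall>i\<in>{0..N + 1}. P i = a + t i *\<^sub>R d) \<and>
        (\<forall>i\<in>{0..N}. t i < (t (i + 1) :: real)) \<and>
        (\<forall>i\<in>{0..N}. (Q i - a) \<bullet> n > 0)) \<and>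
     (\<forall>i\<in>{0..N}.
        dist (P i) (Q i) \<le> dist (P i) (P (i + 1)) \<and>
        dist (P (i + 1)) (Q i) \<le> dist (P i) (P (i + 1))) \<and>
     (\<forall>i\<in>{1..N}. band_angle' P Q i = angle_at (Q (i - 1)) (P i) (Q i)) \<and>
     band_elements N P Q \<subseteq> \<T> \<and>
     inj_on (band_tri P Q) {0..N} \<and> inj_on (band_tri' P Q) {1..N} \<and>
     band_tri P Q ` {0..N} \<inter> band_tri' P Q ` {1..N} = {}"

end

theory Submission
  imports Defs
begin

text \<open>Let \<open>U\<close> be a discrete solution for \<open>u = |x|\<^sup>2\<close> and \<open>L\<close> the length of \<open>\<Gamma>\<close>. If the slopes of
  \<open>U\<close> on consecutive edges of \<open>\<Gamma>\<close> jumped by at most \<open>L / 3\<close> in total, then second differences of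
  \<open>u - U\<close> along \<open>\<Gamma>\<close> with step \<open>L / 3\<close> would be at least \<open>L\<^sup>2 / 9\<close>, and \<open>\<integral>\<^sub>\<Gamma> |u - U|\<close> would be of
  order \<open>L\<^sup>3\<close>. Integrating along parallel lines from \<open>\<Gamma>\<close> to the boundary, where \<open>|u - U| \<le> h\<^sup>2\<close>,
  bounds this integral by a multiple of \<open>h\<^sup>2 L + L\<^sup>1\<^sup>/\<^sup>2 |u - U|\<close> with the \<open>H\<^sup>1\<close> seminorm, which is
  impossible for \<open>L \<ge> C h\<^sup>2\<^sup>\<alpha>\<^sup>/\<^sup>5\<close>. So the jumps \<open>D i\<close> satisfy \<open>\<Sum> |D i| > L / 3\<close>.

  The element between two edges of \<open>\<Gamma>\<close> has a small angle \<open>\<delta>\<close> between its two short edges, along which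
  its gradient is prescribed by the neighbours; hence a jump \<open>D i\<close> forces an error of order
  \<open>|D i| / sin \<delta>\<close> in the gradient on one of the three elements involved. Summing the squares and using
  \<open>L\<^sup>2 \<le> 9 N \<Sum> (D i)\<^sup>2\<close> gives the claim.\<close>

section \<open>Test functions and uniqueness of weak derivatives\<close>

text \<open>The exponent \<open>2 * \<alpha> / 5\<close> comes from a balance: the lower bound L^3
  and the upper bound h^2 L + L^(1/2) E share the factor L^(1/2), and removing it leaves L^(5/2)
  against terms of order h^\<alpha>. Two things are needed before the error estimate can be used at
  all. It speaks only of functions that are discrete solutions, so one has to exist; and its
  seminorm is built on an arbitrarily chosen weak derivative, which has to be identified almost
  everywhere with the cellwise gradient. The identification and the trace estimate both come from
  integrating along lines parallel to an axis. The gradient error \<open>2 *\<^sub>R x - A K\<close>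
  is not constant on a cell, while the jump argument needs its value at the point
  \<open>P i\<close>. Over a cell it varies by at most 2 h, so its minimum over the cell, which the
  energy controls, can take its place at the price of a term h^2. Summed over all cells this costs
  h^2 times the area of \<Omega>, which is harmless because \<alpha> \<le> 1.\<close>

definition flat :: "nat \<Rightarrow> real \<Rightarrow> real" where
  "flat k t = (if t > 0 then (1 / t) ^ k * exp (- (1 / t)) else 0)"

lemma flat_nonneg: "0 \<le> flat k t"
  by (simp add: flat_def)

lemma flat_0_le_1: "flat 0 t \<le> 1"
  by (simp add: flat_def)

lemma flat_nonpos: "t \<le> 0 \<Longrightarrow> flat k t = 0"
  by (simp add: flat_def)

lemma flat_tendsto_0: "(flat k \<longlongrightarrow> 0) (at_right 0)"
proof -
  have "((\<lambda>s::real. s ^ k / exp s) \<longlongrightarrow> 0) at_top"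
    by (rule tendsto_power_div_exp_0)
  then have "((\<lambda>t. (inverse t) ^ k / exp (inverse t)) \<longlongrightarrow> 0) (at_right (0::real))"
    by (rule filterlim_compose) (rule filterlim_inverse_at_top_right)
  moreover have "\<forall>\<^sub>F t in at_right 0. (inverse t) ^ k / exp (inverse t) = flat k t"
    by (auto simp: eventually_at_right_less flat_def exp_minus field_simps eventually_at_filter)
  ultimately show ?thesis
    by (rule Lim_transform_eventually)
qed

text \<open>The powers of 1/t in \<open>flat\<close> are there for this: differentiating exp(-1/t)
  produces them, and with them the family is closed under derivatives up to linear
  combinations.\<close>

lemma flat_DERIV:
  "(flat k has_real_derivative flat (k + 2) t - real k * flat (k + 1) t) (at t)"
proof (cases "t = 0")
  case True
  \<comment> \<open>On the right the difference quotient at 0 is the next member of the family, so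
    \<open>flat_tendsto_0\<close> gives its limit.\<close>
  have q: "flat k h / h = (if h > 0 then flat (k + 1) h else 0)" for h
    by (auto simp: flat_def field_simps)
  have "((\<lambda>h. flat k h / h) \<longlongrightarrow> 0) (at 0)"
    unfolding filterlim_at_split
  proof
    show "((\<lambda>h. flat k h / h) \<longlongrightarrow> 0) (at_left 0)"
      by (rule tendsto_eventually) (auto simp: flat_def eventually_at_filter)
    show "((\<lambda>h. flat k h / h) \<longlongrightarrow> 0) (at_right 0)"
      by (rule Lim_transform_eventually[OF flat_tendsto_0[of "k + 1"]])
        (auto simp: q eventually_at_filter)
  qed
  then show ?thesis
    using True by (simp add: has_field_derivative_iff flat_def)
next
  case False
  then consider "t > 0" | "t < 0" by linarith
  then show ?thesis
  proof cases
    case 1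
    have i: "((\<lambda>t. 1 / t) has_real_derivative - (1 / (t * t))) (at t)"
      using 1 by (auto intro!: derivative_eq_intros simp: power2_eq_square)
    have "real k * (1 / t) ^ (k - 1) * (1 / (t * t)) = real k * (1 / t) ^ (k + 1)"
      using 1 by (cases k) (simp_all add: field_simps)
    then have "((\<lambda>t. (1 / t) ^ k * exp (- (1 / t))) has_real_derivative
        flat (k + 2) t - real k * flat (k + 1) t) (at t)"
      using 1 by (intro DERIV_cong[OF DERIV_mult[OF DERIV_power[OF i, of k] DERIV_fun_exp[OF DERIV_minus[OF i]]]])
        (simp add: flat_def algebra_simps power2_eq_square)
    then show ?thesis
      by (rule has_field_derivative_transform_within_open[where S = "{0<..}"])
        (use 1 in \<open>auto simp: flat_def\<close>)
  next
    case 2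
    have "((\<lambda>t::real. 0) has_real_derivative flat (k + 2) t - real k * flat (k + 1) t) (at t)"
      using 2 by (simp add: flat_def)
    then show ?thesis
      by (rule has_field_derivative_transform_within_open[where S = "{..<0}"])
        (use 2 in \<open>auto simp: flat_def\<close>)
  qed
qed

text \<open>Closed under partial derivatives, so all its members are smooth.\<close>

inductive flat_algebra :: "(real^2 \<Rightarrow> real) \<Rightarrow> bool" where
  flat: "flat_algebra (\<lambda>x. flat k (c * x $ i + d))"
| const: "flat_algebra (\<lambda>x. c)"
| add: "flat_algebra f \<Longrightarrow> flat_algebra g \<Longrightarrow> flat_algebra (\<lambda>x. f x + g x)"
| mult: "flat_algebra f \<Longrightarrow> flat_algebra g \<Longrightarrow> flat_algebra (\<lambda>x. f x * g x)"

lemma partial_eqI: "(f has_derivative f') (at x) \<Longrightarrow> partial i f x = f' (axis i 1)"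
  unfolding partial_def by (metis frechet_derivative_at)

lemma flat_algebra_partial:
  assumes "flat_algebra f"
  shows "(\<forall>x. f differentiable (at x)) \<and> (\<forall>j. flat_algebra (partial j f))"
  using assms
proof (induction rule: flat_algebra.induct)
  case (flat k c i d)
  define D where "D t = flat (k + 2) t - real k * flat (k + 1) t" for t
  have der: "((\<lambda>x. flat k (c * x $ i + d)) has_derivative (\<lambda>h. D (c * x $ i + d) * (c * h $ i))) (at x)"
    for x :: "real^2"
  proof -
    have 1: "((\<lambda>x. c * x $ i + d) has_derivative (\<lambda>h. c * h $ i)) (at x)"
      by (auto intro!: derivative_eq_intros bounded_linear.has_derivative[OF bounded_linear_vec_nth])
    have 2: "(flat k has_derivative (*) (D (c * x $ i + d))) (at (c * x $ i + d))"
      using flat_DERIV unfolding has_field_derivative_def D_def .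
    show ?thesis using has_derivative_compose[OF 1 2] by simp
  qed
  have "partial j (\<lambda>x. flat k (c * x $ i + d)) = (\<lambda>x.
      (flat (k + 2) (c * x $ i + d) + (- real k) * flat (k + 1) (c * x $ i + d)) * (c * axis j 1 $ i))" for j
    by (rule ext, subst partial_eqI[OF der]) (simp add: D_def)
  moreover have "flat_algebra (\<lambda>x.
      (flat (k + 2) (c * x $ i + d) + (- real k) * flat (k + 1) (c * x $ i + d)) * (c * axis j 1 $ i))" for j
    by (intro flat_algebra.intros)
  ultimately have "flat_algebra (partial j (\<lambda>x. flat k (c * x $ i + d)))" for j
    by simp
  then show ?case using der differentiableI by blast
next
  case (const c)
  have "partial j (\<lambda>x. c) = (\<lambda>x. 0)" for j
    by (rule ext, rule partial_eqI) simp
  then show ?case by (simp add: flat_algebra.const)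
next
  case (add f g)
  then have "(f has_derivative frechet_derivative f (at x)) (at x)"
      "(g has_derivative frechet_derivative g (at x)) (at x)" for x
    by (simp_all add: frechet_derivative_works[symmetric])
  then have "partial j (\<lambda>x. f x + g x) = (\<lambda>x. partial j f x + partial j g x)" for j
    unfolding partial_def[of _ f] partial_def[of _ g]
    by (intro ext partial_eqI) (rule has_derivative_add)
  then show ?case using add by (auto intro: flat_algebra.intros)
next
  case (mult f g)
  then have d: "(f has_derivative frechet_derivative f (at x)) (at x)"
      "(g has_derivative frechet_derivative g (at x)) (at x)" for x
    by (simp_all add: frechet_derivative_works[symmetric])
  have "partial j (\<lambda>x. f x * g x) = (\<lambda>x. f x * partial j g x + partial j f x * g x)" for j
    by (rule ext, subst partial_eqI[OF has_derivative_mult[OF d]]) (simp add: partial_def)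
  moreover have "flat_algebra (\<lambda>x. f x * partial j g x + partial j f x * g x)" for j
    using mult by (intro flat_algebra.intros) auto
  ultimately show ?case using mult by auto
qed

lemma flat_algebra_smooth:
  assumes "flat_algebra f" shows "smooth f"
proof -
  have "flat_algebra (foldr partial is f)" for "is"
    by (induction "is") (auto simp: assms flat_algebra_partial)
  then show ?thesis by (simp add: smooth_def flat_algebra_partial)
qed

text \<open>The four factors vanish outside the box, and the scaling by \<open>k\<close> drives each
  of them to 1 inside: smooth functions with values in [0, 1] that converge pointwise to the
  indicator of the open box.\<close>

definition box_bump :: "real^2 \<Rightarrow> real^2 \<Rightarrow> nat \<Rightarrow> real^2 \<Rightarrow> real" where
  "box_bump a b k x =
     (flat 0 (k * (x $ 1 - a $ 1)) * flat 0 (k * (b $ 1 - x $ 1))) *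
     (flat 0 (k * (x $ 2 - a $ 2)) * flat 0 (k * (b $ 2 - x $ 2)))"

lemma box_bump_zero: "x \<notin> box a b \<Longrightarrow> box_bump a b k x = 0"
proof -
  assume "x \<notin> box a b"
  then consider "x $ 1 \<le> a $ 1" | "b $ 1 \<le> x $ 1" | "x $ 2 \<le> a $ 2" | "b $ 2 \<le> x $ 2"
    by (fastforce simp: mem_box_cart forall_2)
  then show ?thesis
    by cases (simp_all add: box_bump_def flat_nonpos mult_nonneg_nonpos)
qed

lemma box_bump_bounds: "0 \<le> box_bump a b k x" "box_bump a b k x \<le> 1"
  unfolding box_bump_def
  by (intro mult_nonneg_nonneg flat_nonneg mult_le_one flat_0_le_1)+

lemma flat_scaled_tendsto:
  assumes "t > 0" shows "(\<lambda>k. flat 0 (real k * t)) \<longlonglongrightarrow> 1"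
proof -
  have "(\<lambda>k. 1 / (real k * t)) \<longlonglongrightarrow> 0"
    using tendsto_mult_right[OF lim_1_over_n, of "1/t"] by (simp add: field_simps)
  then have "(\<lambda>k. exp (- (1 / (real k * t)))) \<longlonglongrightarrow> exp (- 0)"
    by (intro tendsto_intros)
  moreover have "\<forall>\<^sub>F k in sequentially. exp (- (1 / (real k * t))) = flat 0 (real k * t)"
    using eventually_gt_at_top[of 0] by eventually_elim (use assms in \<open>auto simp: flat_def\<close>)
  ultimately have "(\<lambda>k. flat 0 (real k * t)) \<longlonglongrightarrow> exp (- 0)"
    by (rule Lim_transform_eventually)
  then show ?thesis by simp
qed

lemma box_bump_tendsto: "(\<lambda>k. box_bump a b k x) \<longlonglongrightarrow> indicator (box a b) x"
proof (cases "x \<in> box a b")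
  case True
  then have "(\<lambda>k. box_bump a b k x) \<longlonglongrightarrow> (1 * 1) * (1 * 1)"
    unfolding box_bump_def
    by (intro tendsto_mult flat_scaled_tendsto) (auto simp: mem_box_cart)
  then show ?thesis using True by simp
qed (simp add: box_bump_zero)

lemma box_bump_test_function:
  assumes "cbox a b \<subseteq> \<Omega>" shows "box_bump a b k \<in> test_functions \<Omega>"
proof -
  \<comment> \<open>The arguments are rewritten as \<open>c * x $ i + d\<close>, the form of the
    generators of \<open>flat_algebra\<close>.\<close>
  have e: "box_bump a b k = (\<lambda>x.
     (flat 0 (k * x $ 1 + - k * a $ 1) * flat 0 (- k * x $ 1 + k * b $ 1)) *
     (flat 0 (k * x $ 2 + - k * a $ 2) * flat 0 (- k * x $ 2 + k * b $ 2)))"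
    by (rule ext) (simp add: box_bump_def algebra_simps)
  have "smooth (box_bump a b k)"
    unfolding e by (intro flat_algebra_smooth flat_algebra.intros)
  moreover have "{x. box_bump a b k x \<noteq> 0} \<subseteq> cbox a b"
    using box_bump_zero box_subset_cbox by blast
  then have "closure {x. box_bump a b k x \<noteq> 0} \<subseteq> cbox a b"
    by (intro closure_minimal) auto
  moreover from this have "compact (closure {x. box_bump a b k x \<noteq> 0})"
    by (meson bounded_cbox bounded_subset closed_closure compact_eq_bounded_closed)
  ultimately show ?thesis using assms unfolding test_functions_def by blast
qed

lemma smooth_differentiable: "smooth f \<Longrightarrow> f differentiable (at x)"
  unfolding smooth_def by (drule spec[of _ "[]"]) simp

lemma smooth_continuous: "smooth f \<Longrightarrow> continuous_on S f"
  using smooth_differentiable differentiable_imp_continuous_within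
  by (intro continuous_at_imp_continuous_on) blast

lemma smooth_partial: "smooth f \<Longrightarrow> smooth (partial i f)"
proof -
  assume "smooth f"
  then have "foldr partial (is @ [i]) f differentiable at x" for "is" x
    unfolding smooth_def by blast
  then show ?thesis unfolding smooth_def by simp
qed

lemma smooth_has_derivative:
  assumes "smooth f"
  shows "(f has_derivative frechet_derivative f (at x)) (at x)"
  using smooth_differentiable[OF assms] frechet_derivative_works by blast

lemma partial_zero_outside_support:
  assumes "x \<notin> closure {y. f y \<noteq> 0}" shows "partial i f x = 0"
proof -
  have "((\<lambda>y. 0::real) has_derivative (\<lambda>h. 0)) (at x)" by simp
  then have "(f has_derivative (\<lambda>h. 0)) (at x)"
    by (rule has_derivative_transform_within_open[where s = "- closure {y. f y \<noteq> 0}"])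
      (use assms closure_subset[of "{y. f y \<noteq> 0}"] in auto)
  from partial_eqI[OF this] show ?thesis by simp
qed

lemma test_function_partial: 
  assumes "\<phi> \<in> test_functions \<Omega>" shows "partial i \<phi> \<in> test_functions \<Omega>"
proof -
  have s: "closure {y. partial i \<phi> y \<noteq> 0} \<subseteq> closure {y. \<phi> y \<noteq> 0}"
    using partial_zero_outside_support[of _ \<phi> i] by (intro closure_minimal) auto
  have c: "compact (closure {y. \<phi> y \<noteq> 0})" "closure {y. \<phi> y \<noteq> 0} \<subseteq> \<Omega>" "smooth \<phi>"
    using assms by (auto simp: test_functions_def)
  have "compact (closure {y. partial i \<phi> y \<noteq> 0})"
    using c(1) s by (meson bounded_subset closed_closure compact_eq_bounded_closed)
  then show ?thesis
    using c s unfolding test_functions_def by (auto simp: smooth_partial)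
qed

text \<open>A Dynkin argument: open boxes are stable under intersection and generate the Borel sets,
  and the sets over which \<open>g\<close> has integral 0 are closed under complements and disjoint
  unions. Taking the sets where \<open>g\<close> is positive and where it is negative forces
  \<open>g\<close> to vanish.\<close>

lemma AE_zero_if_box_integrals_zero:
  fixes g :: "'a::euclidean_space \<Rightarrow> real"
  assumes int: "integrable lborel g"
    and box: "\<And>a b. (LINT x|lborel. indicator (box a b) x * g x) = 0"
  shows "AE x in lborel. g x = 0"
proof -
  have [measurable]: "g \<in> borel_measurable borel"
    using int by (auto dest: borel_measurable_integrable)
  have intA: "integrable lborel (\<lambda>x. indicator A x * g x)" if "A \<in> sets borel" for A
    using integrable_mult_indicator[OF _ int, of A] that by simp
  \<comment> \<open>Stated with partial unions in order to serve twice: for boxes exhausting the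
    whole space, needed for complements, and for the disjoint unions of the induction.\<close>
  have limit: "(LINT x|lborel. indicator (\<Union>i. F i) x * g x) = 0"
    if F: "\<And>i::nat. F i \<in> sets borel" and z: "\<And>k::nat. (LINT x|lborel. indicator (\<Union>i<k. F i) x * g x) = 0" for F
  proof -
    have [measurable]: "F i \<in> sets borel" for i using F .
    have "(\<lambda>k. LINT x|lborel. indicator (\<Union>i<k. F i) x * g x)
        \<longlonglongrightarrow> (LINT x|lborel. indicator (\<Union>i. F i) x * g x)"
    proof (rule integral_dominated_convergence[where w = "\<lambda>x. \<bar>g x\<bar>"])
      show "AE x in lborel. (\<lambda>k. indicator (\<Union>i<k. F i) x * g x) \<longlonglongrightarrow> indicator (\<Union>i. F i) x * g x"
        by (intro AE_I2 tendsto_mult_right LIMSEQ_indicator_UN)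
      show "AE x in lborel. norm (indicator (\<Union>i<k. F i) x * g x) \<le> \<bar>g x\<bar>" for k
        by (auto split: split_indicator)
      show "integrable lborel (\<lambda>x. \<bar>g x\<bar>)" using int by simp
    qed measurable
    then show ?thesis unfolding z by (simp add: LIMSEQ_const_iff)
  qed
  have "(LINT x|lborel. indicator (\<Union>i::nat. box (- (real i *\<^sub>R One)) (real i *\<^sub>R One :: 'a)) x * g x) = 0"
  proof (rule limit)
    fix k :: nat
    show "(LINT x|lborel. indicator (\<Union>i<k. box (- (real i *\<^sub>R One)) (real i *\<^sub>R One :: 'a)) x * g x) = 0"
    proof (cases k)
      case (Suc m)
      have "(\<Union>i<k. box (- (real i *\<^sub>R One)) (real i *\<^sub>R One :: 'a)) = box (- (real m *\<^sub>R One)) (real m *\<^sub>R One)"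
      proof
        have "box (- (real i *\<^sub>R One)) (real i *\<^sub>R One :: 'a) \<subseteq> box (- (real m *\<^sub>R One)) (real m *\<^sub>R One)"
          if "i < k" for i
        proof -
          have "real i \<le> real m" using that Suc by simp
          then show ?thesis by (fastforce simp: mem_box)
        qed
        then show "(\<Union>i<k. box (- (real i *\<^sub>R One)) (real i *\<^sub>R One :: 'a)) \<subseteq> box (- (real m *\<^sub>R One)) (real m *\<^sub>R One)"
          by blast
      qed (use Suc in blast)
      then show ?thesis by (simp only: box)
    qed simp
  qed auto
  then have all: "(LINT x|lborel. g x) = 0"
    unfolding UN_box_eq_UNIV by simp
  have A: "(LINT x|lborel. indicator A x * g x) = 0" if "A \<in> sets borel" for A
  proof -
    have "Int_stable (range (\<lambda>(a, b). box a b :: 'a set))"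
      by (auto simp: Int_stable_def box_Int_box)
    moreover have "(range (\<lambda>(a, b). box a b :: 'a set)) \<subseteq> Pow UNIV" by auto
    moreover have "A \<in> sigma_sets UNIV (range (\<lambda>(a, b). box a b))"
      using that unfolding borel_eq_box by simp
    ultimately show ?thesis
    proof (induction rule: sigma_sets_induct_disjoint)
      case (basic A)
      then show ?case using box by auto
    next
      case empty
      then show ?case by simp
    next
      case (compl A)
      then have m: "A \<in> sets borel" by (simp add: borel_eq_box)
      have "indicator (UNIV - A) x * g x = g x - indicator A x * g x" for x
        by (auto split: split_indicator)
      then show ?case
        using intA[OF m] int compl.IH all by simp
    next
      case (union F)
      then have m: "\<And>i. F i \<in> sets borel" by (simp add: borel_eq_box subset_eq)
      have "(LINT x|lborel. indicator (\<Union>i<k. F i) x * g x) = 0" for k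
      proof -
        have "disjoint_family_on F {..<k}" using union.hyps(1) by (auto simp: disjoint_family_on_def)
        then have "indicator (\<Union>i<k. F i) x * g x = (\<Sum>i<k. indicator (F i) x * g x)" for x
          by (simp add: indicator_UN_disjoint sum_distrib_right)
        then have "(LINT x|lborel. indicator (\<Union>i<k. F i) x * g x)
            = (LINT x|lborel. (\<Sum>i<k. indicator (F i) x * g x))" by (simp only:)
        also have "\<dots> = (\<Sum>i<k. LINT x|lborel. indicator (F i) x * g x)"
          by (rule Bochner_Integration.integral_sum) (rule intA[OF m])
        finally show ?thesis using union.IH by simp
      qed
      then show ?case by (rule limit[OF m])
    qed
  qed
  have "AE x in lborel. indicator {x. g x > 0} x * g x = 0"
  proof -
    have m: "{x. g x > 0} \<in> sets borel" by measurable
    have "AE x in lborel. 0 \<le> indicator {x. g x > 0} x * g x" by (auto split: split_indicator)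
    from integral_nonneg_eq_0_iff_AE[OF intA[OF m] this] A[OF m] show ?thesis by simp
  qed
  moreover have "AE x in lborel. - (indicator {x. g x < 0} x * g x) = 0"
  proof -
    have m: "{x. g x < 0} \<in> sets borel" by measurable
    have "integrable lborel (\<lambda>x. - (indicator {x. g x < 0} x * g x))"
      using intA[OF m] by simp
    moreover have "AE x in lborel. 0 \<le> - (indicator {x. g x < 0} x * g x)"
      by (auto split: split_indicator)
    ultimately show ?thesis
      using integral_nonneg_eq_0_iff_AE[of lborel "\<lambda>x. - (indicator {x. g x < 0} x * g x)"] A[OF m]
      by simp
  qed
  ultimately show ?thesis
    by eventually_elim (auto split: split_indicator_asm)
qed

lemma L2_mult_integrable:
  assumes "f \<in> L2 \<Omega>" "g \<in> L2 \<Omega>"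
  shows "integrable (lebesgue_on \<Omega>) (\<lambda>x. f x * g x)"
proof (rule Bochner_Integration.integrable_bound)
  show "integrable (lebesgue_on \<Omega>) (\<lambda>x. (f x)\<^sup>2 + (g x)\<^sup>2)"
    using assms by (auto simp: L2_def)
  show "(\<lambda>x. f x * g x) \<in> borel_measurable (lebesgue_on \<Omega>)"
    using assms by (auto simp: L2_def)
  have "\<bar>a * b\<bar> \<le> a\<^sup>2 + b\<^sup>2" for a b :: real
  proof -
    have "2 * (\<bar>a\<bar> * \<bar>b\<bar>) \<le> a\<^sup>2 + b\<^sup>2" using sum_squares_bound[of "\<bar>a\<bar>" "\<bar>b\<bar>"] by simp
    moreover have "0 \<le> \<bar>a\<bar> * \<bar>b\<bar>" by simp
    ultimately show ?thesis unfolding abs_mult by linarith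
  qed
  then show "AE x in lebesgue_on \<Omega>. norm (f x * g x) \<le> norm ((f x)\<^sup>2 + (g x)\<^sup>2)"
    by auto
qed

lemma L2_bounded:
  assumes "f \<in> borel_measurable (lebesgue_on \<Omega>)" "\<Omega> \<in> lmeasurable" "\<And>x. x \<in> \<Omega> \<Longrightarrow> \<bar>f x\<bar> \<le> B"
  shows "f \<in> L2 \<Omega>"
proof -
  interpret finite_measure "lebesgue_on \<Omega>"
    using assms(2) by (rule finite_measure_lebesgue_on)
  have "integrable (lebesgue_on \<Omega>) (\<lambda>x. (f x)\<^sup>2)"
  proof (rule integrable_const_bound[where B = "B\<^sup>2"])
    show "AE x in lebesgue_on \<Omega>. norm ((f x)\<^sup>2) \<le> B\<^sup>2"
      using assms(3) by (auto intro!: AE_I2 abs_le_square_iff[THEN iffD1] simp: space_restrict_space) force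
  qed (use assms(1) in auto)
  then show ?thesis using assms by (simp add: L2_def)
qed

lemma L2_continuous:
  assumes "open \<Omega>" "bounded \<Omega>" "continuous_on (closure \<Omega>) f"
  shows "f \<in> L2 \<Omega>"
proof -
  have "compact (f ` closure \<Omega>)"
    using assms by (intro compact_continuous_image) (auto simp: compact_closure)
  then obtain B where B: "\<And>x. x \<in> \<Omega> \<Longrightarrow> \<bar>f x\<bar> \<le> B"
    using compact_imp_bounded[of "f ` closure \<Omega>"] closure_subset[of \<Omega>]
    by (auto simp: bounded_iff)
  have "f \<in> borel_measurable (lebesgue_on \<Omega>)"
    using assms by (intro continuous_imp_measurable_on_sets_lebesgue)
      (auto intro: continuous_on_subset[OF assms(3) closure_subset])
  then show ?thesis
    using B assms by (intro L2_bounded[where B = B] lmeasurable_open)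
qed

lemma test_function_L2:
  assumes "open \<Omega>" "bounded \<Omega>" "\<phi> \<in> test_functions \<Omega>" shows "\<phi> \<in> L2 \<Omega>"
  using assms by (intro L2_continuous smooth_continuous) (auto simp: test_functions_def)

text \<open>The fundamental lemma of the calculus of variations. Dominated convergence along
  \<open>box_bump\<close> turns orthogonality to test functions into vanishing integrals over boxes
  whose closed box lies in \<Omega>; localising to one such box gives \<open>g = 0\<close> there,
  and countably many of them cover \<Omega>.\<close>

lemma AE_zero_if_orthogonal_to_test_functions:
  assumes "open \<Omega>" and int: "integrable (lebesgue_on \<Omega>) g"
    and orth: "\<And>\<phi>. \<phi> \<in> test_functions \<Omega> \<Longrightarrow> (LINT x|lebesgue_on \<Omega>. g x * \<phi> x) = 0"
  shows "AE x in lebesgue_on \<Omega>. g x = 0"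
proof -
  have box0: "(LINT x|lebesgue_on \<Omega>. g x * indicator (box a b) x) = 0" if "cbox a b \<subseteq> \<Omega>" for a b
  proof -
    have [measurable]: "g \<in> borel_measurable (lebesgue_on \<Omega>)"
      using int by (rule borel_measurable_integrable)
    have [measurable]: "box_bump a b k \<in> borel_measurable (lebesgue_on \<Omega>)" for k
      using box_bump_test_function[OF that, of k] assms(1)
      by (intro continuous_imp_measurable_on_sets_lebesgue smooth_continuous)
        (auto simp: test_functions_def)
    have [measurable]: "indicator (box a b) \<in> borel_measurable (lebesgue_on \<Omega>)"
      by (intro measurable_restrict_space1 borel_measurable_indicator) auto
    have "(\<lambda>k. LINT x|lebesgue_on \<Omega>. g x * box_bump a b k x)
        \<longlonglongrightarrow> (LINT x|lebesgue_on \<Omega>. g x * indicator (box a b) x)"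
    proof (rule integral_dominated_convergence[where w = "\<lambda>x. \<bar>g x\<bar>"])
      show "AE x in lebesgue_on \<Omega>. (\<lambda>k. g x * box_bump a b k x) \<longlonglongrightarrow> g x * indicator (box a b) x"
        by (intro AE_I2 tendsto_mult_left box_bump_tendsto)
      show "AE x in lebesgue_on \<Omega>. norm (g x * box_bump a b k x) \<le> \<bar>g x\<bar>" for k
        using box_bump_bounds[of a b k] by (intro AE_I2) (simp add: abs_mult mult_left_le)
      show "integrable (lebesgue_on \<Omega>) (\<lambda>x. \<bar>g x\<bar>)" using int by simp
    qed measurable
    then show ?thesis
      using orth[OF box_bump_test_function[OF that]] by (simp add: LIMSEQ_const_iff)
  qed
  have aebox: "AE x in lebesgue. x \<in> box a b \<longrightarrow> g x = 0" if "cbox a b \<subseteq> \<Omega>" for a b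
  proof -
    let ?h = "\<lambda>x. indicator (box a b) x * g x"
    have sub: "box a b \<subseteq> \<Omega>" using that box_subset_cbox by blast
    have i\<Omega>: "integrable lebesgue (\<lambda>x. indicator \<Omega> x * g x)"
      using int assms(1) by (simp add: integrable_restrict_space)
    have "integrable lebesgue (\<lambda>x. indicator (box a b) x *\<^sub>R (indicator \<Omega> x * g x))"
      by (rule integrable_mult_indicator[OF _ i\<Omega>]) auto
    moreover have "(\<lambda>x. indicator (box a b) x *\<^sub>R (indicator \<Omega> x * g x)) = ?h"
      by (rule ext) (use sub in \<open>auto split: split_indicator\<close>)
    ultimately have ih: "integrable lebesgue ?h" by simp
    \<comment> \<open>\<open>g\<close> is only Lebesgue measurable, whereas the box criterion is
      about Borel functions; \<open>h\<close> is a Borel representative of \<open>g\<close> cut off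
      to the box.\<close>
    then obtain h where h [measurable]: "h \<in> borel_measurable lborel" and eq: "AE x in lborel. ?h x = h x"
      using completion_ex_borel_measurable_real[of ?h lborel] by (auto dest: borel_measurable_integrable)
    have eq': "AE x in lebesgue. ?h x = h x" using eq by (rule AE_completion)
    have "integrable lebesgue h"
      using ih by (rule integrable_cong_AE_imp) (use eq' in \<open>auto intro: measurable_completion\<close>)
    then have "integrable lborel h" by (simp add: integrable_completion)
    moreover have "(LINT x|lborel. indicator (box c d) x * h x) = 0" for c d
    proof -
      have "(LINT x|lborel. indicator (box c d) x * h x) = (LINT x|lebesgue. indicator (box c d) x * h x)"
        by (rule integral_completion[symmetric]) auto
      also have "\<dots> = (LINT x|lebesgue. indicator (box c d) x * ?h x)"
      proof (rule integral_cong_AE)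
        show "(\<lambda>x. indicator (box c d) x * h x) \<in> borel_measurable lebesgue"
          by (rule measurable_completion) measurable
        have "indicator (box c d) \<in> borel_measurable lebesgue"
          by (rule borel_measurable_indicator) auto
        then show "(\<lambda>x. indicator (box c d) x * ?h x) \<in> borel_measurable lebesgue"
          using borel_measurable_integrable[OF ih] by (rule borel_measurable_times)
        show "AE x in lebesgue. indicator (box c d) x * h x = indicator (box c d) x * ?h x"
          using eq' by eventually_elim simp
      qed
      also have "\<dots> = (LINT x|lebesgue. indicator \<Omega> x *\<^sub>R (g x * indicator (box c d \<inter> box a b) x))"
        by (rule Bochner_Integration.integral_cong) (use sub in \<open>auto split: split_indicator\<close>)
      also have "\<dots> = (LINT x|lebesgue_on \<Omega>. g x * indicator (box c d \<inter> box a b) x)"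
        by (subst integral_restrict_space) (use assms(1) in auto)
      also have "\<dots> = 0"
      proof -
        obtain c' d' where cd: "box c d \<inter> box a b = box c' d'"
          by (simp add: box_Int_box)
        show ?thesis
        \<comment> \<open>An empty open box can have a nonempty closed box that leaves \<Omega>, so
          only the nonempty case can pass through \<open>box0\<close>.\<close>
        proof (cases "box c' d' = {}")
          case False
          then have "cbox c' d' = closure (box c' d')" by simp
          also have "\<dots> \<subseteq> closure (box a b)" using cd by (intro closure_mono) auto
          also have "\<dots> \<subseteq> cbox a b" by (intro closure_minimal box_subset_cbox closed_cbox)
          finally show ?thesis unfolding cd using that by (intro box0) blast
        qed (simp add: cd)
      qed
      finally show ?thesis .
    qed
    ultimately have "AE x in lborel. h x = 0" by (rule AE_zero_if_box_integrals_zero)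
    then have "AE x in lebesgue. h x = 0" by (rule AE_completion)
    with eq' show ?thesis by eventually_elim auto
  qed
  have aecbox: "AE x in lebesgue. x \<in> cbox a b \<longrightarrow> g x = 0" if "cbox a b \<subseteq> \<Omega>" for a b
  proof -
    have "AE x in lebesgue. x \<notin> cbox a b - box a b"
      using negligible_frontier_interval[of a b]
      by (intro AE_not_in) (simp add: negligible_iff_null_sets)
    with aebox[OF that] show ?thesis by eventually_elim auto
  qed
  obtain D where D: "countable D" "D \<subseteq> Pow \<Omega>" "\<And>X. X \<in> D \<Longrightarrow> \<exists>a b. X = cbox a b" "\<Union>D = \<Omega>"
    by (rule open_countable_Union_open_cbox[OF assms(1)]) (rule that)
  have "AE x in lebesgue. x \<in> X \<longrightarrow> g x = 0" if "X \<in> D" for X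
    using D(2,3) that aecbox by blast
  then have "AE x in lebesgue. \<forall>X\<in>D. x \<in> X \<longrightarrow> g x = 0"
    by (subst AE_ball_countable[OF D(1)]) blast
  then have "AE x in lebesgue. x \<in> \<Omega> \<longrightarrow> g x = 0"
    by eventually_elim (use D(4) in blast)
  then show ?thesis
    using assms(1) by (subst AE_restrict_space_iff) auto
qed

text \<open>\<open>weak_partial\<close> picks one of many representatives; by uniqueness any weak
  derivative computed by hand agrees with the picked one almost everywhere.\<close>

lemma weak_partial_AE_unique:
  assumes "open \<Omega>" "bounded \<Omega>" "g \<in> L2 \<Omega>" "g' \<in> L2 \<Omega>"
    "is_weak_partial \<Omega> i f g" "is_weak_partial \<Omega> i f g'"
  shows "AE x in lebesgue_on \<Omega>. g x = g' x"
proof -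
  have one: "(\<lambda>x. 1::real) \<in> L2 \<Omega>"
    using assms by (intro L2_continuous) auto
  have "integrable (lebesgue_on \<Omega>) (\<lambda>x. g x - g' x)"
    using L2_mult_integrable[OF assms(3) one] L2_mult_integrable[OF assms(4) one] by simp
  moreover have "(LINT x|lebesgue_on \<Omega>. (g x - g' x) * \<phi> x) = 0" if "\<phi> \<in> test_functions \<Omega>" for \<phi>
  proof -
    have \<phi>: "\<phi> \<in> L2 \<Omega>" using test_function_L2 assms that by blast
    have "(LINT x|lebesgue_on \<Omega>. g x * \<phi> x) = (LINT x|lebesgue_on \<Omega>. g' x * \<phi> x)"
      using bspec[OF assms(5)[unfolded is_weak_partial_def] that]
        bspec[OF assms(6)[unfolded is_weak_partial_def] that] by simp
    then show ?thesis
      using L2_mult_integrable[OF assms(3) \<phi>] L2_mult_integrable[OF assms(4) \<phi>]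
      by (simp add: left_diff_distrib)
  qed
  ultimately have "AE x in lebesgue_on \<Omega>. g x - g' x = 0"
    by (rule AE_zero_if_orthogonal_to_test_functions[OF assms(1)])
  then show ?thesis by simp
qed

section \<open>Integration over lines parallel to an axis\<close>

definition other :: "2 \<Rightarrow> 2" where "other i = (if i = 1 then 2 else 1)"

lemma other_neq [simp]: "other i \<noteq> i" "i \<noteq> other i"
  by (auto simp: other_def)

lemma UNIV_other: "UNIV = {other i, i}"
  using exhaust_2[of i] by (auto simp: other_def UNIV_2)

lemma forall_other: "(\<forall>k. P k) \<longleftrightarrow> P (other i) \<and> P i"
  by (metis (full_types) exhaust_2 other_def)

text \<open>Coordinates for lines parallel to the \<open>i\<close>-th axis: \<open>s\<close> selects
  the line and \<open>r\<close> runs along it. Both axes are kept available, since the direction of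
  integration in the trace estimate depends on the direction of the band.\<close>

definition axis_pt :: "2 \<Rightarrow> real \<Rightarrow> real \<Rightarrow> real^2" where
  "axis_pt i s r = s *\<^sub>R axis (other i) 1 + r *\<^sub>R axis i 1"

lemma axis_pt_nth [simp]: "axis_pt i s r $ i = r" "axis_pt i s r $ other i = s"
  by (simp_all add: axis_pt_def axis_def)

lemma axis_pt_collapse [simp]: "axis_pt i (x $ other i) (x $ i) = x"
  unfolding vec_eq_iff forall_other[of _ i] by simp

lemma continuous_on_axis_pt: "continuous_on S (axis_pt i s)"
  unfolding axis_pt_def by (intro continuous_intros)

lemma measurable_axis_pt [measurable]:
  "(\<lambda>(s, r). axis_pt i s r) \<in> borel_measurable (lborel \<Otimes>\<^sub>M lborel)"
  "axis_pt i s \<in> borel_measurable lborel"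
  unfolding axis_pt_def by measurable

lemma prod_Basis_axis: "(\<Prod>b\<in>Basis. f b) = f (axis (other i) 1) * f (axis i (1::real))"
proof -
  have "(Basis :: (real^2) set) = {axis (other i) 1, axis i 1}"
    by (auto simp: Basis_vec_def) (metis UNIV_I UNIV_other insertE singletonD)
  moreover have "axis (other i) 1 \<noteq> (axis i 1 :: real^2)"
    by (simp add: axis_eq_axis)
  moreover have "prod f {axis (other i) 1, axis i 1} = f (axis (other i) 1) * f (axis i (1::real))"
    by (subst prod.insert) (auto simp: axis_eq_axis)
  ultimately show ?thesis by simp
qed

text \<open>This carries Fubini from the product measure to \<open>real^2\<close>: Lebesgue measure
  is determined by its values on boxes, and the preimage of a box is a product of intervals.\<close>

lemma distr_axis_pt: "distr (lborel \<Otimes>\<^sub>M lborel) borel (\<lambda>(s, r). axis_pt i s r) = lborel"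
proof (rule lborel_eqI[symmetric])
  fix l u :: "real^2" assume le: "\<And>b. b \<in> Basis \<Longrightarrow> l \<bullet> b \<le> u \<bullet> b"
  have le': "l $ k \<le> u $ k" for k
    using le[of "axis k 1"] by (simp add: inner_axis axis_in_Basis_iff)
  have "(\<lambda>(s, r). axis_pt i s r) -` box l u = box (l $ other i) (u $ other i) \<times> box (l $ i) (u $ i)"
    by (auto simp: mem_box_cart forall_other[of _ i])
  then have "emeasure (distr (lborel \<Otimes>\<^sub>M lborel) borel (\<lambda>(s, r). axis_pt i s r)) (box l u)
      = emeasure (lborel \<Otimes>\<^sub>M lborel) (box (l $ other i) (u $ other i) \<times> box (l $ i) (u $ i))"
    using emeasure_distr[OF measurable_axis_pt(1), of "box l u" i] by (simp add: space_pair_measure)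
  also have "\<dots> = ennreal (u $ other i - l $ other i) * ennreal (u $ i - l $ i)"
    using le'[of i] le'[of "other i"] by (subst lborel.emeasure_pair_measure_Times) simp_all
  also have "\<dots> = (\<Prod>b\<in>Basis. (u - l) \<bullet> b)"
    using le' by (subst prod_Basis_axis[of _ i]) (simp add: inner_axis ennreal_mult)
  finally show "emeasure (distr (lborel \<Otimes>\<^sub>M lborel) borel (\<lambda>(s, r). axis_pt i s r)) (box l u)
      = (\<Prod>b\<in>Basis. (u - l) \<bullet> b)" .
qed simp

lemma
  fixes f :: "real^2 \<Rightarrow> real"
  assumes "integrable lborel f"
  shows AE_integrable_axis_line: "AE s in lborel. integrable lborel (\<lambda>r. f (axis_pt i s r))"
    and integrable_axis_lines: "integrable lborel (\<lambda>s. LINT r|lborel. f (axis_pt i s r))"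
    and integral_axis_lines: "(LINT x|lborel. f x) = (LINT s|lborel. LINT r|lborel. f (axis_pt i s r))"
proof -
  have [measurable]: "f \<in> borel_measurable borel"
    using borel_measurable_integrable[OF assms] by simp
  have "integrable (distr (lborel \<Otimes>\<^sub>M lborel) borel (\<lambda>(s, r). axis_pt i s r)) f"
    using assms by (simp add: distr_axis_pt)
  then have int: "integrable (lborel \<Otimes>\<^sub>M lborel) (\<lambda>(s, r). f (axis_pt i s r))"
    by (subst (asm) integrable_distr_eq) (auto simp: case_prod_unfold)
  show "AE s in lborel. integrable lborel (\<lambda>r. f (axis_pt i s r))"
    using lborel_pair.AE_integrable_fst'[OF int] by simp
  show "integrable lborel (\<lambda>s. LINT r|lborel. f (axis_pt i s r))"
    using lborel_pair.integrable_fst'[OF int] by simp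
  have "(LINT x|lborel. f x) = (LINT x|distr (lborel \<Otimes>\<^sub>M lborel) borel (\<lambda>(s, r). axis_pt i s r). f x)"
    by (simp add: distr_axis_pt)
  also have "\<dots> = (LINT z|(lborel \<Otimes>\<^sub>M lborel). f (axis_pt i (fst z) (snd z)))"
    by (subst integral_distr) (auto simp: case_prod_unfold)
  also have "\<dots> = (LINT s|lborel. LINT r|lborel. f (axis_pt i s r))"
    using lborel_pair.integral_fst'[OF int] by (simp add: case_prod_unfold)
  finally show "(LINT x|lborel. f x) = (LINT s|lborel. LINT r|lborel. f (axis_pt i s r))" .
qed

lemma AE_axis_lines:
  assumes "AE x in lborel. P x"
  shows "AE s in lborel. AE r in lborel. P (axis_pt i s r)"
proof -
  have "AE x in distr (lborel \<Otimes>\<^sub>M lborel) borel (\<lambda>(s, r). axis_pt i s r). P x"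
    using assms unfolding distr_axis_pt by this
  then have "AE z in lborel \<Otimes>\<^sub>M lborel. P (case z of (s, r) \<Rightarrow> axis_pt i s r)"
    by (rule AE_distrD[rotated]) measurable
  then show ?thesis using lborel_pair.AE_pair by fastforce
qed

text \<open>A segment of such a slice that misses the interior would lie in the frontier, which is a null set.\<close>

lemma AE_finite_frontier_slice:
  fixes K :: "(real^2) set"
  assumes "compact K" "convex K"
  shows "AE s in lborel. finite {r. axis_pt i s r \<in> frontier K}"
proof -
  have "negligible (frontier K)" by (rule negligible_convex_frontier[OF assms(2)])
  then have "AE x in lborel. x \<notin> frontier K"
    using AE_not_in[of "frontier K" lebesgue] by (simp add: negligible_iff_null_sets AE_completion_iff)
  then have "AE s in lborel. AE r in lborel. axis_pt i s r \<notin> frontier K"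
    by (rule AE_axis_lines)
  then show ?thesis
  proof eventually_elim
    case (elim s)
    have cl: "closed K" by (simp add: assms compact_imp_closed)
    define S where "S = {r. axis_pt i s r \<in> K}"
    have fS: "{r. axis_pt i s r \<in> frontier K} \<subseteq> S"
      using cl frontier_subset_closed by (auto simp: S_def)
    have lin: "axis_pt i s ((1 - t) * a + t * b) = (1 - t) *\<^sub>R axis_pt i s a + t *\<^sub>R axis_pt i s b" for t a b
      unfolding axis_pt_def by (simp add: algebra_simps)
    have seg: "axis_pt i s ` open_segment a b \<subseteq> open_segment (axis_pt i s a) (axis_pt i s b)" for a b
    proof -
      have "axis_pt i s a \<noteq> axis_pt i s b" if "a \<noteq> b"
        using that axis_pt_nth(1) by metis
      then show ?thesis
        by (auto simp: in_segment lin[symmetric])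
    qed
    have "convex S"
      using assms(2) lin by (auto simp: S_def convex_alt)
    moreover have "closed S"
      unfolding S_def using continuous_closed_vimage[OF cl, of "axis_pt i s"] continuous_on_axis_pt[of UNIV i s]
      by (simp add: vimage_def continuous_on_eq_continuous_at)
    moreover have "bounded S"
    proof -
      obtain B where B: "\<And>x. x \<in> K \<Longrightarrow> norm x \<le> B"
        using assms(1) compact_imp_bounded bounded_iff by metis
      have "\<bar>r\<bar> \<le> B" if "r \<in> S" for r
        using B[of "axis_pt i s r"] that component_le_norm_cart[of "axis_pt i s r" i] by (auto simp: S_def)
      then show ?thesis by (auto simp: bounded_iff)
    qed
    ultimately obtain p q where S: "S = {p..q}"
      using connected_compact_interval_1[of S] by (auto simp: compact_eq_bounded_closed convex_connected)
    have "{r. axis_pt i s r \<in> frontier K} \<subseteq> {p, q}"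
    proof (rule ccontr)
      assume "\<not> ?thesis"
      then obtain r where r: "axis_pt i s r \<in> frontier K" "p < r" "r < q"
        using fS S by force
      have "\<not> (AE r in lborel. r \<notin> {p<..<q})"
        using r by (subst AE_iff_null_sets[symmetric]) auto
      have "\<exists>r'. p < r' \<and> r' < q \<and> axis_pt i s r' \<notin> frontier K"
      proof (rule ccontr)
        assume "\<not> ?thesis"
        then have "axis_pt i s r' \<in> frontier K" if "r' \<in> {p<..<q}" for r' using that by auto
        then have "AE r in lborel. r \<notin> {p<..<q}"
          using elim by (auto elim!: eventually_mono)
        then show False using \<open>\<not> (AE r in lborel. r \<notin> {p<..<q})\<close> by simp
      qed
      then obtain r' where r': "p < r'" "r' < q" "axis_pt i s r' \<notin> frontier K" by blast
      then have int: "axis_pt i s r' \<in> interior K"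
        using S cl unfolding frontier_def by (auto simp: S_def set_eq_iff closure_closed)
      have "r \<noteq> r'" using r r' by auto
      \<comment> \<open>\<open>e\<close> is the end of the slice beyond \<open>r\<close> as seen
        from \<open>r'\<close>. So \<open>r\<close> lies on an open segment from an interior point
        to a point of the closure, and such segments stay in the interior.\<close>
      define e where "e = (if r < r' then p else q)"
      have "r \<in> open_segment r' e" "e \<in> S"
        using r r' \<open>r \<noteq> r'\<close> S by (auto simp: e_def open_segment_eq_real_ivl)
      then have "axis_pt i s r \<in> open_segment (axis_pt i s r') (axis_pt i s e)" "axis_pt i s e \<in> closure K"
        using seg closure_subset[of K] by (auto simp: S_def)
      then have "axis_pt i s r \<in> interior K"
        using in_interior_closure_convex_segment[OF assms(2) int] by blast
      then show False using r(1) by (simp add: frontier_def)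
    qed
    then show ?case by (rule finite_subset) simp
  qed
qed

section \<open>Weak derivatives of piecewise polynomial functions\<close>

lemma integral_lebesgue_on_open:
  fixes g :: "real^2 \<Rightarrow> real"
  assumes "open \<Omega>" "(\<lambda>x. indicator \<Omega> x * g x) \<in> borel_measurable borel"
  shows "(LINT x|lebesgue_on \<Omega>. g x) = (LINT x|lborel. indicator \<Omega> x * g x)"
proof -
  have "(LINT x|lebesgue_on \<Omega>. g x) = (LINT x|lebesgue. indicator \<Omega> x *\<^sub>R g x)"
    using assms(1) by (intro integral_restrict_space) auto
  also have "\<dots> = (LINT x|lborel. indicator \<Omega> x * g x)"
    using assms(2) by (simp add: integral_completion)
  finally show ?thesis .
qed

lemma simplex_2_interior_nonempty:
  assumes "2 simplex (K :: (real^2) set)" shows "interior K \<noteq> {}"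
proof -
  obtain C where C: "\<not> affine_dependent C" "int (card C) = 2 + 1" "K = convex hull C"
    using assms unfolding simplex_def by blast
  then have "card C = Suc DIM(real^2)" by simp
  then show ?thesis using C by (simp add: interior_convex_hull_eq_empty)
qed

locale mesh =
  fixes \<Omega> :: "(real^2) set" and \<T> :: "(real^2) set set"
  assumes open_dom: "open \<Omega>" and bounded_dom: "bounded \<Omega>" and connected_dom: "connected \<Omega>"
    and nonempty_dom: "\<Omega> \<noteq> {}" and negligible_frontier: "negligible (frontier \<Omega>)"
    and conforming: "conforming_triangulation \<Omega> \<T>"
begin

lemma finite_mesh: "finite \<T>"
  using conforming by (simp add: conforming_triangulation_def triangulation_def)

lemma Union_mesh: "\<Union>\<T> = closure \<Omega>"
  using conforming by (simp add: conforming_triangulation_def)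

lemma simplex_cell: "K \<in> \<T> \<Longrightarrow> 2 simplex K"
  using conforming by (simp add: conforming_triangulation_def)

lemma compact_cell: "K \<in> \<T> \<Longrightarrow> compact K"
  using simplex_cell compact_simplex by blast

lemma convex_cell: "K \<in> \<T> \<Longrightarrow> convex K"
  using simplex_cell convex_simplex by blast

lemma interior_cell_nonempty: "K \<in> \<T> \<Longrightarrow> interior K \<noteq> {}"
  using simplex_cell simplex_2_interior_nonempty by blast

lemma cell_subset: "K \<in> \<T> \<Longrightarrow> K \<subseteq> closure \<Omega>"
  using Union_mesh by blast

lemma mesh_face: "K \<in> \<T> \<Longrightarrow> K' \<in> \<T> \<Longrightarrow> K \<inter> K' face_of K"
  using conforming by (simp add: conforming_triangulation_def triangulation_def)

text \<open>\<open>K \<inter> K'\<close> is a face of \<open>K\<close> that meets the interior of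
  \<open>K\<close>, hence all of \<open>K\<close>. If \<open>K\<close> and \<open>K'\<close>
  differed, \<open>K\<close> would be a proper face of \<open>K'\<close> and miss its interior,
  although \<open>interior K\<close> is contained in it.\<close>

lemma interior_cell_disjoint:
  assumes "K \<in> \<T>" "K' \<in> \<T>" "x \<in> interior K" "x \<in> K'"
  shows "K = K'"
proof (rule ccontr)
  assume neq: "K \<noteq> K'"
  have "K \<inter> K' = K"
    using face_of_disjoint_interior[OF mesh_face[OF assms(1,2)]] assms interior_subset by blast
  moreover have "K' \<inter> K face_of K'" using mesh_face[OF assms(2,1)] .
  ultimately have "K face_of K'" by (simp add: Int_commute)
  then have "K \<inter> interior K' = {}" using face_of_disjoint_interior neq by blast
  moreover have "interior K \<subseteq> interior K'" using \<open>K \<inter> K' = K\<close> by (metis inf.absorb_iff1 interior_mono)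
  ultimately show False using interior_cell_nonempty[OF assms(1)] interior_subset by blast
qed

lemma obtain_interior_cell:
  assumes "x \<in> closure \<Omega>" "x \<notin> (\<Union>K\<in>\<T>. frontier K)"
  obtains K where "K \<in> \<T>" "x \<in> interior K"
proof -
  obtain K where K: "K \<in> \<T>" "x \<in> K" using assms(1) Union_mesh by blast
  then have "x \<in> interior K"
    using assms(2) closure_subset by (auto simp: frontier_def)
  with K show ?thesis using that by blast
qed

lemma AE_finite_skeleton_slice: "AE s in lborel. finite {r. axis_pt i s r \<in> (\<Union>K\<in>\<T>. frontier K)}"
proof -
  have "AE s in lborel. \<forall>K\<in>\<T>. finite {r. axis_pt i s r \<in> frontier K}"
    using finite_mesh compact_cell convex_cell
    by (intro AE_finite_allI AE_finite_frontier_slice) auto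
  then show ?thesis
  proof eventually_elim
    case (elim s)
    have "{r. axis_pt i s r \<in> (\<Union>K\<in>\<T>. frontier K)} = (\<Union>K\<in>\<T>. {r. axis_pt i s r \<in> frontier K})"
      by auto
    then show ?case using elim finite_mesh by simp
  qed
qed

text \<open>The functions needed below (the given solution, finite element functions and their
  differences) are all continuous and of the form \<open>\<sigma> |x|\<^sup>2 + A K \<bullet> x + c\<close> on each cell \<open>K\<close>, with the
  same \<open>\<sigma>\<close> for all cells.\<close>

definition cellwise :: "(real^2 \<Rightarrow> real) \<Rightarrow> real \<Rightarrow> ((real^2) set \<Rightarrow> real^2) \<Rightarrow> bool" where
  "cellwise f \<sigma> A \<longleftrightarrow> continuous_on (closure \<Omega>) f \<and>
     (\<forall>K\<in>\<T>. \<exists>c. \<forall>x\<in>K. f x = \<sigma> * (x \<bullet> x) + A K \<bullet> x + c)"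

text \<open>The classical gradient cell by cell, set to 0 on the skeleton and outside \<Omega>.
  Written with indicators it is a Borel function on the whole plane, to which Fubini for
  \<open>lborel\<close> applies directly.\<close>

definition cell_grad :: "real \<Rightarrow> ((real^2) set \<Rightarrow> real^2) \<Rightarrow> 2 \<Rightarrow> real^2 \<Rightarrow> real" where
  "cell_grad \<sigma> A i x = (\<Sum>K\<in>\<T>. indicator (interior K \<inter> \<Omega>) x * (2 * \<sigma> * x $ i + A K $ i))"

lemma cell_grad_interior:
  assumes "K \<in> \<T>" "x \<in> interior K" "x \<in> \<Omega>"
  shows "cell_grad \<sigma> A i x = 2 * \<sigma> * x $ i + A K $ i"
proof -
  have "indicator (interior K' \<inter> \<Omega>) x = (0::real)" if "K' \<in> \<T>" "K' \<noteq> K" for K'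
    using interior_cell_disjoint[OF assms(1) that(1) assms(2)] interior_subset that
    by (auto simp: indicator_def)
  then have "cell_grad \<sigma> A i x = (\<Sum>K'\<in>\<T>. if K' = K then 2 * \<sigma> * x $ i + A K $ i else 0)"
    unfolding cell_grad_def using assms by (intro sum.cong) auto
  then show ?thesis using assms(1) finite_mesh by simp
qed

lemma cell_grad_outside: "x \<notin> \<Omega> \<Longrightarrow> cell_grad \<sigma> A i x = 0"
  by (simp add: cell_grad_def)

lemma cell_grad_measurable [measurable]: "cell_grad \<sigma> A i \<in> borel_measurable borel"
proof -
  have [measurable]: "interior K \<inter> \<Omega> \<in> sets borel" for K
    using open_dom by auto
  show ?thesis unfolding cell_grad_def by measurable
qed

lemma dom_norm_bound: obtains R where "R > 0" "\<And>x. x \<in> closure \<Omega> \<Longrightarrow> norm x < R"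
proof -
  obtain B where "\<And>x. x \<in> closure \<Omega> \<Longrightarrow> norm x \<le> B"
    using bounded_dom bounded_closure bounded_iff by metis
  then show ?thesis by (intro that[of "\<bar>B\<bar> + 1"]) (auto, smt (verit))
qed

lemma cell_grad_bounded: obtains B where "\<And>x. \<bar>cell_grad \<sigma> A i x\<bar> \<le> B"
proof -
  obtain R where R: "R > 0" "\<And>x. x \<in> closure \<Omega> \<Longrightarrow> norm x < R" using dom_norm_bound by blast
  have "\<bar>indicator (interior K \<inter> \<Omega>) x * (2 * \<sigma> * x $ i + A K $ i)\<bar> \<le> 2 * \<bar>\<sigma>\<bar> * R + \<bar>A K $ i\<bar>" for K x
  proof (cases "x \<in> interior K \<inter> \<Omega>")
    case True
    then have "\<bar>x $ i\<bar> \<le> R"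
      using R(2)[of x] closure_subset component_le_norm_cart[of x i] by fastforce
    then have "\<bar>2 * \<sigma> * x $ i\<bar> \<le> 2 * \<bar>\<sigma>\<bar> * R"
      by (simp add: abs_mult mult_left_mono)
    then show ?thesis using True by simp
  qed (use R in simp)
  then have "\<bar>cell_grad \<sigma> A i x\<bar> \<le> (\<Sum>K\<in>\<T>. 2 * \<bar>\<sigma>\<bar> * R + \<bar>A K $ i\<bar>)" for x
    unfolding cell_grad_def by (intro order.trans[OF sum_abs] sum_mono)
  then show ?thesis using that by blast
qed

lemma cell_grad_L2: "cell_grad \<sigma> A i \<in> L2 \<Omega>"
proof -
  obtain B1 where "\<And>x. \<bar>cell_grad \<sigma> A i x\<bar> \<le> B1" using cell_grad_bounded by blast
  then show ?thesis
    by (intro L2_bounded[where B = B1] lmeasurable_open open_dom bounded_dom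
        measurable_restrict_space1 measurable_completion) auto
qed

lemma cellwise_has_derivative:
  assumes "cellwise f \<sigma> A" "K \<in> \<T>" "x \<in> interior K"
  shows "(f has_derivative (\<lambda>h. (2 * \<sigma>) *\<^sub>R x \<bullet> h + A K \<bullet> h)) (at x)"
proof -
  obtain c where c: "\<forall>x\<in>K. f x = \<sigma> * (x \<bullet> x) + A K \<bullet> x + c"
    using assms by (auto simp: cellwise_def)
  have "((\<lambda>x. \<sigma> * (x \<bullet> x) + A K \<bullet> x + c) has_derivative (\<lambda>h. (2 * \<sigma>) *\<^sub>R x \<bullet> h + A K \<bullet> h)) (at x)"
    by (auto intro!: derivative_eq_intros simp: inner_commute algebra_simps)
  then show ?thesis
    by (rule has_derivative_transform_within_open[where s = "interior K"])
      (use assms c interior_subset[of K] in auto)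
qed

lemma cellwise_line_derivative:
  assumes "cellwise f \<sigma> A" "axis_pt i s r \<in> \<Omega>" "axis_pt i s r \<notin> (\<Union>K\<in>\<T>. frontier K)"
  shows "((\<lambda>r. f (axis_pt i s r)) has_real_derivative cell_grad \<sigma> A i (axis_pt i s r)) (at r)"
proof -
  have "axis_pt i s r \<in> closure \<Omega>" using assms(2) closure_subset by blast
  then obtain K where K: "K \<in> \<T>" "axis_pt i s r \<in> interior K"
    using obtain_interior_cell assms(3) by blast
  have line: "(axis_pt i s has_derivative (\<lambda>h. h *\<^sub>R axis i 1)) (at r)"
    unfolding axis_pt_def by (auto intro!: derivative_eq_intros)
  have "((\<lambda>r. f (axis_pt i s r)) has_derivative
      (\<lambda>h. (2 * \<sigma>) *\<^sub>R axis_pt i s r \<bullet> (h *\<^sub>R axis i 1) + A K \<bullet> (h *\<^sub>R axis i 1))) (at r)"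
    by (rule has_derivative_compose[OF line cellwise_has_derivative[OF assms(1) K]])
  moreover have "(\<lambda>h. (2 * \<sigma>) *\<^sub>R axis_pt i s r \<bullet> (h *\<^sub>R axis i 1) + A K \<bullet> (h *\<^sub>R axis i 1))
      = (*) (cell_grad \<sigma> A i (axis_pt i s r))"
    using cell_grad_interior[OF K assms(2), of \<sigma> A i]
    by (auto simp: inner_axis algebra_simps fun_eq_iff)
  ultimately show ?thesis by (simp add: has_field_derivative_def)
qed

text \<open>On almost every line parallel to the \<open>i\<close>-th axis the product of
  \<open>f\<close> with a test function is continuous, and differentiable up to finitely many
  points, so the fundamental theorem of calculus applies across the cells. Continuity of
  \<open>f\<close> excludes jump terms, and the compact support removes the end terms.\<close>

lemma cellwise_weak_partial:
  assumes f: "cellwise f \<sigma> A"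
  shows "is_weak_partial \<Omega> i f (cell_grad \<sigma> A i)"
  unfolding is_weak_partial_def
proof
  fix \<phi> assume \<phi>: "\<phi> \<in> test_functions \<Omega>"
  define S where "S = closure {x. \<phi> x \<noteq> 0}"
  have S: "compact S" "S \<subseteq> \<Omega>" "smooth \<phi>"
    using \<phi> by (auto simp: test_functions_def S_def)
  have \<phi>S: "\<phi> x = 0" if "x \<notin> S" for x
    using that closure_subset[of "{x. \<phi> x \<noteq> 0}"] by (auto simp: S_def)
  have pS: "partial i \<phi> x = 0" if "x \<notin> S" for x
    using that partial_zero_outside_support by (auto simp: S_def)
  have fc: "continuous_on \<Omega> f"
    using f continuous_on_subset[OF _ closure_subset] by (auto simp: cellwise_def)
  \<comment> \<open>Extension by 0: its product with \<phi> is continuous on the whole plane because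
    the support of \<phi> is a compact subset of \<Omega>.\<close>
  define F where "F x = indicator \<Omega> x * f x" for x
  have Fm [measurable]: "F \<in> borel_measurable borel"
    using borel_measurable_continuous_on_indicator[OF _ fc] open_dom by (simp add: F_def[abs_def])
  have [measurable]: "\<phi> \<in> borel_measurable borel" "partial i \<phi> \<in> borel_measurable borel"
    using S(3) by (intro borel_measurable_continuous_onI smooth_continuous smooth_partial; simp)+
  \<comment> \<open>The derivative of \<open>F x * \<phi> x\<close> in direction \<open>i\<close>
    off the skeleton; that its integral vanishes is the claim.\<close>
  define G where "G x = F x * partial i \<phi> x + cell_grad \<sigma> A i x * \<phi> x" for x
  have Gm [measurable]: "G \<in> borel_measurable borel" unfolding G_def[abs_def] by measurable
  have GS: "G x = 0" if "x \<notin> S" for x using that by (simp add: G_def \<phi>S pS)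
  obtain R where R: "R > 0" "\<And>x. x \<in> closure \<Omega> \<Longrightarrow> norm x < R" using dom_norm_bound by blast
  have line: "((\<lambda>r. F (axis_pt i s r) * \<phi> (axis_pt i s r)) has_real_derivative G (axis_pt i s r)) (at r)"
    if nf: "axis_pt i s r \<notin> (\<Union>K\<in>\<T>. frontier K)" for s r
  proof (cases "axis_pt i s r \<in> \<Omega>")
    case True
    have line: "(axis_pt i s has_derivative (\<lambda>h. h *\<^sub>R axis i 1)) (at r)"
      unfolding axis_pt_def by (auto intro!: derivative_eq_intros)
    have "((\<lambda>r. \<phi> (axis_pt i s r)) has_derivative
        (\<lambda>h. frechet_derivative \<phi> (at (axis_pt i s r)) (h *\<^sub>R axis i 1))) (at r)"
      by (rule has_derivative_compose[OF line smooth_has_derivative[OF S(3)]])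
    moreover have "frechet_derivative \<phi> (at (axis_pt i s r)) (h *\<^sub>R axis i 1) = partial i \<phi> (axis_pt i s r) * h" for h
      using linear_cmul[OF has_derivative_linear[OF smooth_has_derivative[OF S(3)]]]
      by (simp add: partial_def)
    ultimately have "((\<lambda>r. \<phi> (axis_pt i s r)) has_real_derivative partial i \<phi> (axis_pt i s r)) (at r)"
      by (simp add: has_field_derivative_def)
    from DERIV_mult[OF cellwise_line_derivative[OF f True nf] this]
    have "((\<lambda>r. f (axis_pt i s r) * \<phi> (axis_pt i s r)) has_real_derivative G (axis_pt i s r)) (at r)"
      using True by (simp add: G_def F_def algebra_simps)
    then show ?thesis
    proof (rule has_field_derivative_transform_within_open[where S = "axis_pt i s -` \<Omega>"])
      show "open (axis_pt i s -` \<Omega>)"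
        using continuous_on_axis_pt[of UNIV i s] open_dom
        by (intro open_vimage) auto
    qed (use True in \<open>auto simp: F_def\<close>)
  next
    case False
    then have nS: "axis_pt i s r \<notin> S" using S by blast
    have "((\<lambda>r. 0) has_real_derivative G (axis_pt i s r)) (at r)"
      using GS[OF nS] by simp
    then show ?thesis
    proof (rule has_field_derivative_transform_within_open[where S = "axis_pt i s -` (- S)"])
      show "open (axis_pt i s -` (- S))"
        using continuous_on_axis_pt[of UNIV i s] S(1) compact_imp_closed
        by (intro open_vimage) auto
    qed (use nS \<phi>S in auto)
  qed
  have cont: "continuous_on UNIV (\<lambda>x. F x * \<phi> x)"
  proof -
    have "continuous_on (\<Omega> \<union> - S) (\<lambda>x. F x * \<phi> x)"
    proof (rule continuous_on_open_Un)
      show "open (- S)" using S(1) compact_imp_closed by blast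
      have "continuous_on \<Omega> (\<lambda>x. f x * \<phi> x)"
        using fc smooth_continuous[OF S(3)] by (intro continuous_on_mult)
      then show "continuous_on \<Omega> (\<lambda>x. F x * \<phi> x)"
        by (rule continuous_on_eq) (simp add: F_def)
      have "continuous_on (- S) (\<lambda>x. 0::real)" by simp
      then show "continuous_on (- S) (\<lambda>x. F x * \<phi> x)"
        by (rule continuous_on_eq) (simp add: \<phi>S)
    qed (rule open_dom)
    moreover have "\<Omega> \<union> - S = UNIV" using S(2) by blast
    ultimately show ?thesis by simp
  qed
  have Gint: "integrable lborel G"
  proof -
    obtain B1 where B1: "\<And>x. \<bar>cell_grad \<sigma> A i x\<bar> \<le> B1" using cell_grad_bounded by blast
    have bd: "\<exists>B. \<forall>x\<in>S. \<bar>g x\<bar> \<le> B" if "continuous_on S g" for g :: "real^2 \<Rightarrow> real"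
      using compact_imp_bounded[OF compact_continuous_image[OF that S(1)]] by (auto simp: bounded_iff)
    obtain B2 where B2: "\<forall>x\<in>S. \<bar>f x\<bar> \<le> B2" using bd continuous_on_subset[OF fc S(2)] by blast
    obtain B3 where B3: "\<forall>x\<in>S. \<bar>\<phi> x\<bar> \<le> B3" using bd smooth_continuous[OF S(3)] by blast
    obtain B4 where B4: "\<forall>x\<in>S. \<bar>partial i \<phi> x\<bar> \<le> B4"
      using bd smooth_continuous[OF smooth_partial[OF S(3)]] by blast
    have "integrable lborel (\<lambda>x. indicator S x *\<^sub>R (B2 * B4 + B1 * B3))"
      using S(1) by (intro integrable_real_indicator integrable_scaleR_left emeasure_compact_finite)
        (auto simp: compact_imp_closed)
    then show ?thesis
    proof (rule Bochner_Integration.integrable_bound)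
      show "AE x in lborel. norm (G x) \<le> norm (indicator S x *\<^sub>R (B2 * B4 + B1 * B3))"
      proof (rule AE_I2)
        fix x
        show "norm (G x) \<le> norm (indicator S x *\<^sub>R (B2 * B4 + B1 * B3))"
        proof (cases "x \<in> S")
          case True
          then have "\<bar>F x * partial i \<phi> x\<bar> \<le> B2 * B4" "\<bar>cell_grad \<sigma> A i x * \<phi> x\<bar> \<le> B1 * B3"
            using B1[of x] B2 B3 B4 S(2)
            by (auto simp: F_def abs_mult indicator_def intro!: mult_mono order.trans[OF abs_ge_zero])
          then show ?thesis using True by (simp add: G_def)
        qed (simp add: GS)
      qed
    qed measurable
  qed
  have "(LINT x|lborel. G x) = (LINT s|lborel. LINT r|lborel. G (axis_pt i s r))"
    by (rule integral_axis_lines[OF Gint])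
  also have "\<dots> = 0"
  proof (rule integral_eq_zero_AE)
    show "AE s in lborel. (LINT r|lborel. G (axis_pt i s r)) = 0"
      using AE_finite_skeleton_slice[of i] AE_integrable_axis_line[OF Gint, of i]
    proof eventually_elim
      case (elim s)
      let ?g = "\<lambda>r. F (axis_pt i s r) * \<phi> (axis_pt i s r)"
      have out: "axis_pt i s r \<notin> S" if "R \<le> \<bar>r\<bar>" for r
        using R(2)[of "axis_pt i s r"] component_le_norm_cart[of "axis_pt i s r" i] that S(2) closure_subset
        by fastforce
      have "((\<lambda>r. G (axis_pt i s r)) has_integral (?g R - ?g (- R))) {-R..R}"
      proof (rule fundamental_theorem_of_calculus_interior_strong[OF elim(1)])
        show "continuous_on {-R..R} ?g"
          using continuous_on_compose2[OF cont continuous_on_axis_pt] by simp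
      qed (use R line in \<open>auto simp: has_real_derivative_iff_has_vector_derivative[symmetric]\<close>)
      moreover have "?g R = 0" "?g (- R) = 0" using out[of R] out[of "- R"] R(1) \<phi>S by auto
      ultimately have "((\<lambda>r. G (axis_pt i s r)) has_integral 0) {-R..R}" by simp
      then have "((\<lambda>r. G (axis_pt i s r)) has_integral 0) UNIV"
        by (rule has_integral_on_superset) (use out GS in \<open>auto simp: abs_le_iff not_le\<close>)
      moreover have "((\<lambda>r. G (axis_pt i s r)) has_integral (LINT r|lborel. G (axis_pt i s r))) UNIV"
        by (rule has_integral_integral_lborel[OF elim(2)])
      ultimately show ?case by (rule has_integral_unique[symmetric])
    qed
  qed
  finally have zero: "(LINT x|lborel. G x) = 0" .
  have \<phi>L: "\<phi> \<in> L2 \<Omega>" "partial i \<phi> \<in> L2 \<Omega>"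
    using test_function_L2 test_function_partial open_dom bounded_dom \<phi> by blast+
  have fL: "f \<in> L2 \<Omega>" using L2_continuous open_dom bounded_dom f by (auto simp: cellwise_def)
  note gL = cell_grad_L2[of \<sigma> A i]
  have "(LINT x|lebesgue_on \<Omega>. f x * partial i \<phi> x + cell_grad \<sigma> A i x * \<phi> x)
      = (LINT x|lborel. indicator \<Omega> x * (f x * partial i \<phi> x + cell_grad \<sigma> A i x * \<phi> x))"
  proof (rule integral_lebesgue_on_open[OF open_dom])
    have "(\<lambda>x. indicator \<Omega> x * (f x * partial i \<phi> x + cell_grad \<sigma> A i x * \<phi> x)) = G"
      by (auto simp: G_def F_def fun_eq_iff indicator_def cell_grad_outside)
    then show "(\<lambda>x. indicator \<Omega> x * (f x * partial i \<phi> x + cell_grad \<sigma> A i x * \<phi> x)) \<in> borel_measurable borel"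
      using Gm by simp
  qed
  also have "(\<lambda>x. indicator \<Omega> x * (f x * partial i \<phi> x + cell_grad \<sigma> A i x * \<phi> x)) = G"
    by (auto simp: G_def F_def fun_eq_iff indicator_def cell_grad_outside)
  finally have "(LINT x|lebesgue_on \<Omega>. f x * partial i \<phi> x + cell_grad \<sigma> A i x * \<phi> x) = 0"
    using zero by simp
  then show "(LINT x|lebesgue_on \<Omega>. f x * partial i \<phi> x) = - (LINT x|lebesgue_on \<Omega>. cell_grad \<sigma> A i x * \<phi> x)"
    using L2_mult_integrable[OF fL \<phi>L(2)] L2_mult_integrable[OF gL \<phi>L(1)] by simp
qed

lemma cellwise_L2: "cellwise f \<sigma> A \<Longrightarrow> f \<in> L2 \<Omega>"
  using L2_continuous open_dom bounded_dom by (auto simp: cellwise_def)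

lemma cellwise_H1: "cellwise f \<sigma> A \<Longrightarrow> f \<in> H1 \<Omega>"
  using cellwise_L2 cell_grad_L2 cellwise_weak_partial unfolding H1_def by blast

lemma weak_partial_H1:
  assumes "f \<in> H1 \<Omega>"
  shows "weak_partial \<Omega> i f \<in> L2 \<Omega>" "is_weak_partial \<Omega> i f (weak_partial \<Omega> i f)"
proof -
  have "\<exists>g. g \<in> L2 \<Omega> \<and> is_weak_partial \<Omega> i f g" using assms by (auto simp: H1_def)
  from someI_ex[OF this]
  show "weak_partial \<Omega> i f \<in> L2 \<Omega>" "is_weak_partial \<Omega> i f (weak_partial \<Omega> i f)"
    unfolding weak_partial_def by blast+
qed

lemma cellwise_weak_partial_AE:
  assumes "cellwise f \<sigma> A"
  shows "AE x in lebesgue_on \<Omega>. weak_partial \<Omega> i f x = cell_grad \<sigma> A i x"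
  using weak_partial_H1[OF cellwise_H1[OF assms]] cell_grad_L2 cellwise_weak_partial[OF assms]
    open_dom bounded_dom
  by (intro weak_partial_AE_unique)

end

section \<open>Existence of the discrete solution\<close>

text \<open>The Riesz representation for a form that is only semidefinite. Finite element functions
  are functions on the plane with arbitrary values off the closure of \<Omega>, so \<open>a\<close>
  has nonzero null vectors; it is enough that \<open>l\<close> vanishes on them. The induction is
  over the points of \<open>M\<close>, whose values determine a function up to null vectors: the
  functions vanishing at one of the points form a subspace of codimension at most 1.\<close>

lemma finite_dimensional_Riesz:
  fixes X :: "('p \<Rightarrow> real) set" and a :: "('p \<Rightarrow> real) \<Rightarrow> ('p \<Rightarrow> real) \<Rightarrow> real"
  assumes "finite M" and "(\<lambda>x. 0) \<in> X"
    and "\<And>f g c. f \<in> X \<Longrightarrow> g \<in> X \<Longrightarrow> (\<lambda>x. c * f x + g x) \<in> X"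
    and "\<And>f g h c. f \<in> X \<Longrightarrow> g \<in> X \<Longrightarrow> h \<in> X \<Longrightarrow> a (\<lambda>x. c * f x + g x) h = c * a f h + a g h"
    and "\<And>f g. f \<in> X \<Longrightarrow> g \<in> X \<Longrightarrow> a f g = a g f"
    and "\<And>f. f \<in> X \<Longrightarrow> 0 \<le> a f f"
    and "\<And>f g c. f \<in> X \<Longrightarrow> g \<in> X \<Longrightarrow> l (\<lambda>x. c * f x + g x) = c * l f + l g"
    and "\<And>f. f \<in> X \<Longrightarrow> a f f = 0 \<Longrightarrow> l f = 0"
    and "\<And>f. f \<in> X \<Longrightarrow> (\<And>m. m \<in> M \<Longrightarrow> f m = 0) \<Longrightarrow> a f f = 0"
  shows "\<exists>w\<in>X. \<forall>v\<in>X. a w v = l v"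
  using assms
proof (induction M arbitrary: X l rule: finite_induct)
  case empty
  have "a (\<lambda>x. 0) v = 0" if "v \<in> X" for v
    using empty(3)[of "\<lambda>x. 0" "\<lambda>x. 0" v 1] empty.prems(1) that by simp
  moreover have "l v = 0" if "v \<in> X" for v
    using empty.prems(7,8) that by blast
  ultimately show ?case using empty.prems(1) by (intro bexI[of _ "\<lambda>x. 0"]) auto
next
  case (insert m M)
  note zero = insert.prems(1) and comb = insert.prems(2) and lin = insert.prems(3)
    and sym = insert.prems(4) and pos = insert.prems(5) and llin = insert.prems(6)
    and null = insert.prems(7) and det = insert.prems(8)
  define X' where "X' = {f \<in> X. f m = 0}"
  have sub: "f \<in> X" if "f \<in> X'" for f using that by (simp add: X'_def)
  have zero': "(\<lambda>x. 0) \<in> X'" using zero by (simp add: X'_def)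
  have comb': "(\<lambda>x. c * f x + g x) \<in> X'" if "f \<in> X'" "g \<in> X'" for f g c
    using that comb by (simp add: X'_def)
  have det': "a f f = 0" if "f \<in> X'" "\<And>m. m \<in> M \<Longrightarrow> f m = 0" for f
    using that by (intro det) (auto simp: X'_def)
  have IH: "\<exists>w\<in>X'. \<forall>v\<in>X'. a w v = k v"
    if k: "\<And>f g c. f \<in> X \<Longrightarrow> g \<in> X \<Longrightarrow> k (\<lambda>x. c * f x + g x) = c * k f + k g"
      "\<And>f. f \<in> X \<Longrightarrow> a f f = 0 \<Longrightarrow> k f = 0" for k
  proof (rule insert.IH)
    show "(\<lambda>x. 0) \<in> X'" by (rule zero')
    show "(\<lambda>x. c * f x + g x) \<in> X'" if "f \<in> X'" "g \<in> X'" for f g c using that by (rule comb')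
    show "a (\<lambda>x. c * f x + g x) h = c * a f h + a g h" if "f \<in> X'" "g \<in> X'" "h \<in> X'" for f g h c
      using that by (intro lin sub)
    show "a f g = a g f" if "f \<in> X'" "g \<in> X'" for f g using that by (intro sym sub)
    show "0 \<le> a f f" if "f \<in> X'" for f using that by (intro pos sub)
    show "k (\<lambda>x. c * f x + g x) = c * k f + k g" if "f \<in> X'" "g \<in> X'" for f g c
      using that by (intro k(1) sub)
    show "k f = 0" if "f \<in> X'" "a f f = 0" for f using that by (intro k(2) sub)
    show "a f f = 0" if "f \<in> X'" "\<And>m. m \<in> M \<Longrightarrow> f m = 0" for f using that by (rule det')
  qed
  \<comment> \<open>The degenerate case of the Cauchy-Schwarz inequality: null vectors are
    orthogonal to everything. The \<open>c\<close> below would give \<open>c * f x + g x\<close> the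
    energy -1.\<close>
  have CS: "a f g = 0" if "f \<in> X" "g \<in> X" "a f f = 0" for f g
  proof (rule ccontr)
    assume nz: "a f g \<noteq> 0"
    define c where "c = - (a g g + 1) / (2 * a f g)"
    have i: "(\<lambda>x. c * f x + g x) \<in> X" using comb that by blast
    have "a (\<lambda>x. c * f x + g x) (\<lambda>x. c * f x + g x)
        = c * a (\<lambda>x. c * f x + g x) f + a (\<lambda>x. c * f x + g x) g"
      using lin[OF that(1,2) i, of c] sym[OF that(1) i] sym[OF that(2) i] by simp
    also have "\<dots> = 2 * c * a f g + a g g"
      using lin[OF that(1,2) that(1), of c] lin[OF that(1,2) that(2), of c] sym[OF that(1,2)] that(3)
      by (simp add: algebra_simps)
    also have "\<dots> = - 1" using nz by (simp add: c_def field_simps)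
    finally show False using pos[OF i] by simp
  qed
  obtain w' where w': "w' \<in> X'" "\<And>v. v \<in> X' \<Longrightarrow> a w' v = l v"
    using IH[of l] llin null by blast
  show ?case
  proof (cases "X' = X")
    case True
    then show ?thesis using w' by blast
  next
    case False
    then obtain \<phi> where \<phi>: "\<phi> \<in> X" "\<phi> m \<noteq> 0" by (auto simp: X'_def)
    \<comment> \<open>\<open>p\<close> is the projection of \<phi> onto \<open>X'\<close>, obtained
      from the induction hypothesis for the functional \<open>\<lambda>v. a v \<phi>\<close>; its
      condition on null vectors is \<open>CS\<close>.\<close>
    obtain p where p: "p \<in> X'" "\<And>v. v \<in> X' \<Longrightarrow> a p v = a v \<phi>"
      using IH[of "\<lambda>v. a v \<phi>"] lin CS \<phi> by blast
    define \<psi> where "\<psi> = (\<lambda>x. - 1 * p x + \<phi> x)"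
    have \<psi>: "\<psi> \<in> X" "\<psi> m \<noteq> 0"
      using comb[OF sub[OF p(1)] \<phi>(1), of "- 1"] p(1) \<phi> by (auto simp: \<psi>_def X'_def)
    have orth: "a \<psi> v = 0" if "v \<in> X'" for v
      using lin[OF sub[OF p(1)] \<phi>(1) sub[OF that], of "- 1"] p(2)[OF that] sym[OF sub[OF that] \<phi>(1)]
      by (simp add: \<psi>_def)
    \<comment> \<open>If \<psi> is a null vector, then \<open>l \<psi> = 0\<close> as well, so the
      default 0 is a correct coefficient.\<close>
    define c where "c = (if a \<psi> \<psi> = 0 then 0 else l \<psi> / a \<psi> \<psi>)"
    have c: "c * a \<psi> \<psi> = l \<psi>" using null[OF \<psi>(1)] by (simp add: c_def)
    define w where "w = (\<lambda>x. c * \<psi> x + w' x)"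
    have w: "w \<in> X" using comb \<psi>(1) sub[OF w'(1)] by (simp add: w_def)
    have "a w v = l v" if v: "v \<in> X" for v
    proof -
      define k where "k = v m / \<psi> m"
      define v' where "v' = (\<lambda>x. - k * \<psi> x + v x)"
      have v': "v' \<in> X'" using comb[OF \<psi>(1) v, of "- k"] \<psi>(2) by (simp add: v'_def k_def X'_def)
      have veq: "v = (\<lambda>x. k * \<psi> x + v' x)" by (simp add: v'_def)
      have "a w \<psi> = l \<psi>"
        using lin[OF \<psi>(1) sub[OF w'(1)] \<psi>(1), of c] orth[OF w'(1)] sym[OF \<psi>(1) sub[OF w'(1)]] c
        by (simp add: w_def)
      moreover have "a w v' = l v'"
        using lin[OF \<psi>(1) sub[OF w'(1)] sub[OF v'], of c] orth[OF v'] w'(2)[OF v'] by (simp add: w_def)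
      moreover have "a w v = k * a w \<psi> + a w v'"
        using lin[OF \<psi>(1) sub[OF v'] w, of k] sym[OF w] \<psi>(1) sub[OF v'] v veq by simp
      moreover have "l v = k * l \<psi> + l v'"
        using llin[OF \<psi>(1) sub[OF v'], of k] veq by simp
      ultimately show ?thesis by simp
    qed
    then show ?thesis using w by blast
  qed
qed

section \<open>Affine interpolation and the energy form on the finite element space\<close>

lemma affine_interpolation:
  fixes C :: "(real^2) set"
  assumes "\<not> affine_dependent C"
  shows "\<exists>a c. \<forall>v\<in>C. a \<bullet> v + c = val v"
proof (cases "C = {}")
  case False
  then obtain v0 where v0: "v0 \<in> C" by blast
  have ind: "independent ((\<lambda>x. - v0 + x) ` (C - {v0}))"
    using assms affine_dependent_iff_dependent2[OF v0] by simp
  obtain g where g: "linear g" "\<And>x. x \<in> (\<lambda>x. - v0 + x) ` (C - {v0}) \<Longrightarrow> g x = val (v0 + x) - val v0"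
    using linear_independent_extend[OF ind, of "\<lambda>x. val (v0 + x) - val v0"] by blast
  have "\<exists>e. \<forall>x. g x = e \<bullet> x"
    using adjoint_works[OF g(1), of _ 1]
    by (intro exI[of _ "adjoint g 1"]) (simp add: inner_commute[of "adjoint g 1"])
  then obtain e where repr: "\<And>x. g x = e \<bullet> x" by blast
  have "e \<bullet> v + (val v0 - e \<bullet> v0) = val v" if "v \<in> C" for v
  proof (cases "v = v0")
    case False
    have "g (- v0 + v) = val v - val v0" using \<open>v \<noteq> v0\<close> g(2)[of "- v0 + v"] that by simp
    moreover have "g (- v0 + v) = e \<bullet> v - e \<bullet> v0"
      using repr[of "- v0 + v"] by (simp only: inner_add_right inner_minus_right)
    ultimately show ?thesis by simp
  qed simp
  then show ?thesis by blast
qed simp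

context mesh
begin

lemma cell_hull_vertices: "K \<in> \<T> \<Longrightarrow> K = convex hull {v. v extreme_point_of K}"
  by (intro Krein_Milman_Minkowski compact_cell convex_cell)

lemma finite_mesh_vertices: "finite (mesh_vertices \<T>)"
proof -
  have "finite {v. v extreme_point_of K}" if K: "K \<in> \<T>" for K
  proof -
    obtain C where C: "\<not> affine_dependent C" "K = convex hull C"
      using simplex_cell[OF K] unfolding simplex_def by blast
    then have "{v. v extreme_point_of K} \<subseteq> C" using extreme_point_of_convex_hull by blast
    then show ?thesis using aff_independent_finite[OF C(1)] finite_subset by blast
  qed
  moreover have "mesh_vertices \<T> = (\<Union>K\<in>\<T>. {v. v extreme_point_of K})"
    by (auto simp: mesh_vertices_def)
  ultimately show ?thesis using finite_mesh by simp
qed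

text \<open>The nodal affine functions of two cells agree at the extreme points of the common face
  \<open>K \<inter> K'\<close>, which are vertices of both cells, and hence on the hull of these
  points. This is where conformity makes the interpolant continuous.\<close>

lemma interpolant_exists:
  obtains I where "I \<in> fe_space \<Omega> \<T>" "\<And>p. p \<in> mesh_vertices \<T> \<Longrightarrow> I p = val p"
proof -
  have "\<exists>a c. \<forall>v. v extreme_point_of K \<longrightarrow> a \<bullet> v + c = val v" if K: "K \<in> \<T>" for K
  proof -
    obtain C where C: "\<not> affine_dependent C" "K = convex hull C"
      using simplex_cell[OF K] unfolding simplex_def by blast
    then have "v \<in> C" if "v extreme_point_of K" for v using that extreme_point_of_convex_hull by blast
    then show ?thesis using affine_interpolation[OF C(1), of val] by blast
  qed
  then obtain A c where Ac: "\<And>K v. K \<in> \<T> \<Longrightarrow> v extreme_point_of K \<Longrightarrow> A K \<bullet> v + c K = val v"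
    by metis
  have agree: "A K \<bullet> x + c K = A K' \<bullet> x + c K'"
    if K: "K \<in> \<T>" "K' \<in> \<T>" and x: "x \<in> K" "x \<in> K'" for K K' x
  proof -
    have F: "compact (K \<inter> K')" "convex (K \<inter> K')"
      by (intro compact_Int convex_Int compact_cell convex_cell K)+
    have "{y. y extreme_point_of (K \<inter> K')} \<subseteq> {y. (A K - A K') \<bullet> y = c K' - c K}"
    proof
      fix y assume "y \<in> {y. y extreme_point_of (K \<inter> K')}"
      then have y: "y extreme_point_of (K \<inter> K')" "y extreme_point_of (K' \<inter> K)"
        by (simp_all add: Int_commute)
      have "y extreme_point_of K" using y(1) extreme_point_of_face[OF mesh_face[OF K]] by blast
      moreover have "y extreme_point_of K'"
        using y(2) extreme_point_of_face[OF mesh_face[OF K(2,1)]] by blast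
      ultimately show "y \<in> {y. (A K - A K') \<bullet> y = c K' - c K}"
        using Ac[OF K(1), of y] Ac[OF K(2), of y] by (simp add: inner_diff_left)
    qed
    then have "convex hull {y. y extreme_point_of (K \<inter> K')} \<subseteq> {y. (A K - A K') \<bullet> y = c K' - c K}"
      by (rule hull_minimal) (rule convex_hyperplane)
    then have "x \<in> {y. (A K - A K') \<bullet> y = c K' - c K}"
      using Krein_Milman_Minkowski[OF F] x by blast
    then show ?thesis by (simp add: inner_diff_left)
  qed
  define cell where "cell x = (SOME K. K \<in> \<T> \<and> x \<in> K)" for x
  define I where "I x = A (cell x) \<bullet> x + c (cell x)" for x
  have IK: "I x = A K \<bullet> x + c K" if "K \<in> \<T>" "x \<in> K" for K x
  proof -
    have "cell x \<in> \<T> \<and> x \<in> cell x" unfolding cell_def by (rule someI[of _ K]) (use that in blast)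
    then show ?thesis unfolding I_def using agree that by blast
  qed
  have "continuous_on (\<Union>K\<in>\<T>. K) I"
  proof (rule continuous_on_closed_Union[OF finite_mesh])
    fix K assume K: "K \<in> \<T>"
    show "closed K" using compact_cell[OF K] compact_imp_closed by blast
    have "continuous_on K (\<lambda>x. A K \<bullet> x + c K)" by (intro continuous_intros)
    then show "continuous_on K I" by (rule continuous_on_eq) (simp add: IK[OF K])
  qed
  then have "I \<in> fe_space \<Omega> \<T>"
    unfolding fe_space_def using IK Union_mesh by auto
  moreover have "I p = val p" if p: "p \<in> mesh_vertices \<T>" for p
  proof -
    obtain K where K: "K \<in> \<T>" "p extreme_point_of K" using p by (auto simp: mesh_vertices_def)
    then show ?thesis using IK[OF K(1), of p] Ac[OF K] by (auto simp: extreme_point_of_def)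
  qed
  ultimately show ?thesis using that by blast
qed

lemma fe_space_cellwise: "V \<in> fe_space \<Omega> \<T> \<longleftrightarrow> (\<exists>A. cellwise V 0 A)"
proof
  assume "V \<in> fe_space \<Omega> \<T>"
  then have c: "continuous_on (closure \<Omega>) V" and "\<forall>K\<in>\<T>. \<exists>a. \<exists>c. \<forall>x\<in>K. V x = a \<bullet> x + c"
    by (auto simp: fe_space_def)
  from bchoice[OF this(2)] obtain A where "\<forall>K\<in>\<T>. \<exists>c. \<forall>x\<in>K. V x = A K \<bullet> x + c" by blast
  then show "\<exists>A. cellwise V 0 A" using c by (auto simp: cellwise_def)
next
  assume "\<exists>A. cellwise V 0 A"
  then obtain A where A: "cellwise V 0 A" by blast
  have "\<exists>a c. \<forall>x\<in>K. V x = a \<bullet> x + c" if "K \<in> \<T>" for K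
    using A that unfolding cellwise_def by (intro exI[of _ "A K"]) simp
  then show "V \<in> fe_space \<Omega> \<T>" using A by (simp add: fe_space_def cellwise_def)
qed

lemma cellwise_comb:
  assumes "cellwise f \<sigma> A" "cellwise g \<tau> B"
  shows "cellwise (\<lambda>x. c * f x + g x) (c * \<sigma> + \<tau>) (\<lambda>K. c *\<^sub>R A K + B K)"
  unfolding cellwise_def
proof (intro conjI ballI)
  show "continuous_on (closure \<Omega>) (\<lambda>x. c * f x + g x)"
    using assms by (intro continuous_intros) (auto simp: cellwise_def)
  fix K assume "K \<in> \<T>"
  then obtain d e where "\<forall>x\<in>K. f x = \<sigma> * (x \<bullet> x) + A K \<bullet> x + d" "\<forall>x\<in>K. g x = \<tau> * (x \<bullet> x) + B K \<bullet> x + e"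
    using assms by (fastforce simp: cellwise_def)
  then show "\<exists>d. \<forall>x\<in>K. c * f x + g x = (c * \<sigma> + \<tau>) * (x \<bullet> x) + (c *\<^sub>R A K + B K) \<bullet> x + d"
    by (intro exI[of _ "c * d + e"]) (auto simp: algebra_simps inner_add_left)
qed

lemma cell_grad_comb:
  "cell_grad (c * \<sigma> + \<tau>) (\<lambda>K. c *\<^sub>R A K + B K) i x = c * cell_grad \<sigma> A i x + cell_grad \<tau> B i x"
  unfolding cell_grad_def sum_distrib_left sum.distrib[symmetric]
  by (intro sum.cong refl) (simp add: algebra_simps)

lemma fe_zero_if_vertices_zero:
  assumes "V \<in> fe_space \<Omega> \<T>" "\<And>v. v \<in> mesh_vertices \<T> \<Longrightarrow> V v = 0" "x \<in> closure \<Omega>"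
  shows "V x = 0"
proof -
  obtain K where K: "K \<in> \<T>" "x \<in> K" using assms(3) Union_mesh by blast
  have "\<exists>a c. \<forall>x\<in>K. V x = a \<bullet> x + c" using assms(1) K(1) by (simp add: fe_space_def)
  then obtain a c where ac: "\<forall>x\<in>K. V x = a \<bullet> x + c" by blast
  have "{v. v extreme_point_of K} \<subseteq> {y. a \<bullet> y = - c}"
  proof
    fix v assume "v \<in> {v. v extreme_point_of K}"
    then have "v \<in> mesh_vertices \<T>" "v \<in> K"
      using K(1) by (auto simp: mesh_vertices_def extreme_point_of_def)
    then have "a \<bullet> v + c = 0" using assms(2)[of v] ac by simp
    then show "v \<in> {y. a \<bullet> y = - c}" by simp
  qed
  then have "convex hull {v. v extreme_point_of K} \<subseteq> {y. a \<bullet> y = - c}"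
    by (rule hull_minimal) (rule convex_hyperplane)
  then have "x \<in> {y. a \<bullet> y = - c}" using cell_hull_vertices[OF K(1)] K(2) by blast
  then show ?thesis using ac K(2) by simp
qed

lemma grad_product_cellwise:
  assumes "cellwise f \<sigma> A" "cellwise g \<tau> B"
  shows "grad_product \<Omega> f g = (\<Sum>i\<in>UNIV. LINT x|lebesgue_on \<Omega>. cell_grad \<sigma> A i x * cell_grad \<tau> B i x)"
  unfolding grad_product_def
proof (rule sum.cong[OF refl])
  fix i
  show "(LINT x|lebesgue_on \<Omega>. weak_partial \<Omega> i f x * weak_partial \<Omega> i g x)
      = (LINT x|lebesgue_on \<Omega>. cell_grad \<sigma> A i x * cell_grad \<tau> B i x)"
  proof (rule integral_cong_AE)
    show "AE x in lebesgue_on \<Omega>. weak_partial \<Omega> i f x * weak_partial \<Omega> i g x = cell_grad \<sigma> A i x * cell_grad \<tau> B i x"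
      using cellwise_weak_partial_AE[OF assms(1), of i] cellwise_weak_partial_AE[OF assms(2), of i]
      by eventually_elim simp
  qed (use L2_mult_integrable cell_grad_L2 weak_partial_H1(1) cellwise_H1 assms
      borel_measurable_integrable in blast)+
qed

lemma grad_product_comb:
  assumes "f \<in> fe_space \<Omega> \<T>" "g \<in> fe_space \<Omega> \<T>" "h \<in> fe_space \<Omega> \<T>"
  shows "grad_product \<Omega> (\<lambda>x. c * f x + g x) h = c * grad_product \<Omega> f h + grad_product \<Omega> g h"
proof -
  obtain A B D where "cellwise f 0 A" "cellwise g 0 B" and h: "cellwise h 0 D"
    using assms fe_space_cellwise by blast
  note fg = this(1,2)
  have "grad_product \<Omega> (\<lambda>x. c * f x + g x) h
      = (\<Sum>i\<in>UNIV. LINT x|lebesgue_on \<Omega>. c * (cell_grad 0 A i x * cell_grad 0 D i x) + cell_grad 0 B i x * cell_grad 0 D i x)"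
    by (subst grad_product_cellwise[OF cellwise_comb[OF fg] h]) (simp only: cell_grad_comb distrib_right mult.assoc)
  also have "\<dots> = (\<Sum>i\<in>UNIV. c * (LINT x|lebesgue_on \<Omega>. cell_grad 0 A i x * cell_grad 0 D i x)
      + (LINT x|lebesgue_on \<Omega>. cell_grad 0 B i x * cell_grad 0 D i x))"
    using L2_mult_integrable[OF cell_grad_L2 cell_grad_L2] by (intro sum.cong) auto
  also have "\<dots> = c * grad_product \<Omega> f h + grad_product \<Omega> g h"
    by (simp add: grad_product_cellwise[OF fg(1) h] grad_product_cellwise[OF fg(2) h]
        sum.distrib sum_distrib_left)
  finally show ?thesis .
qed

lemma grad_product_sym: "grad_product \<Omega> f g = grad_product \<Omega> g f"
  by (simp add: grad_product_def mult.commute)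

lemma grad_product_self_nonneg: "0 \<le> grad_product \<Omega> f f"
  by (simp add: grad_product_def sum_nonneg)

lemma interior_cell_meets_dom:
  assumes "K \<in> \<T>" shows "interior K \<inter> \<Omega> \<noteq> {}"
proof -
  have "interior K \<inter> closure \<Omega> \<noteq> {}"
    using interior_cell_nonempty[OF assms] cell_subset[OF assms] interior_subset by blast
  then show ?thesis using open_Int_closure_eq_empty[OF open_interior] by blast
qed

lemma grad_product_self_zero:
  assumes "cellwise V 0 A" "grad_product \<Omega> V V = 0" "K \<in> \<T>"
  shows "A K = 0"
proof -
  have "A K $ i = 0" for i
  proof -
    have "(LINT x|lebesgue_on \<Omega>. cell_grad 0 A i x * cell_grad 0 A i x) = 0"
      using assms(2) unfolding grad_product_cellwise[OF assms(1,1)]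
      by (subst (asm) sum_nonneg_eq_0_iff) auto
    then have "AE x in lebesgue_on \<Omega>. cell_grad 0 A i x * cell_grad 0 A i x = 0"
      using integral_nonneg_eq_0_iff_AE[OF L2_mult_integrable[OF cell_grad_L2 cell_grad_L2], of 0 A i 0 A i]
      by simp
    then have ae: "AE x in lebesgue. x \<in> \<Omega> \<longrightarrow> cell_grad 0 A i x = 0"
      using open_dom by (subst (asm) AE_restrict_space_iff) auto
    show ?thesis
    proof (rule ccontr)
      assume nz: "A K $ i \<noteq> 0"
      have "AE x in lebesgue. x \<notin> interior K \<inter> \<Omega>"
        using ae by eventually_elim (use nz cell_grad_interior[OF assms(3), of _ 0 A i] in auto)
      then have "interior K \<inter> \<Omega> \<in> null_sets lebesgue"
        using open_dom by (subst AE_iff_null_sets) auto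
      then have "negligible (interior K \<inter> \<Omega>)" by (simp add: negligible_iff_null_sets)
      then show False
        using open_not_negligible[of "interior K \<inter> \<Omega>"] interior_cell_meets_dom[OF assms(3)] open_dom by auto
    qed
  qed
  then show ?thesis by (simp add: vec_eq_iff)
qed

lemma frontier_nonempty: "frontier \<Omega> \<noteq> {}"
proof
  assume "frontier \<Omega> = {}"
  then have "\<Omega> = UNIV" using nonempty_dom frontier_eq_empty[of \<Omega>] by simp
  then show False using bounded_dom not_bounded_UNIV[where 'a = "real^2"] by simp
qed

text \<open>Zero energy makes \<open>V\<close> constant on each cell, hence continuous with finite
  range on the connected closure of \<Omega>, hence constant, and the boundary values make it 0.
  Together the two conclusions supply the condition on null vectors in
  \<open>finite_dimensional_Riesz\<close>.\<close>

lemma grad_product_definite: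
  assumes "V \<in> fe_space \<Omega> \<T>" "\<And>x. x \<in> frontier \<Omega> \<Longrightarrow> V x = 0" "grad_product \<Omega> V V = 0"
  shows "x \<in> closure \<Omega> \<Longrightarrow> V x = 0" "W \<in> fe_space \<Omega> \<T> \<Longrightarrow> grad_product \<Omega> W V = 0"
proof -
  obtain A where A: "cellwise V 0 A" using assms(1) fe_space_cellwise by blast
  have A0: "A K = 0" if "K \<in> \<T>" for K using grad_product_self_zero[OF A assms(3) that] .
  obtain c where c: "\<And>K x. K \<in> \<T> \<Longrightarrow> x \<in> K \<Longrightarrow> V x = c K"
    using A A0 unfolding cellwise_def by (simp, metis)
  have "V ` closure \<Omega> \<subseteq> c ` \<T>" using c Union_mesh by blast
  then have "finite (V ` closure \<Omega>)" using finite_mesh finite_subset by blast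
  then have const: "V constant_on closure \<Omega>"
    using A connected_dom by (intro continuous_finite_range_constant connected_imp_connected_closure)
      (auto simp: cellwise_def)
  show "V x = 0" if "x \<in> closure \<Omega>" for x
  proof -
    obtain y where "y \<in> frontier \<Omega>" using frontier_nonempty by blast
    then have "V y = 0" "y \<in> closure \<Omega>" using assms(2) by (auto simp: frontier_def)
    then show ?thesis using const that by (auto simp: constant_on_def)
  qed
  show "grad_product \<Omega> W V = 0" if W: "W \<in> fe_space \<Omega> \<T>" for W
  proof -
    obtain B where B: "cellwise W 0 B" using W fe_space_cellwise by blast
    have "cell_grad 0 A i = (\<lambda>x. 0)" for i by (auto simp: cell_grad_def A0)
    then show ?thesis by (simp add: grad_product_cellwise[OF B A])
  qed
qed

section \<open>The discrete solution for the squared norm\<close>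

lemma cellwise_square_norm: "cellwise (\<lambda>x. (x $ 1)\<^sup>2 + (x $ 2)\<^sup>2) 1 (\<lambda>K. 0)"
proof -
  have e: "(\<lambda>x::real^2. (x $ 1)\<^sup>2 + (x $ 2)\<^sup>2) = (\<lambda>x. x \<bullet> x)"
    by (simp add: inner_vec_def sum_2 power2_eq_square)
  show ?thesis unfolding cellwise_def e by (auto intro!: continuous_intros exI[of _ 0])
qed

lemma H1_AE_cong:
  assumes "g \<in> H1 \<Omega>" "f \<in> L2 \<Omega>" "AE x in lebesgue_on \<Omega>. f x = g x"
  shows "f \<in> H1 \<Omega>"
proof -
  have "is_weak_partial \<Omega> i f d" if "is_weak_partial \<Omega> i g d" for i d
    unfolding is_weak_partial_def
  proof
    fix \<phi> assume \<phi>: "\<phi> \<in> test_functions \<Omega>"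
    have p: "partial i \<phi> \<in> L2 \<Omega>"
      using test_function_L2 test_function_partial[OF \<phi>] open_dom bounded_dom by blast
    have "(LINT x|lebesgue_on \<Omega>. f x * partial i \<phi> x) = (LINT x|lebesgue_on \<Omega>. g x * partial i \<phi> x)"
    proof (rule integral_cong_AE)
      show "(\<lambda>x. f x * partial i \<phi> x) \<in> borel_measurable (lebesgue_on \<Omega>)"
        "(\<lambda>x. g x * partial i \<phi> x) \<in> borel_measurable (lebesgue_on \<Omega>)"
        using p assms(1,2) by (auto simp: L2_def H1_def)
      show "AE x in lebesgue_on \<Omega>. f x * partial i \<phi> x = g x * partial i \<phi> x"
        using assms(3) by eventually_elim simp
    qed
    then show "(LINT x|lebesgue_on \<Omega>. f x * partial i \<phi> x) = - (LINT x|lebesgue_on \<Omega>. d x * \<phi> x)"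
      using that \<phi> by (simp add: is_weak_partial_def)
  qed
  then show ?thesis using assms(1,2) unfolding H1_def by blast
qed

text \<open>Admits the squared norm to the error hypothesis. Second derivatives are those of the
  chosen \<open>weak_partial\<close>, which equals \<open>2 * x $ i\<close> only almost everywhere;
  hence the passage through \<open>H1_AE_cong\<close>.\<close>

lemma square_norm_H2: "(\<lambda>x. (x $ 1)\<^sup>2 + (x $ 2)\<^sup>2) \<in> H2 \<Omega>"
proof -
  let ?u = "\<lambda>x::real^2. (x $ 1)\<^sup>2 + (x $ 2)\<^sup>2"
  have "weak_partial \<Omega> i ?u \<in> H1 \<Omega>" for i
  proof (rule H1_AE_cong)
    have "cellwise (\<lambda>x. 2 * x $ i) 0 (\<lambda>K. axis i 2)"
      unfolding cellwise_def by (auto intro!: continuous_intros exI[of _ 0] simp: inner_axis inner_commute)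
    then show "(\<lambda>x. 2 * x $ i) \<in> H1 \<Omega>" by (rule cellwise_H1)
    show "weak_partial \<Omega> i ?u \<in> L2 \<Omega>"
      using weak_partial_H1(1)[OF cellwise_H1[OF cellwise_square_norm]] .
    have fr: "AE x in lebesgue. x \<notin> (\<Union>K\<in>\<T>. frontier K)"
    proof -
      have "negligible (\<Union>K\<in>\<T>. frontier K)"
        using finite_mesh convex_cell negligible_convex_frontier by (intro negligible_Union) auto
      then show ?thesis by (intro AE_not_in) (simp add: negligible_iff_null_sets)
    qed
    have "AE x in lebesgue. x \<in> \<Omega> \<longrightarrow> cell_grad 1 (\<lambda>K. 0) i x = 2 * x $ i"
      using fr
    proof eventually_elim
      case (elim x)
      show ?case
      proof
        assume x: "x \<in> \<Omega>"
        then obtain K where "K \<in> \<T>" "x \<in> interior K"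
          using obtain_interior_cell[of x] elim closure_subset by blast
        then show "cell_grad 1 (\<lambda>K. 0) i x = 2 * x $ i" using cell_grad_interior x by simp
      qed
    qed
    then have "AE x in lebesgue_on \<Omega>. cell_grad 1 (\<lambda>K. 0) i x = 2 * x $ i"
      using open_dom by (subst AE_restrict_space_iff) auto
    then show "AE x in lebesgue_on \<Omega>. weak_partial \<Omega> i ?u x = 2 * x $ i"
      using cellwise_weak_partial_AE[OF cellwise_square_norm, of i] by eventually_elim simp
  qed
  then show ?thesis using cellwise_H1[OF cellwise_square_norm] by (simp add: H2_def)
qed

lemma dist_cell_le:
  assumes "K \<in> \<T>" "x \<in> K" "y \<in> K"
  shows "dist x y \<le> mesh_size \<T>"
proof -
  have "dist x y \<le> diameter K"
    using diameter_bounded_bound[OF compact_imp_bounded[OF compact_cell]] assms by blast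
  also have "\<dots> \<le> mesh_size \<T>"
    unfolding mesh_size_def using finite_mesh assms by (intro Max_ge) auto
  finally show ?thesis .
qed

lemma interpolant_error:
  assumes I: "I \<in> fe_space \<Omega> \<T>" "\<And>p. p \<in> mesh_vertices \<T> \<Longrightarrow> I p = p \<bullet> p" and x: "x \<in> closure \<Omega>"
  shows "\<bar>x \<bullet> x - I x\<bar> \<le> (mesh_size \<T>)\<^sup>2"
proof -
  obtain K where K: "K \<in> \<T>" "x \<in> K" using x Union_mesh by blast
  have "\<exists>a c. \<forall>x\<in>K. I x = a \<bullet> x + c" using I(1) K(1) by (simp add: fe_space_def)
  then obtain a c where ac: "\<forall>x\<in>K. I x = a \<bullet> x + c" by blast
  have diam: "dist v x \<le> mesh_size \<T>" if "v \<in> K" for v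
    by (rule dist_cell_le[OF K(1) that K(2)])
  \<comment> \<open>\<open>y \<mapsto> I y - 2 x \<bullet> y + x \<bullet> x\<close> is affine on \<open>K\<close>, equals \<open>|v - x|\<^sup>2\<close> at the vertices
    and the error at \<open>y = x\<close>.\<close>
  have vert: "(a - 2 *\<^sub>R x) \<bullet> v = (dist v x)\<^sup>2 - c - x \<bullet> x" if "v extreme_point_of K" for v
  proof -
    have "v \<in> K" using that by (simp add: extreme_point_of_def)
    then have "a \<bullet> v + c = v \<bullet> v" using ac I(2)[of v] that K(1) by (auto simp: mesh_vertices_def)
    moreover have "(dist v x)\<^sup>2 = v \<bullet> v - 2 * (x \<bullet> v) + x \<bullet> x"
      by (simp add: dist_norm power2_norm_eq_inner inner_simps inner_commute)
    ultimately show ?thesis by (simp add: inner_simps)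
  qed
  have "{v. v extreme_point_of K} \<subseteq> {y. (a - 2 *\<^sub>R x) \<bullet> y \<le> (mesh_size \<T>)\<^sup>2 - c - x \<bullet> x}"
    using vert diam by (auto simp: extreme_point_of_def intro!: power_mono)
  then have "convex hull {v. v extreme_point_of K} \<subseteq> {y. (a - 2 *\<^sub>R x) \<bullet> y \<le> (mesh_size \<T>)\<^sup>2 - c - x \<bullet> x}"
    by (rule hull_minimal) (rule convex_halfspace_le)
  then have "(a - 2 *\<^sub>R x) \<bullet> x \<le> (mesh_size \<T>)\<^sup>2 - c - x \<bullet> x"
    using cell_hull_vertices[OF K(1)] K(2) by blast
  moreover have "{v. v extreme_point_of K} \<subseteq> {y. (a - 2 *\<^sub>R x) \<bullet> y \<ge> - c - x \<bullet> x}"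
    using vert by auto
  then have "convex hull {v. v extreme_point_of K} \<subseteq> {y. (a - 2 *\<^sub>R x) \<bullet> y \<ge> - c - x \<bullet> x}"
    by (rule hull_minimal) (rule convex_halfspace_ge)
  then have "(a - 2 *\<^sub>R x) \<bullet> x \<ge> - c - x \<bullet> x"
    using cell_hull_vertices[OF K(1)] K(2) by blast
  ultimately show ?thesis using ac K(2) by (simp add: inner_diff_left)
qed

text \<open>Without an actual solution the error hypothesis would say nothing. The boundary data are
  lifted by the interpolant \<open>I\<close>: the unknown \<open>w\<close> vanishes on the frontier
  and solves the problem with right-hand side \<open>r v - grad_product \<Omega> v I\<close>. On the
  frontier \<open>U\<close> equals \<open>I\<close>, so the boundary error is an interpolation
  error.\<close>

lemma discrete_solution_exists:
  obtains U A where "discrete_solution \<Omega> \<T> (\<lambda>x. (x $ 1)\<^sup>2 + (x $ 2)\<^sup>2) U" "cellwise U 0 A"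
    "\<And>x. x \<in> frontier \<Omega> \<Longrightarrow> \<bar>x \<bullet> x - U x\<bar> \<le> (mesh_size \<T>)\<^sup>2"
proof -
  let ?u = "\<lambda>x::real^2. (x $ 1)\<^sup>2 + (x $ 2)\<^sup>2"
  obtain I where I: "I \<in> fe_space \<Omega> \<T>" "\<And>p. p \<in> mesh_vertices \<T> \<Longrightarrow> I p = ?u p"
    using interpolant_exists[of ?u] by blast
  have ux: "?u x = x \<bullet> x" for x by (simp add: inner_vec_def sum_2 power2_eq_square)
  define X where "X = {V \<in> fe_space \<Omega> \<T>. \<forall>x\<in>frontier \<Omega>. V x = 0}"
  define r where "r V = (LINT x|lebesgue_on \<Omega>. - weak_laplacian \<Omega> ?u x * V x)" for V
  have fcomb: "(\<lambda>x. c * f x + g x) \<in> fe_space \<Omega> \<T>" if "f \<in> fe_space \<Omega> \<T>" "g \<in> fe_space \<Omega> \<T>" for f g c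
    using that cellwise_comb[of f 0 _ g 0] unfolding fe_space_cellwise by fastforce
  have wl: "integrable (lebesgue_on \<Omega>) (\<lambda>x. weak_laplacian \<Omega> ?u x * V x)" if "V \<in> fe_space \<Omega> \<T>" for V
  proof -
    have "V \<in> L2 \<Omega>" using that cellwise_L2 fe_space_cellwise by blast
    moreover have "weak_partial \<Omega> i (weak_partial \<Omega> i ?u) \<in> L2 \<Omega>" for i
      using square_norm_H2 weak_partial_H1(1) by (simp add: H2_def)
    ultimately show ?thesis
      unfolding weak_laplacian_def sum_distrib_right
      by (intro Bochner_Integration.integrable_sum L2_mult_integrable)
  qed
  have rlin: "r (\<lambda>x. c * f x + g x) = c * r f + r g" if "f \<in> fe_space \<Omega> \<T>" "g \<in> fe_space \<Omega> \<T>" for f g c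
  proof -
    have "r (\<lambda>x. c * f x + g x) = (LINT x|lebesgue_on \<Omega>. - (c * (weak_laplacian \<Omega> ?u x * f x) + weak_laplacian \<Omega> ?u x * g x))"
      unfolding r_def by (rule Bochner_Integration.integral_cong) (auto simp: algebra_simps)
    then show ?thesis using wl[OF that(1)] wl[OF that(2)] by (simp add: r_def)
  qed
  have "\<exists>w\<in>X. \<forall>v\<in>X. grad_product \<Omega> w v = r v - grad_product \<Omega> v I"
  proof (rule finite_dimensional_Riesz[OF finite_mesh_vertices])
    show "(\<lambda>x. 0) \<in> X" by (auto simp: X_def fe_space_def intro!: exI[of _ 0])
    show "(\<lambda>x. c * f x + g x) \<in> X" if "f \<in> X" "g \<in> X" for f g c
      using that fcomb by (simp add: X_def)
    show "grad_product \<Omega> (\<lambda>x. c * f x + g x) h = c * grad_product \<Omega> f h + grad_product \<Omega> g h"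
      if "f \<in> X" "g \<in> X" "h \<in> X" for f g h c
      using that by (intro grad_product_comb) (auto simp: X_def)
    show "r (\<lambda>x. c * f x + g x) - grad_product \<Omega> (\<lambda>x. c * f x + g x) I
        = c * (r f - grad_product \<Omega> f I) + (r g - grad_product \<Omega> g I)" if "f \<in> X" "g \<in> X" for f g c
      using that grad_product_comb[of f g I c] rlin[of f g c] I(1) by (simp add: X_def algebra_simps)
    show "r f - grad_product \<Omega> f I = 0" if "f \<in> X" "grad_product \<Omega> f f = 0" for f
    proof -
      have "f x = 0" if "x \<in> \<Omega>" for x
        using grad_product_definite(1)[of f x] \<open>f \<in> X\<close> \<open>grad_product \<Omega> f f = 0\<close> that closure_subset
        by (auto simp: X_def)
      then have "r f = (LINT x|lebesgue_on \<Omega>. 0)"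
        unfolding r_def by (intro Bochner_Integration.integral_cong) (auto simp: space_restrict_space)
      moreover have "grad_product \<Omega> f I = 0"
        using grad_product_definite(2)[of f I] that I(1) grad_product_sym[of f I] by (simp add: X_def)
      ultimately show ?thesis by simp
    qed
    show "grad_product \<Omega> f f = 0" if "f \<in> X" "\<And>m. m \<in> mesh_vertices \<T> \<Longrightarrow> f m = 0" for f
    proof -
      have "f x = 0" if "x \<in> closure \<Omega>" for x
        using fe_zero_if_vertices_zero \<open>f \<in> X\<close> \<open>\<And>m. m \<in> mesh_vertices \<T> \<Longrightarrow> f m = 0\<close> that
        by (auto simp: X_def)
      then have "cellwise f 0 (\<lambda>K. 0)"
        using cell_subset unfolding cellwise_def
        by (auto intro!: exI[of _ 0] continuous_on_eq[of _ "\<lambda>x. 0"])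
      from grad_product_cellwise[OF this this] show ?thesis by (simp add: cell_grad_def)
    qed
  qed (auto intro: grad_product_sym grad_product_self_nonneg)
  then obtain w where w: "w \<in> X" "\<And>v. v \<in> X \<Longrightarrow> grad_product \<Omega> w v = r v - grad_product \<Omega> v I"
    by blast
  \<comment> \<open>The factor 1 brings \<open>U\<close> into the shape \<open>c * f x + g x\<close>
    of the linearity lemmas.\<close>
  define U where "U = (\<lambda>x. 1 * w x + I x)"
  have Ufe: "U \<in> fe_space \<Omega> \<T>" 
    using w(1) I(1) unfolding U_def X_def by (intro fcomb) auto
  have UI: "U x = I x" if "x \<in> frontier \<Omega>" for x using w(1) that by (simp add: U_def X_def)
  have "continuous_representative \<Omega> ?u ?u"
    using cellwise_square_norm by (simp add: continuous_representative_def cellwise_def)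
  moreover have "lagrange_interpolant \<Omega> \<T> ?u I" using I by (simp add: lagrange_interpolant_def)
  moreover have "grad_product \<Omega> U V = r V" if "V \<in> fe_space \<Omega> \<T>" "\<forall>x\<in>frontier \<Omega>. V x = 0" for V
    using grad_product_comb[of w I V 1] w(1) w(2)[of V] I(1) that grad_product_sym[of V I]
    by (simp add: U_def X_def)
  ultimately have "discrete_solution \<Omega> \<T> ?u U"
    using Ufe UI unfolding discrete_solution_def r_def by blast
  moreover have "\<bar>x \<bullet> x - U x\<bar> \<le> (mesh_size \<T>)\<^sup>2" if "x \<in> frontier \<Omega>" for x
    using interpolant_error[OF I(1), of x] I(2) ux UI[OF that] that by (auto simp: frontier_def)
  moreover obtain A where "cellwise U 0 A" using Ufe fe_space_cellwise by blast
  ultimately show ?thesis using that by blast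
qed

end

section \<open>The trace on a segment\<close>

lemma AE_lborel_affine:
  fixes a c :: real
  assumes "AE x in lborel. P x" "c \<noteq> 0"
  shows "AE x in lborel. P (a + c * x)"
proof -
  obtain N where N: "N \<in> sets borel" "emeasure lborel N = 0" "{x. \<not> P x} \<subseteq> N"
    using AE_E[OF assms(1)] by auto
  then have "AE x in lborel. x \<notin> N" by (intro AE_not_in) (auto simp: null_sets_def)
  then have "AE x in lborel. a + c * x \<notin> N"
    using N(1) by (intro AE_borel_affine[OF assms(2)]) auto
  then show ?thesis by eventually_elim (use N(3) in blast)
qed

context mesh
begin

lemma cell_grad_square_integrable: "integrable lborel (\<lambda>x. (cell_grad \<sigma> A i x)\<^sup>2)"
proof -
  have "integrable (lebesgue_on \<Omega>) (\<lambda>x. (cell_grad \<sigma> A i x)\<^sup>2)"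
    using cell_grad_L2 by (simp add: L2_def)
  then have "integrable lebesgue (\<lambda>x. indicator \<Omega> x *\<^sub>R (cell_grad \<sigma> A i x)\<^sup>2)"
    using open_dom by (simp add: integrable_restrict_space)
  moreover have "(\<lambda>x. indicator \<Omega> x *\<^sub>R (cell_grad \<sigma> A i x)\<^sup>2) = (\<lambda>x. (cell_grad \<sigma> A i x)\<^sup>2)"
    by (auto simp: fun_eq_iff cell_grad_outside split: split_indicator)
  ultimately show ?thesis by (simp add: integrable_completion)
qed

lemma integral_cell_grad_square:
  "(LINT x|lebesgue_on \<Omega>. (cell_grad \<sigma> A i x)\<^sup>2) = (LINT x|lborel. (cell_grad \<sigma> A i x)\<^sup>2)"
proof -
  have e: "(\<lambda>x. indicator \<Omega> x * (cell_grad \<sigma> A i x)\<^sup>2) = (\<lambda>x. (cell_grad \<sigma> A i x)\<^sup>2)"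
    by (auto simp: fun_eq_iff cell_grad_outside split: split_indicator)
  have "(LINT x|lebesgue_on \<Omega>. (cell_grad \<sigma> A i x)\<^sup>2)
      = (LINT x|lborel. indicator \<Omega> x * (cell_grad \<sigma> A i x)\<^sup>2)"
    by (rule integral_lebesgue_on_open[OF open_dom]) (unfold e, measurable)
  then show ?thesis unfolding e .
qed

text \<open>Follow the line parallel to the \<open>i\<close>-th axis from a point of the closure until it first meets
  the boundary, where the function is small.\<close>

lemma line_bound:
  assumes f: "cellwise f \<sigma> A" and bd: "\<And>x. x \<in> frontier \<Omega> \<Longrightarrow> \<bar>f x\<bar> \<le> \<epsilon>"
    and R: "\<And>x. x \<in> closure \<Omega> \<Longrightarrow> norm x < R" and "\<mu> > 0"
    and fin: "finite {r. axis_pt i s r \<in> (\<Union>K\<in>\<T>. frontier K)}"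
    and int: "integrable lborel (\<lambda>r. (cell_grad \<sigma> A i (axis_pt i s r))\<^sup>2)"
    and r0: "axis_pt i s r0 \<in> closure \<Omega>"
  shows "\<bar>f (axis_pt i s r0)\<bar> \<le> \<epsilon> + \<mu> * R + (LINT r|lborel. (cell_grad \<sigma> A i (axis_pt i s r))\<^sup>2) / (2 * \<mu>)"
proof -
  \<comment> \<open>If the line starts on the boundary, the infimum of \<open>S\<close> is
    \<open>r0\<close> itself and the segment of integration degenerates to a point.\<close>
  define S where "S = {r0..} \<inter> axis_pt i s -` frontier \<Omega>"
  have comp: "\<bar>r\<bar> < R" if "axis_pt i s r \<in> closure \<Omega>" for r
    using R[OF that] component_le_norm_cart[of "axis_pt i s r" i] by simp
  have ca: "continuous_on T (axis_pt i s)" for T by (rule continuous_on_axis_pt)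
  have clS: "closed S"
    unfolding S_def using ca[of UNIV] by (intro closed_Int closed_vimage) auto
  have conn: "connected (axis_pt i s ` {a..b})" for a b
    by (intro connected_continuous_image ca) auto
  have "r0 < R" using comp[OF r0] by simp
  have "axis_pt i s R \<notin> closure \<Omega>" using comp[of R] \<open>r0 < R\<close> by auto
  moreover have "axis_pt i s ` {r0..R} \<inter> frontier (closure \<Omega>) \<noteq> {}"
  proof (rule connected_Int_frontier[OF conn])
    have "axis_pt i s r0 \<in> axis_pt i s ` {r0..R}" "axis_pt i s R \<in> axis_pt i s ` {r0..R}"
      using \<open>r0 < R\<close> by simp_all
    then show "axis_pt i s ` {r0..R} \<inter> closure \<Omega> \<noteq> {}" "axis_pt i s ` {r0..R} - closure \<Omega> \<noteq> {}"
      using r0 calculation by blast+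
  qed
  ultimately obtain r where "r0 \<le> r" "axis_pt i s r \<in> frontier (closure \<Omega>)" by auto
  moreover from this(2) have "axis_pt i s r \<in> frontier \<Omega>"
    using interior_mono[OF closure_subset[of \<Omega>]] by (auto simp: frontier_def)
  ultimately have "r \<in> S" by (simp add: S_def)
  then have "S \<noteq> {}" by blast
  moreover have bS: "bdd_below S" by (auto simp: S_def)
  ultimately have R0: "Inf S \<in> S" using clS closed_contains_Inf by blast
  define R0 where "R0 = Inf S"
  have R0S: "r0 \<le> R0" "axis_pt i s R0 \<in> frontier \<Omega>" using R0 by (auto simp: S_def R0_def)
  have before: "axis_pt i s r \<notin> frontier \<Omega>" if "r0 \<le> r" "r < R0" for r
    using cInf_lower[OF _ bS, of r] that by (force simp: S_def R0_def)
  have inside: "axis_pt i s r \<in> \<Omega>" if "r0 \<le> r" "r < R0" for r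
  proof -
    have "axis_pt i s r0 \<in> \<Omega>"
      using before[of r0] that r0 open_dom by (auto simp: frontier_def interior_open)
    moreover have "axis_pt i s ` {r0..r} \<inter> frontier \<Omega> = {}" using before that by auto
    moreover have "axis_pt i s r0 \<in> axis_pt i s ` {r0..r}" "axis_pt i s r \<in> axis_pt i s ` {r0..r}"
      using that by simp_all
    ultimately show ?thesis using connected_Int_frontier[OF conn, of r0 r \<Omega>] by blast
  qed
  have incl: "axis_pt i s r \<in> closure \<Omega>" if "r0 \<le> r" "r \<le> R0" for r
    using inside[of r] R0S that closure_subset by (cases "r = R0") (auto simp: frontier_def)
  let ?g = "\<lambda>r. cell_grad \<sigma> A i (axis_pt i s r)"
  have ftc: "(?g has_integral (f (axis_pt i s R0) - f (axis_pt i s r0))) {r0..R0}"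
  proof (rule fundamental_theorem_of_calculus_interior_strong[OF fin R0S(1)])
    show "continuous_on {r0..R0} (\<lambda>r. f (axis_pt i s r))"
      by (rule continuous_on_compose2[OF _ ca]) (use f incl in \<open>auto simp: cellwise_def\<close>)
    show "((\<lambda>r. f (axis_pt i s r)) has_vector_derivative ?g r) (at r)"
      if "r \<in> {r0<..<R0} - {r. axis_pt i s r \<in> (\<Union>K\<in>\<T>. frontier K)}" for r
      unfolding has_real_derivative_iff_has_vector_derivative[symmetric]
      using that inside by (intro cellwise_line_derivative[OF f]) auto
  qed
  have gi: "(\<lambda>r. (?g r)\<^sup>2) integrable_on UNIV"
    and gI: "integral UNIV (\<lambda>r. (?g r)\<^sup>2) = (LINT r|lborel. (?g r)\<^sup>2)"
    using has_integral_integral_lborel[OF int] by (auto simp: has_integral_iff)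
  have gi': "(\<lambda>r. (?g r)\<^sup>2) integrable_on {r0..R0}"
    by (rule integrable_on_subinterval[OF gi]) simp
  \<comment> \<open>The weight \<mu> replaces the square root of Cauchy-Schwarz: the bound stays
    linear in the integral of the squared gradient, so it can still be integrated over all lines,
    and \<mu> is chosen at the end.\<close>
  have am: "\<bar>?g r\<bar> \<le> \<mu> / 2 + (?g r)\<^sup>2 / (2 * \<mu>)" for r
  proof -
    have "2 * \<mu> * \<bar>?g r\<bar> \<le> \<mu>\<^sup>2 + (?g r)\<^sup>2"
      using sum_squares_bound[of \<mu> "\<bar>?g r\<bar>"] by simp
    then show ?thesis using \<open>\<mu> > 0\<close> by (simp add: field_simps power2_eq_square)
  qed
  have "\<bar>f (axis_pt i s R0) - f (axis_pt i s r0)\<bar> = norm (integral {r0..R0} ?g)"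
    using integral_unique[OF ftc] by simp
  also have "\<dots> \<le> integral {r0..R0} (\<lambda>r. \<mu> / 2 + (?g r)\<^sup>2 / (2 * \<mu>))"
    using ftc gi' am
    by (intro integral_norm_bound_integral integrable_add integrable_on_divide integrable_const_ivl)
      (auto simp: has_integral_integrable_integral)
  also have "\<dots> = \<mu> / 2 * (R0 - r0) + integral {r0..R0} (\<lambda>r. (?g r)\<^sup>2) / (2 * \<mu>)"
    using gi' R0S(1)
    by (subst Henstock_Kurzweil_Integration.integral_add) (auto intro: integrable_on_divide)
  also have "\<dots> \<le> \<mu> / 2 * (2 * R) + (LINT r|lborel. (?g r)\<^sup>2) / (2 * \<mu>)"
  proof (intro add_mono mult_left_mono divide_right_mono)
    show "R0 - r0 \<le> 2 * R" using comp[OF incl[of R0]] comp[OF r0] R0S(1) by simp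
    show "integral {r0..R0} (\<lambda>r. (?g r)\<^sup>2) \<le> (LINT r|lborel. (?g r)\<^sup>2)"
      unfolding gI[symmetric] by (rule integral_subset_le[OF _ gi' gi]) auto
  qed (use \<open>\<mu> > 0\<close> in auto)
  finally show ?thesis using bd[OF R0S(2)] by simp
qed

text \<open>\<open>line_bound\<close> integrated over the lines that cross the segment. They are
  parallel to the axis \<open>i\<close> for which the other component \<open>d $ j\<close> is at
  least 1/2 in absolute value, so the crossing is transversal. The substitution
  \<open>s = a $ j + d $ j * t\<close> then costs at most a factor 2, which the 2 in
  \<open>2 * \<mu>\<close> absorbs.\<close>

lemma trace_bound:
  assumes f: "cellwise f \<sigma> A" and bd: "\<And>x. x \<in> frontier \<Omega> \<Longrightarrow> \<bar>f x\<bar> \<le> \<epsilon>"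
    and R: "\<And>x. x \<in> closure \<Omega> \<Longrightarrow> norm x < R" and "\<mu> > 0"
    and d: "norm d = 1" and t: "t0 \<le> t1" and seg: "\<And>t. t \<in> {t0..t1} \<Longrightarrow> a + t *\<^sub>R d \<in> closure \<Omega>"
    and D: "(\<Sum>i\<in>UNIV. LINT x|lebesgue_on \<Omega>. (cell_grad \<sigma> A i x)\<^sup>2) \<le> D"
  shows "integral {t0..t1} (\<lambda>t. \<bar>f (a + t *\<^sub>R d)\<bar>) \<le> (\<epsilon> + \<mu> * R) * (t1 - t0) + D / \<mu>"
proof -
  have "\<exists>j. 1 / 2 \<le> \<bar>d $ j\<bar>"
  proof (rule ccontr)
    assume "\<not> ?thesis"
    then have "\<bar>d $ j\<bar> < 1 / 2" for j by (auto simp: not_le)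
    then have "(d $ j)\<^sup>2 < 1 / 4" for j
      using power_strict_mono[of "\<bar>d $ j\<bar>" "1/2" 2] by (simp add: power2_eq_square)
    from this[of 1] this[of 2] have "d \<bullet> d < 1" by (simp add: inner_vec_def sum_2 power2_eq_square)
    then show False using d by (simp add: norm_eq_sqrt_inner)
  qed
  then obtain j where dj: "1 / 2 \<le> \<bar>d $ j\<bar>" by blast
  define i where "i = other j"
  have ij: "other i = j" using UNIV_other[of i] UNIV_other[of j] by (auto simp: i_def other_def split: if_splits) 
  define G where "G s = (LINT r|lborel. (cell_grad \<sigma> A i (axis_pt i s r))\<^sup>2)" for s
  have Gint: "integrable lborel G"
    using integrable_axis_lines[OF cell_grad_square_integrable] by (simp add: G_def[abs_def])
  have Gnn: "0 \<le> G s" for s by (simp add: G_def)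
  have GD: "(LINT s|lborel. G s) \<le> D"
  proof -
    have "(LINT s|lborel. G s) = (LINT x|lebesgue_on \<Omega>. (cell_grad \<sigma> A i x)\<^sup>2)"
      unfolding G_def integral_cell_grad_square
      by (rule integral_axis_lines[OF cell_grad_square_integrable, symmetric])
    also have "\<dots> \<le> (\<Sum>i\<in>UNIV. LINT x|lebesgue_on \<Omega>. (cell_grad \<sigma> A i x)\<^sup>2)"
      by (rule member_le_sum) auto
    finally show ?thesis using D by simp
  qed
  have dj0: "d $ j \<noteq> 0" using dj by auto
  \<comment> \<open>Lines with infinitely many skeleton points or without integrable squared
    gradient form a null set of parameters \<open>s\<close>, and the affine substitution keeps it
    null.\<close>
  have "AE s in lborel. \<forall>r. axis_pt i s r \<in> closure \<Omega> \<longrightarrow> \<bar>f (axis_pt i s r)\<bar> \<le> \<epsilon> + \<mu> * R + G s / (2 * \<mu>)"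
    using AE_finite_skeleton_slice[of i] AE_integrable_axis_line[OF cell_grad_square_integrable[of \<sigma> A i], of i]
  proof eventually_elim
    case (elim s)
    then show ?case
      unfolding G_def using line_bound[OF f bd R \<open>\<mu> > 0\<close>] by blast
  qed
  from AE_lborel_affine[OF this dj0, of "a $ j"]
  have ae: "AE t in lborel. t \<in> {t0..t1} \<longrightarrow> \<bar>f (a + t *\<^sub>R d)\<bar> \<le> \<epsilon> + \<mu> * R + G (a $ j + d $ j * t) / (2 * \<mu>)"
  proof eventually_elim
    case (elim t)
    show ?case
    proof
      assume t: "t \<in> {t0..t1}"
      have "axis_pt i (a $ j + d $ j * t) ((a + t *\<^sub>R d) $ i) = a + t *\<^sub>R d"
        using axis_pt_collapse[of i "a + t *\<^sub>R d"] by (simp add: ij mult.commute)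
      then show "\<bar>f (a + t *\<^sub>R d)\<bar> \<le> \<epsilon> + \<mu> * R + G (a $ j + d $ j * t) / (2 * \<mu>)"
        using elim seg[OF t] by metis
    qed
  qed
  have Gaff: "integrable lborel (\<lambda>t. G (a $ j + d $ j * t))"
    using lborel_integrable_real_affine[OF Gint dj0] by simp
  have Gval: "(LINT t|lborel. G (a $ j + d $ j * t)) \<le> 2 * D"
  proof -
    have "(LINT s|lborel. G s) = \<bar>d $ j\<bar> * (LINT t|lborel. G (a $ j + d $ j * t))"
      using lborel_integral_real_affine[OF dj0, of G "a $ j"] by simp
    moreover have "1 / 2 * (LINT t|lborel. G (a $ j + d $ j * t)) \<le> \<bar>d $ j\<bar> * (LINT t|lborel. G (a $ j + d $ j * t))"
      using dj Gnn by (intro mult_right_mono) auto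
    ultimately show ?thesis using GD by simp
  qed
  have ch: "continuous_on {t0..t1} (\<lambda>t. \<bar>f (a + t *\<^sub>R d)\<bar>)"
  proof -
    have "continuous_on {t0..t1} (\<lambda>t. f (a + t *\<^sub>R d))"
      by (rule continuous_on_compose2[where t = "closure \<Omega>"])
        (use f seg in \<open>auto simp: cellwise_def intro!: continuous_intros\<close>)
    then show ?thesis by (intro continuous_intros)
  qed
  have hi: "set_integrable lborel {t0..t1} (\<lambda>t. \<bar>f (a + t *\<^sub>R d)\<bar>)"
    using borel_integrable_atLeastAtMost'[OF ch] .
  have ci: "set_integrable lborel {t0..t1} (\<lambda>t. \<epsilon> + \<mu> * R)"
    by (rule borel_integrable_atLeastAtMost') (intro continuous_intros)
  have Gi: "set_integrable lborel {t0..t1} (\<lambda>t. G (a $ j + d $ j * t) / (2 * \<mu>))"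
    unfolding set_integrable_def
    by (intro integrable_mult_indicator) (use Gaff in auto)
  have "integral {t0..t1} (\<lambda>t. \<bar>f (a + t *\<^sub>R d)\<bar>) = (LINT t:{t0..t1}|lborel. \<bar>f (a + t *\<^sub>R d)\<bar>)"
    using set_borel_integral_eq_integral(2)[OF hi] by simp
  also have "\<dots> \<le> (LINT t:{t0..t1}|lborel. (\<epsilon> + \<mu> * R) + G (a $ j + d $ j * t) / (2 * \<mu>))"
    using ae by (intro set_integral_mono_AE hi set_integral_add(1) ci Gi) auto
  also have "\<dots> = (LINT t:{t0..t1}|lborel. \<epsilon> + \<mu> * R) + (LINT t:{t0..t1}|lborel. G (a $ j + d $ j * t) / (2 * \<mu>))"
    by (rule set_integral_add(2)[OF ci Gi])
  also have "(LINT t:{t0..t1}|lborel. \<epsilon> + \<mu> * R) = (\<epsilon> + \<mu> * R) * (t1 - t0)"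
    using t by (simp add: set_lebesgue_integral_def)
  also have "(LINT t:{t0..t1}|lborel. G (a $ j + d $ j * t) / (2 * \<mu>)) \<le> (LINT t|lborel. G (a $ j + d $ j * t) / (2 * \<mu>))"
    unfolding set_lebesgue_integral_def
    using Gi Gaff Gnn \<open>\<mu> > 0\<close>
    by (intro integral_mono) (auto simp: set_integrable_def split: split_indicator)
  also have "\<dots> \<le> D / \<mu>"
    using Gval \<open>\<mu> > 0\<close> by (simp add: field_simps)
  finally show ?thesis by simp
qed

end

section \<open>Slopes along a polyline and angles\<close>

text \<open>A largest angle is at least \<pi>/3. Here \<open>k\<close> is the cosine between the
  sides \<open>A\<close> and \<open>B\<close>, and \<open>A - k * B\<close> and
  \<open>B - k * A\<close> are \<open>C\<close> times the cosines of the other two angles. Comparing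
  cosines avoids the angle sum.\<close>

lemma cos_largest_angle_le_half:
  fixes A B C k :: real
  assumes pos: "A > 0" "B > 0" "C > 0" and "k < 1"
    and C: "C\<^sup>2 = A\<^sup>2 + B\<^sup>2 - 2 * k * A * B"
    and le: "k * C \<le> A - k * B" "k * C \<le> B - k * A"
  shows "k \<le> 1 / 2"
proof (rule ccontr)
  assume "\<not> ?thesis"
  then have k: "1 / 2 < k" by simp
  \<comment> \<open>With \<open>B\<close> the shorter of the two sides,
    \<open>k * C \<le> B * (1 - k)\<close> and
    \<open>2 * (1 - k) * B\<^sup>2 \<le> C\<^sup>2\<close> combine to
    \<open>2 * k\<^sup>2 \<le> 1 - k\<close>, which fails beyond 1/2.\<close>
  have key: False
    if "B \<le> A" "A > 0" "B > 0" "C\<^sup>2 = A\<^sup>2 + B\<^sup>2 - 2 * k * A * B" "k * C \<le> B - k * A" for A B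
  proof -
    have "k * C \<le> B * (1 - k)"
    proof -
      have "k * B \<le> k * A" using that(1) k by (intro mult_left_mono) auto
      then show ?thesis using that(5) by (simp add: algebra_simps)
    qed
    then have "(k * C)\<^sup>2 \<le> (B * (1 - k))\<^sup>2"
      using k pos by (intro power_mono) auto
    moreover have "2 * (1 - k) * B\<^sup>2 \<le> C\<^sup>2"
    proof -
      have "C\<^sup>2 = (A - B)\<^sup>2 + 2 * (1 - k) * (A * B)"
        unfolding that(4) by (simp add: power2_eq_square algebra_simps)
      moreover have "2 * (1 - k) * (B * B) \<le> 2 * (1 - k) * (A * B)"
        using \<open>k < 1\<close> that by (intro mult_left_mono mult_right_mono) auto
      ultimately show ?thesis
        using zero_le_power2[of "A - B"] unfolding power2_eq_square[of B] by linarith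
    qed
    then have "k\<^sup>2 * (2 * (1 - k) * B\<^sup>2) \<le> (k * C)\<^sup>2"
      unfolding power_mult_distrib by (intro mult_left_mono) auto
    ultimately have "(2 * k\<^sup>2) * ((1 - k) * B\<^sup>2) \<le> (1 - k) * ((1 - k) * B\<^sup>2)"
      by (simp add: power2_eq_square algebra_simps)
    moreover have "0 < (1 - k) * B\<^sup>2" using \<open>k < 1\<close> that by simp
    ultimately have "2 * k\<^sup>2 \<le> 1 - k"
      using mult_le_cancel_right_pos by blast
    moreover have "(1 / 2)\<^sup>2 < k\<^sup>2" using k by (intro power_strict_mono) auto
    ultimately show False using k by (simp add: power2_eq_square)
  qed
  show False
  proof (cases "B \<le> A")
    case True
    then show ?thesis using key[of B A] pos C le by simp
  next
    case False
    then show ?thesis using key[of A B] pos C le by (simp add: mult_ac add_ac)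
  qed
qed

text \<open>In coordinates along and across the band, (b1, b2) and (c1, -c2) are the unit directions
  of the two short edges of an element, (x, y) is the gradient error on it and (x1, y1), (x0, y0)
  are those on its neighbours; \<open>c1 * b2 + c2 * b1\<close> is the sine of the angle between the
  edges. If both edges are flat, each edge equation moves the first component by at most 4 M times
  the normal part of the edge direction, and the sine is at least half the sum of these parts. If
  just one is steep, the sine is at least 3/7 and the trivial bound 2 M suffices.\<close>

lemma slope_jump_le_unit:
  fixes b1 b2 c1 c2 x y x1 y1 x0 y0 M :: real
  assumes pos: "b1 > 0" "b2 > 0" "c1 > 0" "c2 > 0"
    and unit: "b1\<^sup>2 + b2\<^sup>2 = 1" "c1\<^sup>2 + c2\<^sup>2 = 1"
    and cosle: "c2 * b2 - c1 * b1 \<le> 1 / 2"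
    and edge: "x * b1 + y * b2 = x1 * b1 + y1 * b2" "x * c1 - y * c2 = x0 * c1 - y0 * c2"
    and M: "\<bar>y\<bar> \<le> M" "\<bar>x1\<bar> \<le> M" "\<bar>y1\<bar> \<le> M" "\<bar>x0\<bar> \<le> M" "\<bar>y0\<bar> \<le> M"
  shows "\<bar>x1 - x0\<bar> \<le> 8 * (c1 * b2 + c2 * b1) * M"
proof -
  have M0: "0 \<le> M" using M by linarith
  have flat: "\<bar>u\<bar> \<le> 4 * M * e2"
    if "1/2 \<le> e1" "0 < e2" "u * e1 = v * e2" "\<bar>v\<bar> \<le> 2 * M" for u v e1 e2
  proof -
    have "\<bar>u\<bar> * (1/2) \<le> \<bar>u\<bar> * e1" using that by (intro mult_left_mono) auto
    also have "\<dots> = \<bar>v\<bar> * e2" using that by (metis abs_mult abs_of_pos less_le_trans half_gt_zero zero_less_one)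
    also have "\<dots> \<le> 2 * M * e2" using that by (intro mult_right_mono) auto
    finally show ?thesis by simp
  qed
  \<comment> \<open>6/7 is a rational lower bound for half the square root of 3.\<close>
  have large: "6 / 7 \<le> e2" if "e1 < 1/2" "0 < e1" "0 < e2" "e1\<^sup>2 + e2\<^sup>2 = 1" for e1 e2 :: real
  proof (rule power2_le_imp_le)
    have "e1\<^sup>2 \<le> (1/2)\<^sup>2" using that by (intro power_mono) auto
    then show "(6/7)\<^sup>2 \<le> e2\<^sup>2" using that by (simp add: power2_eq_square)
  qed (use that in simp)
  have triv: "\<bar>x1 - x0\<bar> \<le> 2 * M" using M by linarith
  have steep: ?thesis if "3/7 \<le> c1 * b2 + c2 * b1"
  proof -
    have "3/7 * M \<le> (c1 * b2 + c2 * b1) * M" using that M0 by (rule mult_right_mono)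
    then show ?thesis using triv M0 by linarith
  qed
  consider "1/2 \<le> b1" "1/2 \<le> c1" | "b1 < 1/2" "1/2 \<le> c1" | "1/2 \<le> b1" "c1 < 1/2"
    | "b1 < 1/2" "c1 < 1/2" by linarith
  then show ?thesis
  proof cases
    case 1
    have "\<bar>x1 - x\<bar> \<le> 4 * M * b2"
      by (rule flat[OF 1(1) pos(2), of _ "y - y1"]) (use edge M in \<open>auto simp: algebra_simps\<close>)
    moreover have "\<bar>x0 - x\<bar> \<le> 4 * M * c2"
      by (rule flat[OF 1(2) pos(4), of _ "y0 - y"]) (use edge M in \<open>auto simp: algebra_simps\<close>)
    moreover have "(1/2) * b2 + (1/2) * c2 \<le> c1 * b2 + c2 * b1"
    proof -
      have "(1/2) * c2 \<le> b1 * c2" "(1/2) * b2 \<le> c1 * b2"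
        using 1 pos by (intro mult_right_mono; simp)+
      then show ?thesis by (simp add: mult.commute)
    qed
    then have "((1/2) * b2 + (1/2) * c2) * M \<le> (c1 * b2 + c2 * b1) * M"
      using M0 by (rule mult_right_mono)
    ultimately show ?thesis by (simp add: algebra_simps)
  next
    case 2
    have "(1/2) * (6/7) \<le> c1 * b2" using 2 large[of b1 b2] pos unit by (intro mult_mono) auto
    moreover have "0 \<le> c2 * b1" using pos by simp
    ultimately show ?thesis by (intro steep) linarith
  next
    case 3
    have "(6/7) * (1/2) \<le> c2 * b1" using 3 large[of c1 c2] pos unit by (intro mult_mono) auto
    moreover have "0 \<le> c1 * b2" using pos by simp
    ultimately show ?thesis by (intro steep) linarith
  next
    \<comment> \<open>Two steep edges would enclose an angle with cosine above 1/2, too sharp for a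
      largest angle.\<close>
    case 4
    have "b1\<^sup>2 < 1/4" "c1\<^sup>2 < 1/4"
      using 4 pos power_strict_mono[of b1 "1/2" 2] power_strict_mono[of c1 "1/2" 2]
      by (simp_all add: power2_eq_square)
    then have "(3/4) * (3/4) < c2\<^sup>2 * b2\<^sup>2"
      using unit by (intro mult_strict_mono) auto
    then have "(3/4)\<^sup>2 < (c2 * b2)\<^sup>2" by (simp add: power_mult_distrib power2_eq_square mult_ac)
    then have "3/4 < c2 * b2" by (rule power2_less_imp_less) (use pos in simp)
    moreover have "c1 * b1 < (1/2) * (1/2)" using 4 pos by (intro mult_strict_mono) auto
    ultimately show ?thesis using cosle by simp
  qed
qed

section \<open>Piecewise linear functions on an interval\<close>

lemma slope_diff_le_sum_jumps:
  fixes \<tau> :: "nat \<Rightarrow> real"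
  assumes "i \<le> N" "j \<le> N"
  shows "\<tau> i - \<tau> j \<le> (\<Sum>k=1..N. \<bar>\<tau> k - \<tau> (k - 1)\<bar>)"
proof -
  have *: "\<bar>\<tau> i - \<tau> j\<bar> \<le> (\<Sum>k=1..N. \<bar>\<tau> k - \<tau> (k - 1)\<bar>)" if "j \<le> i" "i \<le> N" for i j
  proof -
    have "\<bar>\<tau> i - \<tau> j\<bar> \<le> (\<Sum>k\<in>{j<..i}. \<bar>\<tau> k - \<tau> (k - 1)\<bar>)"
      using that(1)
    proof (induction i rule: dec_induct)
      case (step n)
      have "{j<..Suc n} = insert (Suc n) {j<..n}" using step by auto
      then show ?case using step.IH by simp
    qed simp
    also have "\<dots> \<le> (\<Sum>k=1..N. \<bar>\<tau> k - \<tau> (k - 1)\<bar>)"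
      using that by (intro sum_mono2) auto
    finally show ?thesis .
  qed
  show ?thesis using *[of i j] *[of j i] assms by (cases "i \<le> j") (auto simp: abs_minus_commute)
qed

lemma piecewise_linear_increment_le:
  fixes g :: "real \<Rightarrow> real" and t :: "nat \<Rightarrow> real"
  assumes "\<And>i. i \<le> N \<Longrightarrow> t i < t (Suc i)"
    and "\<And>i x. i \<le> N \<Longrightarrow> t i \<le> x \<Longrightarrow> x \<le> t (Suc i) \<Longrightarrow> g x = g (t i) + \<tau> i * (x - t i)"
    and "\<And>i. i \<le> N \<Longrightarrow> \<tau> i \<le> m"
    and "t 0 \<le> x" "x \<le> y" "y \<le> t (Suc N)"
  shows "g y - g x \<le> m * (y - x)"
proof -
  have last: "g y - g x \<le> m * (y - x)" if "i \<le> N" "t i \<le> x" "x \<le> y" "y \<le> t (Suc i)" for x y i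
  proof -
    have "g y - g x = \<tau> i * (y - x)"
      using assms(2)[OF that(1), of x] assms(2)[OF that(1), of y] that by (simp add: algebra_simps)
    also have "\<dots> \<le> m * (y - x)" using assms(3) that by (intro mult_right_mono) auto
    finally show ?thesis .
  qed
  have "g y - g x \<le> m * (y - x)"
    if "n \<le> N" "t 0 \<le> x" "x \<le> y" "y \<le> t (Suc n)" for n x y
    using that
  proof (induction n arbitrary: x y)
    case 0
    then show ?case using last[of 0 x y] by simp
  next
    case (Suc n)
    consider "y \<le> t (Suc n)" | "t (Suc n) \<le> x" | "x \<le> t (Suc n)" "t (Suc n) \<le> y" by linarith
    then show ?case
    proof cases
      case 1
      then show ?thesis using Suc by simp
    next
      case 2
      then show ?thesis using last[of "Suc n" x y] Suc by simp
    next
      case 3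
      have "g (t (Suc n)) - g x \<le> m * (t (Suc n) - x)" using Suc 3 by simp
      moreover have "g y - g (t (Suc n)) \<le> m * (y - t (Suc n))"
        using last[of "Suc n" "t (Suc n)" y] Suc 3 by simp
      ultimately show ?thesis by (simp add: algebra_simps)
    qed
  qed
  then show ?thesis using assms by blast
qed

text \<open>Each of the two increments is governed by an extreme slope, and the extreme slopes
  differ by at most the total jump.\<close>

lemma piecewise_linear_second_difference:
  fixes g :: "real \<Rightarrow> real" and t :: "nat \<Rightarrow> real"
  assumes t: "\<And>i. i \<le> N \<Longrightarrow> t i < t (Suc i)"
    and g: "\<And>i x. i \<le> N \<Longrightarrow> t i \<le> x \<Longrightarrow> x \<le> t (Suc i) \<Longrightarrow> g x = g (t i) + \<tau> i * (x - t i)"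
    and s: "t 0 \<le> s" "0 \<le> \<delta>" "s + 2 * \<delta> \<le> t (Suc N)"
  shows "g s - 2 * g (s + \<delta>) + g (s + 2 * \<delta>) \<le> (\<Sum>k=1..N. \<bar>\<tau> k - \<tau> (k - 1)\<bar>) * \<delta>"
proof -
  define hi lo where "hi = Max (\<tau> ` {0..N})" and "lo = Min (\<tau> ` {0..N})"
  have hi: "\<tau> i \<le> hi" and lo: "lo \<le> \<tau> i" if "i \<le> N" for i
    using that by (auto simp: hi_def lo_def)
  have "hi \<in> \<tau> ` {0..N}" "lo \<in> \<tau> ` {0..N}"
    unfolding hi_def lo_def by (intro Max_in Min_in; simp)+
  then have osc: "hi - lo \<le> (\<Sum>k=1..N. \<bar>\<tau> k - \<tau> (k - 1)\<bar>)"
    using slope_diff_le_sum_jumps by auto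
  have "g (s + 2 * \<delta>) - g (s + \<delta>) \<le> hi * (s + 2 * \<delta> - (s + \<delta>))"
    by (rule piecewise_linear_increment_le[where \<tau> = \<tau> and N = N, OF t g]) (use s hi in auto)
  moreover have "- g (s + \<delta>) - - g s \<le> (- lo) * (s + \<delta> - s)"
    by (rule piecewise_linear_increment_le[where N = N and t = t and g = "\<lambda>x. - g x" and \<tau> = "\<lambda>i. - \<tau> i"])
      (use s lo t g in \<open>auto simp: algebra_simps\<close>)
  ultimately have "g s - 2 * g (s + \<delta>) + g (s + 2 * \<delta>) \<le> (hi - lo) * \<delta>"
    by (simp add: algebra_simps)
  also have "\<dots> \<le> (\<Sum>k=1..N. \<bar>\<tau> k - \<tau> (k - 1)\<bar>) * \<delta>"
    using osc s by (intro mult_right_mono)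
  finally show ?thesis .
qed

text \<open>With step \<delta> = L/3 the second difference of the parabola is 2 \<delta>^2 and that
  of \<open>g\<close> at most \<delta>^2, so the distances at three points, with weights 1, 2, 1,
  add up to at least \<delta>^2. As the first point runs through the first third, the three points
  sweep the three thirds; the largest weight gives \<delta>^3 \<le> 2 times the integral, whence 54
  = 2 * 27.\<close>

lemma piecewise_linear_far_from_parabola:
  fixes g :: "real \<Rightarrow> real" and t :: "nat \<Rightarrow> real"
  assumes t: "\<And>i. i \<le> N \<Longrightarrow> t i < t (Suc i)"
    and g: "\<And>i x. i \<le> N \<Longrightarrow> t i \<le> x \<Longrightarrow> x \<le> t (Suc i) \<Longrightarrow> g x = g (t i) + \<tau> i * (x - t i)"
    and q: "\<And>x. q x = x\<^sup>2 + b * x + c"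
    and cont: "continuous_on {t 0..t (Suc N)} g"
    and L: "L = t (Suc N) - t 0" "0 \<le> L"
    and jumps: "(\<Sum>k=1..N. \<bar>\<tau> k - \<tau> (k - 1)\<bar>) \<le> L / 3"
  shows "L ^ 3 / 54 \<le> integral {t 0..t (Suc N)} (\<lambda>x. \<bar>q x - g x\<bar>)"
proof -
  define \<delta> where "\<delta> = L / 3"
  have \<delta>: "0 \<le> \<delta>" "L = 3 * \<delta>" using L by (simp_all add: \<delta>_def)
  have jumps': "(\<Sum>k=1..N. \<bar>\<tau> k - \<tau> (k - 1)\<bar>) \<le> \<delta>" using jumps by (simp add: \<delta>_def)
  define h where "h x = \<bar>q x - g x\<bar>" for x
  have ch: "continuous_on {t 0..t (Suc N)} h"
    unfolding h_def q using cont by (intro continuous_intros)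
  have ch': "continuous_on {x..y} h" if "t 0 \<le> x" "y \<le> t (Suc N)" for x y
    using that by (intro continuous_on_subset[OF ch]) auto
  have ih: "h integrable_on {x..y}" if "t 0 \<le> x" "y \<le> t (Suc N)" for x y
    using ch'[OF that] by (rule integrable_continuous_real)
  let ?a = "t 0"
  have b: "t (Suc N) = ?a + 3 * \<delta>" using L(1) \<delta> by simp
  have pt: "\<delta>\<^sup>2 \<le> h s + 2 * h (s + \<delta>) + h (s + 2 * \<delta>)" if "s \<in> {?a..?a + \<delta>}" for s
  proof -
    have "g s - 2 * g (s + \<delta>) + g (s + 2 * \<delta>) \<le> (\<Sum>k=1..N. \<bar>\<tau> k - \<tau> (k - 1)\<bar>) * \<delta>"
      by (rule piecewise_linear_second_difference[where N = N and t = t and g = g and \<tau> = \<tau>, OF t g])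
        (use \<delta> that b in auto)
    also have "\<dots> \<le> \<delta> * \<delta>" using jumps' \<delta>(1) by (rule mult_right_mono)
    finally have "g s - 2 * g (s + \<delta>) + g (s + 2 * \<delta>) \<le> \<delta>\<^sup>2" by (simp add: power2_eq_square)
    moreover have "q s - 2 * q (s + \<delta>) + q (s + 2 * \<delta>) = 2 * \<delta>\<^sup>2"
      unfolding q by (simp add: power2_eq_square algebra_simps)
    moreover have "q s - g s \<le> h s" "- (q (s + \<delta>) - g (s + \<delta>)) \<le> h (s + \<delta>)"
      "q (s + 2 * \<delta>) - g (s + 2 * \<delta>) \<le> h (s + 2 * \<delta>)"
      unfolding h_def by (rule abs_ge_self abs_ge_minus_self)+
    ultimately show ?thesis by linarith
  qed
  have s1: "(\<lambda>s. h (s + \<delta>)) integrable_on {?a..?a + \<delta>}" "(\<lambda>s. h (s + 2 * \<delta>)) integrable_on {?a..?a + \<delta>}"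
    using \<delta> b by (intro integrable_continuous_real continuous_on_compose2[OF ch] continuous_intros; force)+
  have sh1: "integral {?a..?a + \<delta>} (\<lambda>s. h (s + \<delta>)) = integral {?a + \<delta>..?a + 2 * \<delta>} h"
  proof -
    have "continuous_on {?a + \<delta>..?a + \<delta> + \<delta>} h" by (rule ch') (use \<delta>(1) b in auto)
    from integral_shift[OF this] have "integral {?a + \<delta>..?a + \<delta> + \<delta>} h = integral {?a..?a + \<delta>} (\<lambda>s. h (s + \<delta>))"
      by (simp only: o_def)
    moreover have "?a + \<delta> + \<delta> = ?a + 2 * \<delta>" by simp
    ultimately show ?thesis by metis
  qed
  have sh2: "integral {?a..?a + \<delta>} (\<lambda>s. h (s + 2 * \<delta>)) = integral {?a + 2 * \<delta>..?a + 3 * \<delta>} h"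
  proof -
    have "continuous_on {?a + 2 * \<delta>..?a + \<delta> + 2 * \<delta>} h" by (rule ch') (use \<delta>(1) b in auto)
    from integral_shift[OF this] have "integral {?a + 2 * \<delta>..?a + \<delta> + 2 * \<delta>} h = integral {?a..?a + \<delta>} (\<lambda>s. h (s + 2 * \<delta>))"
      by (simp only: o_def)
    moreover have "?a + \<delta> + 2 * \<delta> = ?a + 3 * \<delta>" by simp
    ultimately show ?thesis by metis
  qed
  have "\<delta>\<^sup>2 * \<delta> = integral {?a..?a + \<delta>} (\<lambda>s. \<delta>\<^sup>2)" using \<delta>(1) by simp
  also have "\<dots> \<le> integral {?a..?a + \<delta>} (\<lambda>s. h s + 2 * h (s + \<delta>) + h (s + 2 * \<delta>))"
    using pt s1 ih[of ?a "?a + \<delta>"] \<delta> b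
    by (intro integral_le integrable_add integrable_on_mult_right integrable_const_ivl) auto
  also have "\<dots> = integral {?a..?a + \<delta>} h + 2 * integral {?a + \<delta>..?a + 2 * \<delta>} h
      + integral {?a + 2 * \<delta>..?a + 3 * \<delta>} h"
  proof -
    have "integral {?a..?a + \<delta>} (\<lambda>s. h s + 2 * h (s + \<delta>) + h (s + 2 * \<delta>))
        = integral {?a..?a + \<delta>} h + 2 * integral {?a..?a + \<delta>} (\<lambda>s. h (s + \<delta>))
          + integral {?a..?a + \<delta>} (\<lambda>s. h (s + 2 * \<delta>))"
      using s1 ih[of ?a "?a + \<delta>"] \<delta> b
      by (subst Henstock_Kurzweil_Integration.integral_add integral_mult_right;
          (intro integrable_add integrable_on_mult_right)?; simp)+
    then show ?thesis unfolding sh1 sh2 .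
  qed
  also have "\<dots> \<le> 2 * (integral {?a..?a + \<delta>} h + integral {?a + \<delta>..?a + 2 * \<delta>} h
      + integral {?a + 2 * \<delta>..?a + 3 * \<delta>} h)"
  proof -
    have "0 \<le> integral {x..y} h" if "t 0 \<le> x" "y \<le> t (Suc N)" for x y
      by (rule integral_nonneg[OF ih[OF that]]) (simp add: h_def)
    from this[of ?a "?a + \<delta>"] this[of "?a + 2 * \<delta>" "?a + 3 * \<delta>"] show ?thesis using \<delta> b by simp
  qed
  also have "integral {?a..?a + \<delta>} h + integral {?a + \<delta>..?a + 2 * \<delta>} h
      + integral {?a + 2 * \<delta>..?a + 3 * \<delta>} h = integral {?a..t (Suc N)} h"
  proof -
    have "integral {?a..?a + \<delta>} h + integral {?a + \<delta>..?a + 2 * \<delta>} h = integral {?a..?a + 2 * \<delta>} h"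
      using \<delta> b by (intro Henstock_Kurzweil_Integration.integral_combine ih) auto
    moreover have "integral {?a..?a + 2 * \<delta>} h + integral {?a + 2 * \<delta>..?a + 3 * \<delta>} h = integral {?a..?a + 3 * \<delta>} h"
      using \<delta> b by (intro Henstock_Kurzweil_Integration.integral_combine ih) auto
    ultimately show ?thesis using b by simp
  qed
  finally have "\<delta>\<^sup>2 * \<delta> \<le> 2 * integral {?a..t (Suc N)} h" .
  then show ?thesis using \<delta> by (simp add: h_def[abs_def] power2_eq_square power3_eq_cube)
qed

section \<open>Bands\<close>

lemma orthonormal_inner_expand:
  fixes d n x y :: "real^2"
  assumes "norm d = 1" "norm n = 1" "d \<bullet> n = 0"
  shows "x \<bullet> y = (x \<bullet> d) * (y \<bullet> d) + (x \<bullet> n) * (y \<bullet> n)"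
proof -
  have "d \<bullet> d = 1" "n \<bullet> n = 1" using assms by (simp_all add: norm_eq_1)
  then have e: "d $ 1 * d $ 1 + d $ 2 * d $ 2 = 1" "n $ 1 * n $ 1 + n $ 2 * n $ 2 = 1"
    "d $ 1 * n $ 1 + d $ 2 * n $ 2 = 0"
    using assms(3) by (simp_all add: inner_vec_def sum_2)
  \<comment> \<open>An orthogonal matrix: the columns are orthonormal because the rows
    \<open>d\<close> and \<open>n\<close> are.\<close>
  have c: "d $ 1 * d $ 1 + n $ 1 * n $ 1 = 1" "d $ 2 * d $ 2 + n $ 2 * n $ 2 = 1"
    "d $ 1 * d $ 2 + n $ 1 * n $ 2 = 0"
    using e by algebra+
  have "(x \<bullet> d) * (y \<bullet> d) + (x \<bullet> n) * (y \<bullet> n)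
      = x $ 1 * y $ 1 * (d $ 1 * d $ 1 + n $ 1 * n $ 1) + x $ 2 * y $ 2 * (d $ 2 * d $ 2 + n $ 2 * n $ 2)
        + (x $ 1 * y $ 2 + x $ 2 * y $ 1) * (d $ 1 * d $ 2 + n $ 1 * n $ 2)"
    by (simp add: inner_vec_def sum_2 algebra_simps)
  then show ?thesis by (simp add: c inner_vec_def sum_2)
qed

text \<open>The geometric form of \<open>slope_jump_le_unit\<close>. Continuity across the edges
  from \<open>Q0\<close> to \<open>P\<close> and from \<open>P\<close> to \<open>Q1\<close>
  prescribes the component of \<open>e\<close> along each of them. When the angle at
  \<open>P\<close> is near \<pi>, both directions nearly coincide with \<open>d\<close>, and then
  \<open>e0\<close> and \<open>e1\<close> can differ along \<open>d\<close> only if large components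
  normal to \<open>d\<close> make up for it.\<close>

lemma gradient_jump:
  fixes d n P Q0 Q1 e e0 e1 :: "real^2"
  assumes on: "norm d = 1" "norm n = 1" "d \<bullet> n = 0"
    and p: "(P - Q0) \<bullet> d > 0" "(P - Q0) \<bullet> n < 0"
    and q: "(Q1 - P) \<bullet> d > 0" "(Q1 - P) \<bullet> n > 0"
    and max: "max_angle Q0 Q1 P = angle_at Q0 P Q1"
    and edge: "e \<bullet> (P - Q0) = e0 \<bullet> (P - Q0)" "e \<bullet> (Q1 - P) = e1 \<bullet> (Q1 - P)"
    and M: "norm e \<le> M" "norm e0 \<le> M" "norm e1 \<le> M"
  shows "0 < sin (pi - max_angle Q0 Q1 P)"
    and "\<bar>(e1 - e0) \<bullet> d\<bar> \<le> 8 * sin (pi - max_angle Q0 Q1 P) * M"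
proof -
  define p where "p = P - Q0"
  define q where "q = Q1 - P"
  define A B C where "A = norm p" and "B = norm q" and "C = norm (p + q)"
  have exp: "x \<bullet> y = (x \<bullet> d) * (y \<bullet> d) + (x \<bullet> n) * (y \<bullet> n)" for x y :: "real^2"
    by (rule orthonormal_inner_expand[OF on])
  have pq: "p \<bullet> d > 0" "p \<bullet> n < 0" "q \<bullet> d > 0" "q \<bullet> n > 0"
    using p q by (simp_all only: p_def q_def)
  have ABC: "A > 0" "B > 0" "C > 0"
    unfolding A_def B_def C_def using pq by (auto simp: inner_add_left dest: arg_cong[where f = "\<lambda>x. x \<bullet> d"])
  have sq: "A\<^sup>2 = p \<bullet> p" "B\<^sup>2 = q \<bullet> q" "C\<^sup>2 = (p + q) \<bullet> (p + q)"
    by (simp_all add: A_def B_def C_def power2_norm_eq_inner)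
  define b1 b2 c1 c2 where "b1 = q \<bullet> d / B" and "b2 = q \<bullet> n / B"
    and "c1 = p \<bullet> d / A" and "c2 = - (p \<bullet> n) / A"
  have pos: "b1 > 0" "b2 > 0" "c1 > 0" "c2 > 0"
    using pq ABC by (simp_all add: b1_def b2_def c1_def c2_def divide_neg_pos)
  have unit: "b1\<^sup>2 + b2\<^sup>2 = 1" "c1\<^sup>2 + c2\<^sup>2 = 1"
  proof -
    have "(q \<bullet> d)\<^sup>2 + (q \<bullet> n)\<^sup>2 = B\<^sup>2" "(p \<bullet> d)\<^sup>2 + (p \<bullet> n)\<^sup>2 = A\<^sup>2"
      using sq(1,2) exp[of p p] exp[of q q] by (simp_all add: power2_eq_square)
    moreover have "b1\<^sup>2 + b2\<^sup>2 = ((q \<bullet> d)\<^sup>2 + (q \<bullet> n)\<^sup>2) / B\<^sup>2" "c1\<^sup>2 + c2\<^sup>2 = ((p \<bullet> d)\<^sup>2 + (p \<bullet> n)\<^sup>2) / A\<^sup>2"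
      by (simp_all add: b1_def b2_def c1_def c2_def power_divide add_divide_distrib)
    ultimately show "b1\<^sup>2 + b2\<^sup>2 = 1" "c1\<^sup>2 + c2\<^sup>2 = 1" using ABC by simp_all
  qed
  \<comment> \<open>The cosine of the angle at \<open>P\<close>; the signs come from
    \<open>p\<close> pointing towards \<open>P\<close> and \<open>q\<close> away from it.\<close>
  define k where "k = c2 * b2 - c1 * b1"
  have kpq: "k * A * B = - (p \<bullet> q)"
    using ABC exp[of p q] by (simp add: k_def b1_def b2_def c1_def c2_def field_simps)
  have id: "(c1 * b2 + c2 * b1)\<^sup>2 = 1 - k\<^sup>2"
  proof -
    have "(c1 * b2 + c2 * b1)\<^sup>2 + k\<^sup>2 = (c1\<^sup>2 + c2\<^sup>2) * (b1\<^sup>2 + b2\<^sup>2)"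
      by (simp add: k_def power2_eq_square algebra_simps)
    then show ?thesis using unit by simp
  qed
  have spos: "0 < c1 * b2 + c2 * b1" using pos by (simp add: add_pos_pos)
  have k2: "k\<^sup>2 < 1" using id spos by (smt (verit) zero_less_power)
  then have k1: "\<bar>k\<bar> \<le> 1" "k < 1"
    using abs_square_less_1[of k] by auto
  have ang: "angle_at Q0 P Q1 = arccos k"
  proof -
    have "(Q0 - P) \<bullet> (Q1 - P) = - (p \<bullet> q)" by (simp add: p_def q_def inner_diff_left)
    moreover have "norm (Q0 - P) = A" "norm (Q1 - P) = B"
      by (simp_all add: A_def B_def p_def q_def norm_minus_commute)
    moreover have "- (p \<bullet> q) / (A * B) = k" unfolding kpq[symmetric] using ABC by simp
    ultimately show ?thesis unfolding angle_at_def by (simp only:)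
  qed
  have s: "sin (pi - max_angle Q0 Q1 P) = c1 * b2 + c2 * b1"
  proof -
    have "sin (pi - max_angle Q0 Q1 P) = sqrt (1 - k\<^sup>2)"
      using k1 by (simp add: max ang sin_arccos)
    also have "\<dots> = c1 * b2 + c2 * b1" using spos by (simp add: id[symmetric])
    finally show ?thesis .
  qed
  have cosle: "k \<le> 1 / 2"
  proof (rule cos_largest_angle_le_half[OF ABC k1(2)])
    show "C\<^sup>2 = A\<^sup>2 + B\<^sup>2 - 2 * k * A * B"
    proof -
      have "C\<^sup>2 = A\<^sup>2 + B\<^sup>2 + 2 * (p \<bullet> q)"
        using sq by (simp add: inner_add_left inner_add_right inner_commute)
      then show ?thesis using kpq by (simp add: mult.assoc)
    qed
    have le: "k \<le> x / y" if "angle_at u v w \<le> angle_at Q0 P Q1" "(u - v) \<bullet> (w - v) = x"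
      "norm (u - v) * norm (w - v) = y" "y > 0" for u v w x y
    proof -
      have "\<bar>x\<bar> \<le> y" using Cauchy_Schwarz_ineq2[of "u - v" "w - v"] that by simp
      then have "\<bar>x / y\<bar> \<le> 1" using that(4) by simp
      moreover have "arccos (x / y) \<le> arccos k"
        using that(1) unfolding ang by (simp add: angle_at_def that(2,3))
      ultimately show ?thesis using arccos_le_mono[of "x / y" k] k1(1) by simp
    qed
    have "angle_at Q1 Q0 P \<le> max_angle Q0 Q1 P" "angle_at Q0 Q1 P \<le> max_angle Q0 Q1 P"
      by (simp_all add: max_angle_def)
    then have m: "angle_at Q1 Q0 P \<le> angle_at Q0 P Q1" "angle_at Q0 Q1 P \<le> angle_at Q0 P Q1"
      using max by simp_all
    have PQ: "Q1 - Q0 = p + q" "P - Q0 = p" "Q0 - Q1 = - (p + q)" "P - Q1 = - q"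
      by (simp_all add: p_def q_def)
    have "k \<le> (p + q) \<bullet> p / (C * A)"
      by (rule le[OF m(1)]) (use ABC in \<open>simp_all add: PQ A_def C_def\<close>)
    also have "(p + q) \<bullet> p / (C * A) = (A - k * B) / C"
    proof -
      have "(p + q) \<bullet> p = p \<bullet> p + p \<bullet> q" by (simp add: inner_add_left inner_commute[of q p])
      also have "\<dots> = A * A - k * A * B" using kpq sq(1) by (simp add: power2_eq_square)
      also have "\<dots> = (A - k * B) * A" by (simp add: algebra_simps)
      finally show ?thesis using ABC by simp
    qed
    finally show "k * C \<le> A - k * B" using ABC by (simp add: field_simps)
    have "k \<le> (p + q) \<bullet> q / (C * B)"
    proof (rule le[OF m(2)])
      show "(Q0 - Q1) \<bullet> (P - Q1) = (p + q) \<bullet> q" unfolding PQ by (simp only: inner_minus_left inner_minus_right minus_minus)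
      show "norm (Q0 - Q1) * norm (P - Q1) = C * B" unfolding PQ by (simp only: norm_minus_cancel B_def C_def)
    qed (use ABC in simp)
    also have "(p + q) \<bullet> q / (C * B) = (B - k * A) / C"
    proof -
      have "(p + q) \<bullet> q = q \<bullet> q + p \<bullet> q" by (simp add: inner_add_left)
      also have "\<dots> = B * B - k * A * B" using kpq sq(2) by (simp add: power2_eq_square)
      also have "\<dots> = (B - k * A) * B" by (simp add: algebra_simps)
      finally show ?thesis using ABC by simp
    qed
    finally show "k * C \<le> B - k * A" using ABC by (simp add: field_simps)
  qed
  show "0 < sin (pi - max_angle Q0 Q1 P)" using s spos by simp
  have cs: "\<bar>v \<bullet> d\<bar> \<le> M" "\<bar>v \<bullet> n\<bar> \<le> M" if "norm v \<le> M" for v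
    using Cauchy_Schwarz_ineq2[of v d] Cauchy_Schwarz_ineq2[of v n] on that by simp_all
  have "\<bar>e1 \<bullet> d - e0 \<bullet> d\<bar> \<le> 8 * (c1 * b2 + c2 * b1) * M"
  proof (rule slope_jump_le_unit[OF pos unit, where x = "e \<bullet> d" and y = "e \<bullet> n" and ?y1.0 = "e1 \<bullet> n" and ?y0.0 = "e0 \<bullet> n"])
    show "c2 * b2 - c1 * b1 \<le> 1 / 2" using cosle by (simp add: k_def)
    have "(e \<bullet> d) * (q \<bullet> d) + (e \<bullet> n) * (q \<bullet> n) = (e1 \<bullet> d) * (q \<bullet> d) + (e1 \<bullet> n) * (q \<bullet> n)"
      using edge(2) exp[of e q] exp[of e1 q] by (simp add: q_def)
    then show "e \<bullet> d * b1 + e \<bullet> n * b2 = e1 \<bullet> d * b1 + e1 \<bullet> n * b2"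
      using ABC by (simp add: b1_def b2_def add_divide_distrib[symmetric])
    have "(e \<bullet> d) * (p \<bullet> d) + (e \<bullet> n) * (p \<bullet> n) = (e0 \<bullet> d) * (p \<bullet> d) + (e0 \<bullet> n) * (p \<bullet> n)"
      using edge(1) exp[of e p] exp[of e0 p] by (simp add: p_def)
    then show "e \<bullet> d * c1 - e \<bullet> n * c2 = e0 \<bullet> d * c1 - e0 \<bullet> n * c2"
      using ABC by (simp add: c1_def c2_def add_divide_distrib[symmetric])
  qed (use cs M in auto)
  then show "\<bar>(e1 - e0) \<bullet> d\<bar> \<le> 8 * sin (pi - max_angle Q0 Q1 P) * M"
    unfolding s inner_diff_left .
qed

section \<open>Energy and area distributed over the cells\<close>

context mesh
begin

text \<open>Interiors of cells are disjoint and the frontiers are null sets, so the left side is the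
  integral of a function below \<open>g\<close>. It is applied to the squared gradient error and to
  the indicator of \<Omega>.\<close>

lemma cell_sum_le_integral:
  assumes g: "integrable lborel g" "\<And>x. 0 \<le> g x"
    and c: "\<And>K x. K \<in> \<T> \<Longrightarrow> x \<in> interior K \<Longrightarrow> x \<in> \<Omega> \<Longrightarrow> c K \<le> g x"
  shows "(\<Sum>K\<in>\<T>. measure lebesgue K * c K) \<le> (LINT x|lborel. g x)"
proof -
  have meas: "measure lebesgue K = measure lborel (interior K \<inter> \<Omega>)" if K: "K \<in> \<T>" for K
  proof -
    have "negligible (frontier K \<union> frontier \<Omega>)"
      using negligible_convex_frontier[OF convex_cell[OF K]] negligible_frontier by simp
    then have "AE x in lebesgue. x \<notin> frontier K \<union> frontier \<Omega>"
      by (intro AE_not_in) (simp add: negligible_iff_null_sets)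
    then have "AE x in lebesgue. x \<in> K \<longleftrightarrow> x \<in> interior K \<inter> \<Omega>"
    proof eventually_elim
      case (elim x)
      then show ?case
        using cell_subset[OF K] closure_subset[of K] interior_subset[of K] open_dom
        by (auto simp: frontier_def interior_open)
    qed
    then have "measure lebesgue K = measure lebesgue (interior K \<inter> \<Omega>)"
      using compact_cell[OF K] open_dom by (intro measure_eq_AE) (auto simp: compact_imp_closed)
    then show ?thesis using open_dom by (simp add: measure_completion)
  qed
  have fin: "integrable lborel (\<lambda>x. indicator (interior K \<inter> \<Omega>) x * c K)" for K
  proof -
    have "emeasure lborel (interior K \<inter> \<Omega>) \<le> emeasure lborel (closure \<Omega>)"
      using closure_subset[of \<Omega>] by (intro emeasure_mono) auto
    also have "\<dots> < \<infinity>" using bounded_dom by (intro emeasure_compact_finite) (simp add: compact_closure)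
    finally have "integrable lborel (indicator (interior K \<inter> \<Omega>) :: _ \<Rightarrow> real)"
      using open_dom by (intro integrable_real_indicator) auto
    then show ?thesis by simp
  qed
  have "(\<Sum>K\<in>\<T>. measure lebesgue K * c K) = (\<Sum>K\<in>\<T>. LINT x|lborel. indicator (interior K \<inter> \<Omega>) x * c K)"
    by (intro sum.cong) (auto simp: meas)
  also have "\<dots> = (LINT x|lborel. (\<Sum>K\<in>\<T>. indicator (interior K \<inter> \<Omega>) x * c K))"
    by (rule Bochner_Integration.integral_sum[symmetric]) (rule fin)
  also have "\<dots> \<le> (LINT x|lborel. g x)"
  proof (rule integral_mono)
    show "integrable lborel (\<lambda>x. \<Sum>K\<in>\<T>. indicator (interior K \<inter> \<Omega>) x * c K)"
      by (intro Bochner_Integration.integrable_sum fin)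
    fix x :: "real^2"
    show "(\<Sum>K\<in>\<T>. indicator (interior K \<inter> \<Omega>) x * c K) \<le> g x"
    proof (cases "\<exists>K\<in>\<T>. x \<in> interior K \<inter> \<Omega>")
      case True
      then obtain K where K: "K \<in> \<T>" "x \<in> interior K" "x \<in> \<Omega>" by blast
      have "indicator (interior K' \<inter> \<Omega>) x = (0::real)" if "K' \<in> \<T>" "K' \<noteq> K" for K'
        using interior_cell_disjoint[OF K(1) that(1) K(2)] interior_subset that
        by (auto simp: indicator_def)
      then have "(\<Sum>K\<in>\<T>. indicator (interior K \<inter> \<Omega>) x * c K) = (\<Sum>K'\<in>\<T>. if K' = K then c K else 0)"
        using K by (intro sum.cong) auto
      then show ?thesis using c[OF K] K(1) finite_mesh by simp
    next
      case False
      then have "(\<Sum>K\<in>\<T>. indicator (interior K \<inter> \<Omega>) x * c K) = 0"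
        by (intro sum.neutral) (auto split: split_indicator)
      then show ?thesis using g(2) by simp
    qed
  qed (rule g(1))
  finally show ?thesis .
qed

text \<open>\<open>m K\<close> is the minimum of the squared gradient error over the cell, so its
  product with the area stays below the energy. Elsewhere in the cell the norm exceeds its minimum a
  by at most 2 h, and (a + 2 h)^2 \<le> 2 a^2 + 8 h^2.\<close>

lemma cell_weights:
  obtains m where "\<And>K. 0 \<le> m K"
    "\<And>K z. K \<in> \<T> \<Longrightarrow> z \<in> K \<Longrightarrow> (norm (2 *\<^sub>R z + B K))\<^sup>2 \<le> 2 * m K + 8 * (mesh_size \<T>)\<^sup>2"
    "(\<Sum>K\<in>\<T>. measure lebesgue K * m K) \<le> (\<Sum>i\<in>UNIV. LINT x|lebesgue_on \<Omega>. (cell_grad 1 B i x)\<^sup>2)"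
proof -
  have "\<exists>x\<in>K. \<forall>y\<in>K. norm (2 *\<^sub>R x + B K) \<le> norm (2 *\<^sub>R y + B K)" if K: "K \<in> \<T>" for K
  proof (rule continuous_attains_inf[OF compact_cell[OF K]])
    show "K \<noteq> {}" using interior_cell_nonempty[OF K] interior_subset by blast
  qed (intro continuous_intros)
  then obtain z where z: "\<And>K. K \<in> \<T> \<Longrightarrow> z K \<in> K"
      "\<And>K y. K \<in> \<T> \<Longrightarrow> y \<in> K \<Longrightarrow> norm (2 *\<^sub>R z K + B K) \<le> norm (2 *\<^sub>R y + B K)"
    by metis
  define m where "m K = (norm (2 *\<^sub>R z K + B K))\<^sup>2" for K
  have "(norm (2 *\<^sub>R y + B K))\<^sup>2 \<le> 2 * m K + 8 * (mesh_size \<T>)\<^sup>2" if "K \<in> \<T>" "y \<in> K" for K y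
  proof -
    have "norm (2 *\<^sub>R y + B K) = norm ((2 *\<^sub>R z K + B K) + 2 *\<^sub>R (y - z K))"
      by (simp add: algebra_simps)
    also have "\<dots> \<le> norm (2 *\<^sub>R z K + B K) + 2 * dist y (z K)"
      by (rule norm_triangle_le) (simp add: dist_norm)
    also have "\<dots> \<le> norm (2 *\<^sub>R z K + B K) + 2 * mesh_size \<T>"
      using dist_cell_le[OF that z(1)[OF that(1)]] by simp
    finally have "(norm (2 *\<^sub>R y + B K))\<^sup>2 \<le> (norm (2 *\<^sub>R z K + B K) + 2 * mesh_size \<T>)\<^sup>2"
      by (intro power_mono) auto
    also have "\<dots> \<le> 2 * m K + 8 * (mesh_size \<T>)\<^sup>2"
      using sum_squares_bound[of "norm (2 *\<^sub>R z K + B K)" "2 * mesh_size \<T>"]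
      by (simp add: m_def power2_sum power_mult_distrib)
    finally show ?thesis .
  qed
  moreover have "(\<Sum>K\<in>\<T>. measure lebesgue K * m K) \<le> (LINT x|lborel. (\<Sum>i\<in>UNIV. (cell_grad 1 B i x)\<^sup>2))"
  proof (rule cell_sum_le_integral)
    show "integrable lborel (\<lambda>x. \<Sum>i\<in>UNIV. (cell_grad 1 B i x)\<^sup>2)"
      by (intro Bochner_Integration.integrable_sum cell_grad_square_integrable)
    fix K x assume K: "K \<in> \<T>" "x \<in> interior K" "x \<in> \<Omega>"
    have "m K \<le> (norm (2 *\<^sub>R x + B K))\<^sup>2"
      unfolding m_def using z(2)[OF K(1)] K(2) interior_subset by (intro power_mono) auto
    also have "\<dots> = (\<Sum>i\<in>UNIV. (cell_grad 1 B i x)\<^sup>2)"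
      unfolding power2_norm_eq_inner inner_vec_def
      by (simp add: cell_grad_interior[OF K] power2_eq_square)
    finally show "m K \<le> (\<Sum>i\<in>UNIV. (cell_grad 1 B i x)\<^sup>2)" .
  qed (simp add: sum_nonneg)
  then have "(\<Sum>K\<in>\<T>. measure lebesgue K * m K) \<le> (\<Sum>i\<in>UNIV. LINT x|lebesgue_on \<Omega>. (cell_grad 1 B i x)\<^sup>2)"
    by (simp add: integral_cell_grad_square Bochner_Integration.integral_sum cell_grad_square_integrable)
  moreover have "0 \<le> m K" for K by (simp add: m_def)
  ultimately show ?thesis using that by blast
qed

lemma total_area_le: "(\<Sum>K\<in>\<T>. measure lebesgue K) \<le> measure lebesgue \<Omega>"
proof -
  have i: "integrable lborel (indicator \<Omega> :: _ \<Rightarrow> real)"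
  proof -
    have "emeasure lborel \<Omega> < \<infinity>"
      using emeasure_bounded_finite[OF bounded_dom] by simp
    then show ?thesis using open_dom by (intro integrable_real_indicator) auto
  qed
  have "(\<Sum>K\<in>\<T>. measure lebesgue K * 1) \<le> (LINT x|lborel. indicator \<Omega> x)"
    by (rule cell_sum_le_integral[OF i]) auto
  then show ?thesis using open_dom by (simp add: measure_completion)
qed

end

section \<open>Geometry and jumps of a single band\<close>

lemma between_consecutive:
  fixes t :: "nat \<Rightarrow> real"
  assumes "t 0 \<le> x" "x \<le> t (Suc N)"
  shows "\<exists>i\<le>N. t i \<le> x \<and> x \<le> t (Suc i)"
  using assms
proof (induction N)
  case (Suc N)
  then show ?case
    by (cases "x \<le> t (Suc N)") (use le_SucI in blast, auto)
qed auto

text \<open>\<open>Q i\<close> lies off the line and no farther from either end of its edge than the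
  edge is long. By Pythagoras its foot is strictly inside the edge, which gives the signs of the
  tangential components that \<open>gradient_jump\<close> requires.\<close>

lemma band_pointsE:
  assumes "is_band \<T> N P Q"
  obtains a d n t where "norm d = 1" "norm n = 1" "d \<bullet> n = 0"
    "\<And>i. i \<le> Suc N \<Longrightarrow> P i = a + t i *\<^sub>R d" "\<And>i. i \<le> N \<Longrightarrow> t i < t (Suc i)"
    "\<And>i. i \<le> N \<Longrightarrow> (Q i - P i) \<bullet> n > 0"
    "\<And>i. i \<le> N \<Longrightarrow> (Q i - P i) \<bullet> d > 0"
    "\<And>i. i \<le> N \<Longrightarrow> (P (Suc i) - Q i) \<bullet> n < 0"
    "\<And>i. i \<le> N \<Longrightarrow> (P (Suc i) - Q i) \<bullet> d > 0"
proof -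
  obtain a d n t where on: "norm d = 1" "norm n = 1" "d \<bullet> n = 0"
    and P0: "\<forall>i\<in>{0..N + 1}. P i = a + t i *\<^sub>R d" and t0: "\<forall>i\<in>{0..N}. t i < (t (i + 1) :: real)"
    and Q0: "\<forall>i\<in>{0..N}. (Q i - a) \<bullet> n > 0"
    using assms unfolding is_band_def by (elim conjE exE) (rule that)
  have P: "P i = a + t i *\<^sub>R d" if "i \<le> Suc N" for i using P0 that by simp
  have t: "t i < t (Suc i)" if "i \<le> N" for i using t0 that by simp
  have dd: "d \<bullet> d = 1" using on(1) by (simp add: norm_eq_1)
  have "(Q i - P i) \<bullet> n > 0 \<and> (Q i - P i) \<bullet> d > 0 \<and> (P (Suc i) - Q i) \<bullet> n < 0 \<and> (P (Suc i) - Q i) \<bullet> d > 0"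
    if i: "i \<le> N" for i
  proof -
    define v l where "v = Q i - P i" and "l = t (Suc i) - t i"
    have l: "0 < l" using t[OF i] by (simp add: l_def)
    have PP: "P (Suc i) - P i = l *\<^sub>R d"
      using P[of i] P[of "Suc i"] i by (simp add: l_def algebra_simps)
    have vn: "v \<bullet> n > 0"
      using Q0 P[of i] i on(3) by (simp add: v_def inner_diff_left inner_add_left)
    have sq: "x \<bullet> x = (x \<bullet> d)\<^sup>2 + (x \<bullet> n)\<^sup>2" for x :: "real^2"
      using orthonormal_inner_expand[OF on, of x x] by (simp add: power2_eq_square)
    have PQ: "P (Suc i) - Q i = l *\<^sub>R d - v" using PP by (simp add: v_def algebra_simps)
    have "norm v \<le> l" "norm (l *\<^sub>R d - v) \<le> l"
    proof -
      have "dist (P i) (Q i) \<le> dist (P i) (P (Suc i))" "dist (P (Suc i)) (Q i) \<le> dist (P i) (P (Suc i))"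
        using assms i unfolding is_band_def by auto
      moreover have "dist (P i) (P (Suc i)) = l"
        using PP l on(1) by (subst dist_commute) (simp add: dist_norm)
      ultimately show "norm v \<le> l" "norm (l *\<^sub>R d - v) \<le> l"
        unfolding PQ[symmetric] by (simp_all add: v_def dist_norm norm_minus_commute)
    qed
    then have "v \<bullet> v \<le> l\<^sup>2" "(l *\<^sub>R d - v) \<bullet> (l *\<^sub>R d - v) \<le> l\<^sup>2"
      using l by (simp_all add: norm_le_square power2_eq_square dot_square_norm abs_le_square_iff[symmetric])
    then have a: "(v \<bullet> d)\<^sup>2 + (v \<bullet> n)\<^sup>2 \<le> l\<^sup>2" "(l - v \<bullet> d)\<^sup>2 + (v \<bullet> n)\<^sup>2 \<le> l\<^sup>2"
      unfolding sq by (simp_all add: inner_diff_left dd on(3))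
    have "(v \<bullet> n)\<^sup>2 > 0" using vn by simp
    then have "(v \<bullet> d)\<^sup>2 < l\<^sup>2" "(l - v \<bullet> d)\<^sup>2 < l\<^sup>2" using a by linarith+
    then have "\<bar>v \<bullet> d\<bar> < l" "\<bar>l - v \<bullet> d\<bar> < l"
      using l power2_less_imp_less[of "\<bar>v \<bullet> d\<bar>" l] power2_less_imp_less[of "\<bar>l - v \<bullet> d\<bar>" l]
      by simp_all
    then have "0 < v \<bullet> d" "v \<bullet> d < l" by linarith+
    moreover have "(P (Suc i) - Q i) \<bullet> n = - (v \<bullet> n)" "(P (Suc i) - Q i) \<bullet> d = l - v \<bullet> d"
      unfolding PQ by (simp_all add: inner_diff_left dd on(3))
    ultimately show ?thesis using vn by (simp add: v_def)
  qed
  note pts = this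
  show ?thesis
  proof (rule that)
    show "norm d = 1" "norm n = 1" "d \<bullet> n = 0" by (fact on)+
    show "P i = a + t i *\<^sub>R d" if "i \<le> Suc N" for i using P[OF that] .
  qed (use t pts in auto)
qed

lemma band_length_eq:
  assumes "norm d = 1" "\<And>i. i \<le> Suc N \<Longrightarrow> P i = a + t i *\<^sub>R d" "\<And>i. i \<le> N \<Longrightarrow> t i < t (Suc i)"
  shows "band_length N P = t (Suc N) - t 0"
proof -
  have "dist (P i) (P (Suc i)) = t (Suc i) - t i" if "i \<le> N" for i
  proof -
    have "P (Suc i) - P i = (t (Suc i) - t i) *\<^sub>R d"
      using assms(2)[of i] assms(2)[of "Suc i"] that by (simp add: algebra_simps)
    then show ?thesis using assms(1) assms(3)[OF that] by (simp add: dist_norm norm_minus_commute[of "P i"])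
  qed
  then have "band_length N P = (\<Sum>i = 0..N. t (Suc i) - t i)"
    by (simp add: band_length_def)
  also have "\<dots> = t (Suc N) - t 0" by (rule sum_Suc_diff) simp
  finally show ?thesis .
qed

context mesh
begin

lemma cellwise_edge:
  assumes "cellwise U 0 A" "K \<in> \<T>" "x \<in> K" "y \<in> K"
  shows "A K \<bullet> (x - y) = U x - U y"
proof -
  obtain c where "\<forall>x\<in>K. U x = 0 * (x \<bullet> x) + A K \<bullet> x + c"
    using assms(1,2) by (auto simp: cellwise_def)
  then show ?thesis using assms(3,4) by (simp add: inner_diff_right)
qed

lemma cellwise_error:
  assumes "cellwise U 0 A" shows "cellwise (\<lambda>x. x \<bullet> x - U x) 1 (\<lambda>K. - A K)"
proof -
  have "(x $ 1)\<^sup>2 + (x $ 2)\<^sup>2 = x \<bullet> x" for x :: "real^2"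
    by (simp add: inner_vec_def sum_2 power2_eq_square)
  then show ?thesis
    using cellwise_comb[OF assms cellwise_square_norm, of "- 1"] by simp
qed

lemma band_cells:
  assumes "is_band \<T> N P Q"
  shows "i \<le> N \<Longrightarrow> band_tri P Q i \<in> \<T>" "i \<in> {1..N} \<Longrightarrow> band_tri' P Q i \<in> \<T>"
  using assms unfolding is_band_def band_elements_def by (auto simp: image_subset_iff)

lemma band_cell_vertices:
  "P i \<in> band_tri P Q i" "P (Suc i) \<in> band_tri P Q i" "Q i \<in> band_tri P Q i"
  "Q (i - 1) \<in> band_tri' P Q i" "Q i \<in> band_tri' P Q i" "P i \<in> band_tri' P Q i"
  unfolding band_tri_def band_tri'_def by (simp_all add: hull_inc)

lemma band_polyline:
  assumes "cellwise U 0 A" "is_band \<T> N P Q" "i \<le> N"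
    and P: "\<And>i. i \<le> Suc N \<Longrightarrow> P i = a + t i *\<^sub>R d" and t: "\<And>i. i \<le> N \<Longrightarrow> t i < t (Suc i)"
    and x: "t i \<le> x" "x \<le> t (Suc i)"
  shows "a + x *\<^sub>R d \<in> band_tri P Q i"
    and "U (a + x *\<^sub>R d) = U (a + t i *\<^sub>R d) + A (band_tri P Q i) \<bullet> d * (x - t i)"
proof -
  define u where "u = (x - t i) / (t (Suc i) - t i)"
  have u: "0 \<le> u" "u \<le> 1" using t[OF assms(3)] x by (simp_all add: u_def)
  have xu: "x = (1 - u) * t i + u * t (Suc i)"
  proof -
    have "u * (t (Suc i) - t i) = x - t i" using t[OF assms(3)] by (simp add: u_def)
    then show ?thesis by (simp add: algebra_simps)
  qed
  have "a + x *\<^sub>R d = (1 - u) *\<^sub>R P i + u *\<^sub>R P (Suc i)"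
    using P[of i] P[of "Suc i"] assms(3) unfolding xu by (simp add: algebra_simps)
  moreover have "convex (band_tri P Q i)" by (simp add: band_tri_def)
  ultimately show mem: "a + x *\<^sub>R d \<in> band_tri P Q i"
    using band_cell_vertices(1,2) u by (simp add: convex_alt)
  have "P i = a + t i *\<^sub>R d" using P assms(3) by simp
  then have "a + t i *\<^sub>R d \<in> band_tri P Q i" using band_cell_vertices(1)[of P i Q] by simp
  from cellwise_edge[OF assms(1) band_cells(1)[OF assms(2,3)] mem this]
  show "U (a + x *\<^sub>R d) = U (a + t i *\<^sub>R d) + A (band_tri P Q i) \<bullet> d * (x - t i)"
  proof -
    assume e: "A (band_tri P Q i) \<bullet> (a + x *\<^sub>R d - (a + t i *\<^sub>R d)) = U (a + x *\<^sub>R d) - U (a + t i *\<^sub>R d)"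
    have "a + x *\<^sub>R d - (a + t i *\<^sub>R d) = (x - t i) *\<^sub>R d" by (simp add: scaleR_diff_left)
    then show ?thesis using e by (simp add: mult.commute)
  qed
qed

lemma band_jump:
  assumes U: "cellwise U 0 A" and band: "is_band \<T> N P Q" and i: "i \<in> {1..N}"
    and on: "norm d = 1" "norm n = 1" "d \<bullet> n = 0"
    and Qn: "\<And>i. i \<le> N \<Longrightarrow> (Q i - P i) \<bullet> n > 0" and Qd: "\<And>i. i \<le> N \<Longrightarrow> (Q i - P i) \<bullet> d > 0"
    and Pn: "\<And>i. i \<le> N \<Longrightarrow> (P (Suc i) - Q i) \<bullet> n < 0" and Pd: "\<And>i. i \<le> N \<Longrightarrow> (P (Suc i) - Q i) \<bullet> d > 0"
    and M: "norm (2 *\<^sub>R P i - A (band_tri' P Q i)) \<le> M" "norm (2 *\<^sub>R P i - A (band_tri P Q i)) \<le> M"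
      "norm (2 *\<^sub>R P i - A (band_tri P Q (i - 1))) \<le> M"
  shows "0 < sin (pi - band_angle' P Q i)"
    and "\<bar>A (band_tri P Q i) \<bullet> d - A (band_tri P Q (i - 1)) \<bullet> d\<bar> \<le> 8 * sin (pi - band_angle' P Q i) * M"
proof -
  \<comment> \<open>The gradient of the squared norm at \<open>P i\<close> is subtracted from all
    three gradients: edge identities and jumps do not see a common vector, but now \<open>M\<close>
    bounds errors instead of gradients.\<close>
  let ?e = "\<lambda>K. A K - 2 *\<^sub>R P i"
  have Si: "Suc (i - 1) = i" and le: "i - 1 \<le> N" "i \<le> N" using i by auto
  have cells: "band_tri P Q i \<in> \<T>" "band_tri P Q (i - 1) \<in> \<T>" "band_tri' P Q i \<in> \<T>"
    using band_cells[OF band] i le by auto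
  have max: "max_angle (Q (i - 1)) (Q i) (P i) = angle_at (Q (i - 1)) (P i) (Q i)"
    using band i unfolding is_band_def band_angle'_def by blast
  have "P i \<in> band_tri P Q (i - 1)" using band_cell_vertices(2)[of P "i - 1" Q] Si by simp
  then have edge: "?e (band_tri' P Q i) \<bullet> (P i - Q (i - 1)) = ?e (band_tri P Q (i - 1)) \<bullet> (P i - Q (i - 1))"
      "?e (band_tri' P Q i) \<bullet> (Q i - P i) = ?e (band_tri P Q i) \<bullet> (Q i - P i)"
    using cellwise_edge[OF U] cells band_cell_vertices by (simp_all add: inner_diff_left)
  note J = gradient_jump[OF on _ _ Qd[OF le(2)] Qn[OF le(2)] max edge, of M]
  have pre: "(P i - Q (i - 1)) \<bullet> d > 0" "(P i - Q (i - 1)) \<bullet> n < 0"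
    using Pd[OF le(1)] Pn[OF le(1)] Si by simp_all
  have M': "norm (?e (band_tri' P Q i)) \<le> M" "norm (?e (band_tri P Q (i - 1))) \<le> M" "norm (?e (band_tri P Q i)) \<le> M"
    using M by (simp_all add: norm_minus_commute)
  show "0 < sin (pi - band_angle' P Q i)"
    using J(1)[OF pre M'] by (simp add: band_angle'_def)
  show "\<bar>A (band_tri P Q i) \<bullet> d - A (band_tri P Q (i - 1)) \<bullet> d\<bar> \<le> 8 * sin (pi - band_angle' P Q i) * M"
    using J(2)[OF pre M'] by (simp add: band_angle'_def inner_diff_left)
qed

lemma long_band_jumps:
  assumes U: "cellwise U 0 A" and bd: "\<And>x. x \<in> frontier \<Omega> \<Longrightarrow> \<bar>x \<bullet> x - U x\<bar> \<le> \<epsilon>" "0 \<le> \<epsilon>"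
    and R: "\<And>x. x \<in> closure \<Omega> \<Longrightarrow> norm x < R"
    and E: "0 < E" "(\<Sum>i\<in>UNIV. LINT x|lebesgue_on \<Omega>. (cell_grad 1 (\<lambda>K. - A K) i x)\<^sup>2) \<le> E\<^sup>2"
    and band: "is_band \<T> N P Q" and d: "norm d = 1"
    and P: "\<And>i. i \<le> Suc N \<Longrightarrow> P i = a + t i *\<^sub>R d" and t: "\<And>i. i \<le> N \<Longrightarrow> t i < t (Suc i)"
    and long: "54 * (\<epsilon> * sqrt (2 * R) + (R + 1) * E) < band_length N P powr (5 / 2)"
  shows "band_length N P / 3 < (\<Sum>k=1..N. \<bar>A (band_tri P Q k) \<bullet> d - A (band_tri P Q (k - 1)) \<bullet> d\<bar>)"
proof (rule ccontr)
  assume small: "\<not> ?thesis"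
  define L where "L = band_length N P"
  have L: "L = t (Suc N) - t 0" unfolding L_def by (rule band_length_eq[where N = N and P = P and a = a and t = t, OF d P t])
  have mono: "t 0 < t (Suc k)" if "k \<le> N" for k
    using that by (induction k) (use t in \<open>force intro: less_trans\<close>)+
  have Lpos: "0 < L" using mono[of N] L by simp
  have seg: "a + x *\<^sub>R d \<in> closure \<Omega>" if x: "x \<in> {t 0..t (Suc N)}" for x
  proof -
    obtain i where "i \<le> N" "t i \<le> x" "x \<le> t (Suc i)" using between_consecutive[of t x N] x by auto
    then show ?thesis
      using band_polyline(1)[where a = a and t = t and d = d, OF U band _ P t] band_cells(1)[OF band] cell_subset by blast
  qed
  \<comment> \<open>Bounds the factor sqrt L in front of \<epsilon>, so that the left side of
    \<open>long\<close> does not depend on \<open>L\<close>.\<close>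
  have L2R: "L \<le> 2 * R"
  proof -
    have "L = norm ((a + t (Suc N) *\<^sub>R d) - (a + t 0 *\<^sub>R d))"
      using L Lpos d by (simp add: scaleR_diff_left[symmetric])
    also have "\<dots> \<le> norm (a + t (Suc N) *\<^sub>R d) + norm (a + t 0 *\<^sub>R d)" by (rule norm_triangle_ineq4)
    also have "\<dots> \<le> 2 * R"
      using R[OF seg[of "t (Suc N)"]] R[OF seg[of "t 0"]] mono[of N] by simp
    finally show ?thesis .
  qed
  \<comment> \<open>this weight balances the terms \<open>\<mu> R L\<close> and \<open>E\<^sup>2 / \<mu>\<close> of the trace bound\<close>
  define \<mu> where "\<mu> = E / sqrt L"
  have \<mu>: "0 < \<mu>" using E Lpos by (simp add: \<mu>_def)
  \<comment> \<open>Along the line the squared norm is a parabola with leading coefficient 1,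
    because \<open>d\<close> is a unit vector.\<close>
  have ints: "L ^ 3 / 54 \<le> integral {t 0..t (Suc N)} (\<lambda>x. \<bar>(x\<^sup>2 + 2 * (a \<bullet> d) * x + a \<bullet> a) - U (a + x *\<^sub>R d)\<bar>)"
  proof (rule piecewise_linear_far_from_parabola[where N = N and t = t and \<tau> = "\<lambda>k. A (band_tri P Q k) \<bullet> d", OF t])
    show "U (a + x *\<^sub>R d) = U (a + t i *\<^sub>R d) + A (band_tri P Q i) \<bullet> d * (x - t i)"
      if "i \<le> N" "t i \<le> x" "x \<le> t (Suc i)" for i x
      using band_polyline(2)[where a = a and t = t and d = d, OF U band that(1) P t that(2,3)] .
    show "continuous_on {t 0..t (Suc N)} (\<lambda>x. U (a + x *\<^sub>R d))"
      by (rule continuous_on_compose2[where t = "closure \<Omega>"])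
        (use U seg in \<open>auto simp: cellwise_def intro!: continuous_intros\<close>)
    show "(\<Sum>k=1..N. \<bar>A (band_tri P Q k) \<bullet> d - A (band_tri P Q (k - 1)) \<bullet> d\<bar>) \<le> L / 3"
      using small by (simp add: L_def)
  qed (use L Lpos in auto)
  also have "(\<lambda>x. \<bar>(x\<^sup>2 + 2 * (a \<bullet> d) * x + a \<bullet> a) - U (a + x *\<^sub>R d)\<bar>)
      = (\<lambda>x. \<bar>(a + x *\<^sub>R d) \<bullet> (a + x *\<^sub>R d) - U (a + x *\<^sub>R d)\<bar>)"
  proof -
    have "d \<bullet> d = 1" using d by (simp add: norm_eq_1)
    then show ?thesis
      by (simp add: fun_eq_iff inner_add_left inner_add_right inner_commute power2_eq_square algebra_simps)
  qed
  also have "integral {t 0..t (Suc N)} \<dots> \<le> (\<epsilon> + \<mu> * R) * (t (Suc N) - t 0) + E\<^sup>2 / \<mu>"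
    using seg L Lpos by (intro trace_bound[OF cellwise_error[OF U] bd(1) R \<mu> d _ _ E(2)]) auto
  also have "\<dots> = (\<epsilon> + \<mu> * R) * L + E\<^sup>2 / \<mu>" by (simp add: L)
  finally have main: "L ^ 3 / 54 \<le> (\<epsilon> + \<mu> * R) * L + E\<^sup>2 / \<mu>" .
  \<comment> \<open>Every term on the right carries a factor sqrt L. Cancelling it leaves the power
    5/2 of \<open>L\<close> that appears in \<open>long\<close>.\<close>
  define r where "r = sqrt L"
  have r: "0 < r" "L = r\<^sup>2" using Lpos by (simp_all add: r_def)
  have "(\<epsilon> + \<mu> * R) * L + E\<^sup>2 / \<mu> = (\<epsilon> * r + (R + 1) * E) * r"
    using r E(1) by (simp add: \<mu>_def r_def[symmetric] field_simps power2_eq_square)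
  then have "(r ^ 5 / 54) * r \<le> (\<epsilon> * r + (R + 1) * E) * r"
    using main unfolding r(2) by (simp add: power2_eq_square power3_eq_cube eval_nat_numeral algebra_simps)
  then have "r ^ 5 \<le> 54 * (\<epsilon> * r + (R + 1) * E)" using r(1) by simp
  also have "\<dots> \<le> 54 * (\<epsilon> * sqrt (2 * R) + (R + 1) * E)"
    using L2R bd(2) by (simp add: r_def mult_left_mono)
  also have "\<dots> < L powr (5 / 2)" using long by (simp add: L_def)
  also have "L powr (5 / 2) = r ^ 5"
  proof -
    have "(L powr (1 / 2)) powr 5 = L powr (5 / 2)" by (subst powr_powr) simp
    moreover have "L powr (1 / 2) = r" using Lpos by (simp only: r_def powr_half_sqrt)
    ultimately have "L powr (5 / 2) = r powr 5" by metis
    then show ?thesis using r(1) by simp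
  qed
  finally show False by simp
qed

text \<open>The factor 2: \<open>band_tri P Q i\<close> is a neighbour of
  \<open>band_tri' P Q i\<close> and of \<open>band_tri' P Q (i + 1)\<close>. The injectivity and
  disjointness clauses of \<open>is_band\<close> turn sums over indices into sums over
  elements.\<close>

lemma sum_consecutive_cells_le:
  fixes W :: "(real^2) set \<Rightarrow> real"
  assumes band: "is_band \<T> N P Q" and W: "\<And>K. 0 \<le> W K"
  shows "(\<Sum>i=1..N. W (band_tri' P Q i) + W (band_tri P Q i) + W (band_tri P Q (i - 1)))
    \<le> 2 * (\<Sum>K\<in>band_elements N P Q. W K)"
proof -
  have inj: "inj_on (band_tri P Q) {0..N}" "inj_on (band_tri' P Q) {1..N}"
    "band_tri P Q ` {0..N} \<inter> band_tri' P Q ` {1..N} = {}"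
    using band by (simp_all add: is_band_def)
  have "(\<Sum>K\<in>band_elements N P Q. W K) = (\<Sum>i=0..N. W (band_tri P Q i)) + (\<Sum>i=1..N. W (band_tri' P Q i))"
    unfolding band_elements_def
    by (subst sum.union_disjoint) (use inj in \<open>simp_all add: sum.reindex\<close>)
  moreover have "(\<Sum>i=1..N. W (band_tri P Q i)) \<le> (\<Sum>i=0..N. W (band_tri P Q i))"
    by (intro sum_mono2) (auto simp: W)
  moreover have "(\<Sum>i=1..N. W (band_tri P Q (i - 1))) \<le> (\<Sum>i=0..N. W (band_tri P Q i))"
  proof -
    have "(\<Sum>i=1..N. W (band_tri P Q (i - 1))) = (\<Sum>j\<in>(\<lambda>i. i - 1) ` {1..N}. W (band_tri P Q j))"
      by (subst sum.reindex) (auto intro!: inj_onI)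
    also have "\<dots> \<le> (\<Sum>i=0..N. W (band_tri P Q i))"
      by (intro sum_mono2) (auto simp: W)
    finally show ?thesis .
  qed
  moreover have "0 \<le> (\<Sum>i=1..N. W (band_tri' P Q i))" by (simp add: W sum_nonneg)
  ultimately show ?thesis by (simp add: sum.distrib)
qed

text \<open>1152 = 9 * 64 * 2: the jumps add up to more than L/3, the bound for a single jump
  carries the factor 8, and each element is counted at most twice. In \<open>1 + CK\<close> the 1
  pays for the element between two edges and \<open>CK\<close> for its neighbours.\<close>

lemma band_bound:
  assumes U: "cellwise U 0 A" and bd: "\<And>x. x \<in> frontier \<Omega> \<Longrightarrow> \<bar>x \<bullet> x - U x\<bar> \<le> \<epsilon>" "0 \<le> \<epsilon>"
    and R: "\<And>x. x \<in> closure \<Omega> \<Longrightarrow> norm x < R"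
    and E: "0 < E" "(\<Sum>i\<in>UNIV. LINT x|lebesgue_on \<Omega>. (cell_grad 1 (\<lambda>K. - A K) i x)\<^sup>2) \<le> E\<^sup>2"
    and band: "is_band \<T> N P Q"
    and long: "54 * (\<epsilon> * sqrt (2 * R) + (R + 1) * E) < band_length N P powr (5 / 2)"
    and CK: "0 < CK" "\<And>i. i \<in> {1..N} \<Longrightarrow>
        measure lebesgue (band_tri' P Q i) \<le> CK * measure lebesgue (band_tri P Q i) \<and>
        measure lebesgue (band_tri' P Q i) \<le> CK * measure lebesgue (band_tri P Q (i - 1))"
    and w: "\<And>K. 0 \<le> w K"
      "\<And>K z. K \<in> \<T> \<Longrightarrow> z \<in> K \<Longrightarrow> (norm (2 *\<^sub>R z - A K))\<^sup>2 \<le> w K"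
  shows "Min ((\<lambda>i. 1 / (sin (pi - band_angle' P Q i))\<^sup>2) ` {1..N}) *
      Min ((\<lambda>i. measure lebesgue (band_tri' P Q i)) ` {1..N}) * (band_length N P)\<^sup>2 / real N
    \<le> 1152 * (1 + CK) * (\<Sum>K\<in>band_elements N P Q. measure lebesgue K * w K)"
proof -
  obtain a d n t where on: "norm d = 1" "norm n = 1" "d \<bullet> n = 0"
    and P: "\<And>i. i \<le> Suc N \<Longrightarrow> P i = a + t i *\<^sub>R d" and t: "\<And>i. i \<le> N \<Longrightarrow> t i < t (Suc i)"
    and pts: "\<And>i. i \<le> N \<Longrightarrow> (Q i - P i) \<bullet> n > 0" "\<And>i. i \<le> N \<Longrightarrow> (Q i - P i) \<bullet> d > 0"
      "\<And>i. i \<le> N \<Longrightarrow> (P (Suc i) - Q i) \<bullet> n < 0" "\<And>i. i \<le> N \<Longrightarrow> (P (Suc i) - Q i) \<bullet> d > 0"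
    by (rule band_pointsE[OF band]) (rule that)
  have N: "1 \<le> N" using band by (simp add: is_band_def)
  define L where "L = band_length N P"
  define s where "s i = sin (pi - band_angle' P Q i)" for i
  define J where "J i = \<bar>A (band_tri P Q i) \<bullet> d - A (band_tri P Q (i - 1)) \<bullet> d\<bar>" for i
  define \<kappa> where "\<kappa> i = measure lebesgue (band_tri' P Q i)" for i
  define W where "W K = measure lebesgue K * w K" for K
  define m1 m2 where "m1 = Min ((\<lambda>i. 1 / (s i)\<^sup>2) ` {1..N})" and "m2 = Min (\<kappa> ` {1..N})"
  have m1: "0 \<le> m1" "\<And>i. i \<in> {1..N} \<Longrightarrow> m1 \<le> 1 / (s i)\<^sup>2"
    unfolding m1_def using N by (auto simp: Min_ge_iff)
  have m2: "0 \<le> m2" "\<And>i. i \<in> {1..N} \<Longrightarrow> m2 \<le> \<kappa> i"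
    unfolding m2_def using N by (auto simp: Min_ge_iff \<kappa>_def)
  \<comment> \<open>The sine cancels: the bound on the squared jump contains
    \<open>(s i)\<^sup>2\<close>, and \<open>m1\<close> is at most its reciprocal.\<close>
  have cell_term: "m1 * m2 * (J i)\<^sup>2 \<le> 64 * (1 + CK) * (W (band_tri' P Q i) + W (band_tri P Q i) + W (band_tri P Q (i - 1)))"
    if i: "i \<in> {1..N}" for i
  proof -
    \<comment> \<open>\<open>sqrt S\<close> dominates the gradient errors at \<open>P i\<close> on
      all three elements and serves as \<open>M\<close> in \<open>band_jump\<close>.\<close>
    define S where "S = w (band_tri' P Q i) + w (band_tri P Q i) + w (band_tri P Q (i - 1))"
    have Pi: "P i \<in> band_tri P Q (i - 1)"
      using band_cell_vertices(2)[of P "i - 1" Q] i by simp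
    have bound: "norm (2 *\<^sub>R P i - A K) \<le> sqrt S" if "K \<in> \<T>" "P i \<in> K" "w K \<le> S" for K
      using w(2)[OF that(1,2)] that(3) by (intro real_le_rsqrt) linarith
    have wS: "w (band_tri' P Q i) \<le> S" "w (band_tri P Q i) \<le> S" "w (band_tri P Q (i - 1)) \<le> S"
      using w(1) by (simp_all add: S_def add_nonneg_nonneg add_increasing)
    have cells: "band_tri' P Q i \<in> \<T>" "band_tri P Q i \<in> \<T>" "band_tri P Q (i - 1) \<in> \<T>"
      using band_cells[OF band] i by auto
    note jump = band_jump[OF U band i on pts bound[OF cells(1) _ wS(1)] bound[OF cells(2) _ wS(2)]
        bound[OF cells(3) Pi wS(3)]]
    have spos: "0 < s i" and Js: "J i \<le> 8 * s i * sqrt S"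
      unfolding s_def J_def using jump band_cell_vertices(1,6) by blast+
    have S0: "0 \<le> S" using w(1) by (simp add: S_def)
    have "(J i)\<^sup>2 \<le> (8 * s i * sqrt S)\<^sup>2" using Js by (intro power_mono) (auto simp: J_def)
    also have "\<dots> = 64 * (s i)\<^sup>2 * S" using S0 by (simp add: power_mult_distrib)
    finally have J2: "(J i)\<^sup>2 \<le> 64 * (s i)\<^sup>2 * S" .
    have "m1 * m2 * (J i)\<^sup>2 \<le> (1 / (s i)\<^sup>2 * \<kappa> i) * (64 * (s i)\<^sup>2 * S)"
      using m1 m2 i J2 by (intro mult_mono) (auto simp: \<kappa>_def)
    also have "\<dots> = 64 * (\<kappa> i * S)" using spos by simp
    also have "\<kappa> i * S \<le> (1 + CK) * (W (band_tri' P Q i) + W (band_tri P Q i) + W (band_tri P Q (i - 1)))"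
    proof -
      have "\<kappa> i * w (band_tri' P Q i) \<le> (1 + CK) * W (band_tri' P Q i)"
        unfolding W_def \<kappa>_def using CK(1) w(1) by (simp add: algebra_simps)
      moreover have "\<kappa> i * w (band_tri P Q j) \<le> (1 + CK) * W (band_tri P Q j)" if "j = i \<or> j = i - 1" for j
      proof -
        have "\<kappa> i \<le> (1 + CK) * measure lebesgue (band_tri P Q j)"
          using CK(2)[OF i] that measure_nonneg[of lebesgue "band_tri P Q j"]
          by (auto simp: \<kappa>_def distrib_right intro: order.trans)
        from mult_right_mono[OF this w(1)[of "band_tri P Q j"]] show ?thesis
          by (simp add: W_def mult.assoc)
      qed
      ultimately show ?thesis by (simp add: S_def distrib_left add_mono)
    qed
    finally show ?thesis by (simp only: mult.assoc)
  qed
  have "L / 3 < (\<Sum>i=1..N. J i)"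
    unfolding L_def J_def by (rule long_band_jumps[where a = a and t = t, OF U bd R E band on(1) P t long])
  moreover have "0 \<le> L" by (simp add: L_def band_length_def sum_nonneg)
  ultimately have "(L / 3)\<^sup>2 \<le> (\<Sum>i=1..N. J i)\<^sup>2" by (intro power_mono) auto
  \<comment> \<open>Cauchy-Schwarz over the \<open>N\<close> jumps is the origin of the factor 1/N
    in the claim.\<close>
  also have "\<dots> \<le> (\<Sum>i=1..N. (J i)\<^sup>2) * real N"
    using sum_squared_le_sum_of_squares[of J "{1..N}"] by simp
  finally have "L\<^sup>2 / real N \<le> 9 * (\<Sum>i=1..N. (J i)\<^sup>2)"
    using N by (simp add: field_simps)
  then have "m1 * m2 * (L\<^sup>2 / real N) \<le> m1 * m2 * (9 * (\<Sum>i=1..N. (J i)\<^sup>2))"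
    using m1(1) m2(1) by (intro mult_left_mono) auto
  also have "\<dots> = 9 * (\<Sum>i=1..N. m1 * m2 * (J i)\<^sup>2)" by (simp add: sum_distrib_left mult_ac)
  also have "\<dots> \<le> 9 * (\<Sum>i=1..N. 64 * (1 + CK) * (W (band_tri' P Q i) + W (band_tri P Q i) + W (band_tri P Q (i - 1))))"
    using cell_term by (intro mult_left_mono sum_mono) auto
  also have "\<dots> = 576 * (1 + CK) * (\<Sum>i=1..N. W (band_tri' P Q i) + W (band_tri P Q i) + W (band_tri P Q (i - 1)))"
    unfolding sum_distrib_left[symmetric] by simp
  also have "\<dots> \<le> 576 * (1 + CK) * (2 * (\<Sum>K\<in>band_elements N P Q. W K))"
    using CK(1) w(1) by (intro mult_left_mono sum_consecutive_cells_le[OF band]) (auto simp: W_def)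
  also have "\<dots> = 1152 * (1 + CK) * (\<Sum>K\<in>band_elements N P Q. W K)" by (simp add: algebra_simps)
  finally show ?thesis
    by (simp only: m1_def m2_def s_def \<kappa>_def[abs_def] L_def W_def times_divide_eq_right)
qed

end

section \<open>All bands together and the choice of the constants\<close>

lemma polygonal_negligible_frontier:
  assumes "polygonal_domain \<Omega>" shows "negligible (frontier \<Omega>)"
proof -
  obtain S where S: "finite S" "frontier \<Omega> = (\<Union>(a, b)\<in>S. closed_segment a b)"
    using assms by (auto simp: polygonal_domain_def)
  have "negligible (closed_segment a b)" for a b :: "real^2"
    using negligible_convex_interior[of "closed_segment a b"] interior_closed_segment_ge2[of a b] by simp
  then have "negligible (\<Union>((\<lambda>(a, b). closed_segment a b) ` S))"
    using S(1) by (intro negligible_Union) auto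
  then show ?thesis using S(2) by simp
qed

lemma mesh_of_polygonal_domain:
  "polygonal_domain \<Omega> \<Longrightarrow> conforming_triangulation \<Omega> \<T> \<Longrightarrow> mesh \<Omega> \<T>"
  by (simp add: mesh_def polygonal_negligible_frontier) (simp add: polygonal_domain_def)

context mesh
begin

lemma H1_seminorm_cellwise:
  assumes "cellwise f \<sigma> A"
  shows "(H1_seminorm \<Omega> f)\<^sup>2 = (\<Sum>i\<in>UNIV. LINT x|lebesgue_on \<Omega>. (cell_grad \<sigma> A i x)\<^sup>2)"
proof -
  have "(H1_seminorm \<Omega> f)\<^sup>2 = grad_product \<Omega> f f"
    unfolding H1_seminorm_def grad_product_def power2_eq_square[symmetric]
    by (rule real_sqrt_pow2) (simp add: sum_nonneg)
  then show ?thesis by (simp add: grad_product_cellwise[OF assms assms] power2_eq_square)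
qed

text \<open>Disjointness lets one sum over all cells dominate the sum over the bands, so the
  constant does not depend on their number. \<open>E\<close> stands beside \<open>e\<close> because
  the weight \<open>E / sqrt L\<close> of the trace estimate has to be positive, while
  \<open>e\<close> may be 0.\<close>

lemma bands_bound:
  fixes NB :: nat
  assumes err: "\<And>U. discrete_solution \<Omega> \<T> (\<lambda>x. (x $ 1)\<^sup>2 + (x $ 2)\<^sup>2) U \<Longrightarrow>
      H1_seminorm \<Omega> (\<lambda>x. ((x $ 1)\<^sup>2 + (x $ 2)\<^sup>2) - U x) \<le> e"
    and R: "\<And>x. x \<in> closure \<Omega> \<Longrightarrow> norm x < R"
    and E: "e \<le> E" "0 < E"
    and band: "\<And>b. b \<in> {1..NB} \<Longrightarrow> is_band \<T> (N b) (P b) (Q b)"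
    and disj: "\<And>b b'. b \<in> {1..NB} \<Longrightarrow> b' \<in> {1..NB} \<Longrightarrow> b \<noteq> b' \<Longrightarrow>
        band_elements (N b) (P b) (Q b) \<inter> band_elements (N b') (P b') (Q b') = {}"
    and long: "\<And>b. b \<in> {1..NB} \<Longrightarrow>
        54 * ((mesh_size \<T>)\<^sup>2 * sqrt (2 * R) + (R + 1) * E) < band_length (N b) (P b) powr (5 / 2)"
    and CK: "0 < CK" "\<And>b i. b \<in> {1..NB} \<Longrightarrow> i \<in> {1..N b} \<Longrightarrow>
        measure lebesgue (band_tri' (P b) (Q b) i) \<le> CK * measure lebesgue (band_tri (P b) (Q b) i) \<and>
        measure lebesgue (band_tri' (P b) (Q b) i) \<le> CK * measure lebesgue (band_tri (P b) (Q b) (i - 1))"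
  shows "(\<Sum>b=1..NB. Min ((\<lambda>i. 1 / (sin (pi - band_angle' (P b) (Q b) i))\<^sup>2) ` {1..N b}) *
      Min ((\<lambda>i. measure lebesgue (band_tri' (P b) (Q b) i)) ` {1..N b}) * (band_length (N b) (P b))\<^sup>2 / real (N b))
    \<le> 1152 * (1 + CK) * (2 * E\<^sup>2 + 8 * (mesh_size \<T>)\<^sup>2 * measure lebesgue \<Omega>)"
proof -
  obtain U A where sol: "discrete_solution \<Omega> \<T> (\<lambda>x. (x $ 1)\<^sup>2 + (x $ 2)\<^sup>2) U" and U: "cellwise U 0 A"
    and bd: "\<And>x. x \<in> frontier \<Omega> \<Longrightarrow> \<bar>x \<bullet> x - U x\<bar> \<le> (mesh_size \<T>)\<^sup>2"
    by (rule discrete_solution_exists) (rule that)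
  have ux: "(x $ 1)\<^sup>2 + (x $ 2)\<^sup>2 = x \<bullet> x" for x :: "real^2"
    by (simp add: inner_vec_def sum_2 power2_eq_square)
  have "H1_seminorm \<Omega> (\<lambda>x. x \<bullet> x - U x) \<le> E"
    using err[OF sol] E(1) by (simp add: ux)
  moreover have "0 \<le> H1_seminorm \<Omega> (\<lambda>x. x \<bullet> x - U x)"
    by (simp add: H1_seminorm_def sum_nonneg)
  ultimately have "(H1_seminorm \<Omega> (\<lambda>x. x \<bullet> x - U x))\<^sup>2 \<le> E\<^sup>2" by (intro power_mono)
  then have D: "(\<Sum>i\<in>UNIV. LINT x|lebesgue_on \<Omega>. (cell_grad 1 (\<lambda>K. - A K) i x)\<^sup>2) \<le> E\<^sup>2"
    by (simp add: H1_seminorm_cellwise[OF cellwise_error[OF U]])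
  obtain m where m: "\<And>K. 0 \<le> m K"
    "\<And>K z. K \<in> \<T> \<Longrightarrow> z \<in> K \<Longrightarrow> (norm (2 *\<^sub>R z + - A K))\<^sup>2 \<le> 2 * m K + 8 * (mesh_size \<T>)\<^sup>2"
    "(\<Sum>K\<in>\<T>. measure lebesgue K * m K) \<le> (\<Sum>i\<in>UNIV. LINT x|lebesgue_on \<Omega>. (cell_grad 1 (\<lambda>K. - A K) i x)\<^sup>2)"
    by (rule cell_weights[of "\<lambda>K. - A K"]) (rule that)
  define w where "w K = 2 * m K + 8 * (mesh_size \<T>)\<^sup>2" for K
  have w0: "0 \<le> w K" for K using m(1) by (simp add: w_def)
  define W where "W K = measure lebesgue K * w K" for K
  have W0: "0 \<le> W K" for K using w0 by (simp add: W_def)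
  have sub: "band_elements (N b) (P b) (Q b) \<subseteq> \<T>" if "b \<in> {1..NB}" for b
    using band[OF that] by (simp add: is_band_def)
  let ?t = "\<lambda>b. Min ((\<lambda>i. 1 / (sin (pi - band_angle' (P b) (Q b) i))\<^sup>2) ` {1..N b}) *
      Min ((\<lambda>i. measure lebesgue (band_tri' (P b) (Q b) i)) ` {1..N b}) * (band_length (N b) (P b))\<^sup>2 / real (N b)"
  have "(\<Sum>b=1..NB. ?t b) \<le> (\<Sum>b=1..NB. 1152 * (1 + CK) * (\<Sum>K\<in>band_elements (N b) (P b) (Q b). W K))"
  proof (rule sum_mono)
    fix b assume b: "b \<in> {1..NB}"
    show "?t b \<le> 1152 * (1 + CK) * (\<Sum>K\<in>band_elements (N b) (P b) (Q b). W K)"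
      unfolding W_def
      by (rule band_bound[OF U bd _ R E(2) D band[OF b] long[OF b] CK(1) CK(2)[OF b] w0])
        (use m(2) in \<open>auto simp: w_def\<close>)
  qed
  also have "\<dots> = 1152 * (1 + CK) * (\<Sum>b=1..NB. \<Sum>K\<in>band_elements (N b) (P b) (Q b). W K)"
    by (rule sum_distrib_left[symmetric])
  also have "(\<Sum>b=1..NB. \<Sum>K\<in>band_elements (N b) (P b) (Q b). W K)
      = (\<Sum>K\<in>(\<Union>b\<in>{1..NB}. band_elements (N b) (P b) (Q b)). W K)"
  proof (rule sum.UNION_disjoint[symmetric])
    show "\<forall>b\<in>{1..NB}. finite (band_elements (N b) (P b) (Q b))"
      using finite_subset[OF sub finite_mesh] by blast
    show "\<forall>b\<in>{1..NB}. \<forall>b'\<in>{1..NB}. b \<noteq> b' \<longrightarrow>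
        band_elements (N b) (P b) (Q b) \<inter> band_elements (N b') (P b') (Q b') = {}"
      using disj by blast
  qed simp
  also have "\<dots> \<le> (\<Sum>K\<in>\<T>. W K)"
    by (rule sum_mono2[OF finite_mesh UN_least]) (use sub W0 in auto)
  also have "\<dots> = 2 * (\<Sum>K\<in>\<T>. measure lebesgue K * m K) + 8 * (mesh_size \<T>)\<^sup>2 * (\<Sum>K\<in>\<T>. measure lebesgue K)"
  proof -
    have "W K = 2 * (measure lebesgue K * m K) + 8 * (mesh_size \<T>)\<^sup>2 * measure lebesgue K" for K
      by (simp add: W_def w_def algebra_simps)
    then show ?thesis by (simp only: sum.distrib sum_distrib_left[symmetric])
  qed
  also have "\<dots> \<le> 2 * E\<^sup>2 + 8 * (mesh_size \<T>)\<^sup>2 * measure lebesgue \<Omega>"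
    using m(3) D total_area_le by (intro add_mono mult_left_mono) auto
  finally show ?thesis using CK(1) by simp
qed

end

text \<open>\<open>Cq\<close> is fixed before \<open>C0\<close>, so the threshold depends on
  \<Omega>, \<open>h0\<close>, \<alpha> and the error constant of the squared norm, but neither on
  the meshes nor on the error constants of other functions.\<close>

theorem corollary13:
  fixes \<Omega> :: "(real^2) set" and h0 \<alpha> Cq :: real
  assumes "polygonal_domain \<Omega>" and "lipschitz_boundary \<Omega>"
    and "h0 > 0" and "0 \<le> \<alpha>" and "\<alpha> \<le> 1"
  shows "\<exists>C0>0. \<forall>(\<T> :: real \<Rightarrow> (real^2) set set) (Cerr :: (real^2 \<Rightarrow> real) \<Rightarrow> real).
    (\<forall>h\<in>{0<..<h0}. conforming_triangulation \<Omega> (\<T> h) \<and> mesh_size (\<T> h) = h) \<longrightarrow>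
    (\<forall>u\<in>H2 \<Omega>. \<forall>h\<in>{0<..<h0}. \<forall>U. discrete_solution \<Omega> (\<T> h) u U \<longrightarrow>
        H1_seminorm \<Omega> (\<lambda>x. u x - U x) \<le> Cerr u * h powr \<alpha>) \<longrightarrow>
    Cerr (\<lambda>x. (x $ 1)\<^sup>2 + (x $ 2)\<^sup>2) = Cq \<longrightarrow>
    (\<forall>CK>0. \<forall>C\<alpha>>0. \<forall>CL>C0. \<exists>C>0. \<forall>h\<in>{0<..<h0}.
      \<forall>(NB :: nat) (N :: nat \<Rightarrow> nat) (P :: nat \<Rightarrow> nat \<Rightarrow> real^2) (Q :: nat \<Rightarrow> nat \<Rightarrow> real^2).
        (\<forall>b\<in>{1..NB}. is_band (\<T> h) (N b) (P b) (Q b)) \<longrightarrow>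
        (\<forall>b\<in>{1..NB}. \<forall>b'\<in>{1..NB}. b \<noteq> b' \<longrightarrow>
            band_elements (N b) (P b) (Q b) \<inter> band_elements (N b') (P b') (Q b') = {}) \<longrightarrow>
        (\<forall>b\<in>{1..NB}. band_length (N b) (P b) \<ge> CL * h powr (2 * \<alpha> / 5)) \<longrightarrow>
        (\<forall>b\<in>{1..NB}. \<forall>i\<in>{1..N b}.
            measure lebesgue (band_tri' (P b) (Q b) i)
              \<le> CK * measure lebesgue (band_tri (P b) (Q b) i) \<and>
            measure lebesgue (band_tri' (P b) (Q b) i)
              \<le> CK * measure lebesgue (band_tri (P b) (Q b) (i - 1)) \<and>
            sin (pi - band_angle (P b) (Q b) (i - 1))
              \<le> C\<alpha> * sin (pi - band_angle' (P b) (Q b) i)) \<longrightarrow>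
        sqrt (\<Sum>b=1..NB.
            Min ((\<lambda>i. 1 / (sin (pi - band_angle' (P b) (Q b) i))\<^sup>2) ` {1..N b}) *
            Min ((\<lambda>i. measure lebesgue (band_tri' (P b) (Q b) i)) ` {1..N b}) *
            (band_length (N b) (P b))\<^sup>2 / real (N b))
          \<le> C * h powr \<alpha>)"
proof -
  have bdd: "bounded \<Omega>" using assms(1) by (simp add: polygonal_domain_def)
  obtain R where R: "0 < R" "\<And>x. x \<in> closure \<Omega> \<Longrightarrow> norm x < R"
  proof -
    obtain B where "\<forall>x\<in>closure \<Omega>. norm x \<le> B"
      using bounded_closure[OF bdd] by (auto simp: bounded_iff)
    then show ?thesis by (intro that[of "\<bar>B\<bar> + 1"]) (auto intro: le_less_trans)
  qed
  \<comment> \<open>Makes \<open>h\<^sup>2 \<le> c * h powr \<alpha>\<close> for all positive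
    \<open>h\<close> below \<open>h0\<close>.\<close>
  define c where "c = h0 powr (2 - \<alpha>)"
  \<comment> \<open>54 times the bracket, multiplied by \<open>h powr \<alpha>\<close>, dominates
    the length threshold of \<open>bands_bound\<close>; the leading 1 ensures \<open>CL > 1\<close>,
    so that \<open>CL \<le> CL powr (5 / 2)\<close>.\<close>
  define C0 where "C0 = 1 + 54 * (c * sqrt (2 * R) + (R + 1) * (\<bar>Cq\<bar> + 1))"
  have c: "0 < c" using assms(3) by (simp add: c_def)
  have "0 < c * sqrt (2 * R) + (R + 1) * (\<bar>Cq\<bar> + 1)"
  proof (rule add_pos_pos)
    show "0 < c * sqrt (2 * R)" using c R(1) by simp
    show "0 < (R + 1) * (\<bar>Cq\<bar> + 1)" by (rule mult_pos_pos) (use R(1) in linarith)+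
  qed
  then have C0: "1 < C0" by (simp add: C0_def)
  have h2: "h\<^sup>2 \<le> c * h powr \<alpha>" if "0 < h" "h < h0" for h
  proof -
    have "h\<^sup>2 = h powr (2 - \<alpha>) * h powr \<alpha>" using that by (simp add: powr_add[symmetric])
    also have "\<dots> \<le> c * h powr \<alpha>"
      unfolding c_def using that assms(5) by (intro mult_right_mono powr_mono2) auto
    finally show ?thesis .
  qed
  \<comment> \<open>The bound of \<open>bands_bound\<close> with
    \<open>(h powr \<alpha>)\<^sup>2\<close> taken out, using \<open>h\<^sup>2 \<le> h0 powr (2 - 2
    * \<alpha>) * (h powr \<alpha>)\<^sup>2\<close>; the exponent is nonnegative because \<alpha>
    \<le> 1.\<close>
  define Z where "Z CK = 1152 * (1 + CK) * (2 * (\<bar>Cq\<bar> + 1)\<^sup>2 + 8 * h0 powr (2 - 2 * \<alpha>) * measure lebesgue \<Omega>)" for CK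
  show ?thesis
  proof (rule exI[of _ C0], intro conjI allI impI)
    show "0 < C0" using C0 by simp
    fix \<T> :: "real \<Rightarrow> (real^2) set set" and Cerr :: "(real^2 \<Rightarrow> real) \<Rightarrow> real" and CK C\<alpha> CL :: real
    assume tri: "\<forall>h\<in>{0<..<h0}. conforming_triangulation \<Omega> (\<T> h) \<and> mesh_size (\<T> h) = h"
      and err: "\<forall>u\<in>H2 \<Omega>. \<forall>h\<in>{0<..<h0}. \<forall>U. discrete_solution \<Omega> (\<T> h) u U \<longrightarrow>
        H1_seminorm \<Omega> (\<lambda>x. u x - U x) \<le> Cerr u * h powr \<alpha>"
      and Cq: "Cerr (\<lambda>x. (x $ 1)\<^sup>2 + (x $ 2)\<^sup>2) = Cq"
      and CK: "0 < CK" and "0 < C\<alpha>" and CL: "C0 < CL"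
    have Zpos: "0 \<le> Z CK" unfolding Z_def using CK by (intro mult_nonneg_nonneg add_nonneg_nonneg) auto
    show "\<exists>C>0. \<forall>h\<in>{0<..<h0}.
      \<forall>(NB :: nat) (N :: nat \<Rightarrow> nat) (P :: nat \<Rightarrow> nat \<Rightarrow> real^2) (Q :: nat \<Rightarrow> nat \<Rightarrow> real^2).
        (\<forall>b\<in>{1..NB}. is_band (\<T> h) (N b) (P b) (Q b)) \<longrightarrow>
        (\<forall>b\<in>{1..NB}. \<forall>b'\<in>{1..NB}. b \<noteq> b' \<longrightarrow>
            band_elements (N b) (P b) (Q b) \<inter> band_elements (N b') (P b') (Q b') = {}) \<longrightarrow>
        (\<forall>b\<in>{1..NB}. band_length (N b) (P b) \<ge> CL * h powr (2 * \<alpha> / 5)) \<longrightarrow>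
        (\<forall>b\<in>{1..NB}. \<forall>i\<in>{1..N b}.
            measure lebesgue (band_tri' (P b) (Q b) i)
              \<le> CK * measure lebesgue (band_tri (P b) (Q b) i) \<and>
            measure lebesgue (band_tri' (P b) (Q b) i)
              \<le> CK * measure lebesgue (band_tri (P b) (Q b) (i - 1)) \<and>
            sin (pi - band_angle (P b) (Q b) (i - 1))
              \<le> C\<alpha> * sin (pi - band_angle' (P b) (Q b) i)) \<longrightarrow>
        sqrt (\<Sum>b=1..NB.
            Min ((\<lambda>i. 1 / (sin (pi - band_angle' (P b) (Q b) i))\<^sup>2) ` {1..N b}) *
            Min ((\<lambda>i. measure lebesgue (band_tri' (P b) (Q b) i)) ` {1..N b}) *
            (band_length (N b) (P b))\<^sup>2 / real (N b))
          \<le> C * h powr \<alpha>"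
    \<comment> \<open>The summand 1 gives a positive constant from \<open>0 \<le> Z CK\<close>
      alone.\<close>
    proof (rule exI[of _ "sqrt (Z CK) + 1"], intro conjI allI impI ballI)
      show "0 < sqrt (Z CK) + 1" using Zpos by (simp add: add_nonneg_pos)
      fix h NB and N :: "nat \<Rightarrow> nat" and P Q :: "nat \<Rightarrow> nat \<Rightarrow> real^2"
      assume h': "h \<in> {0<..<h0}"
        and band: "\<forall>b\<in>{1..NB}. is_band (\<T> h) (N b) (P b) (Q b)"
        and disj: "\<forall>b\<in>{1..NB}. \<forall>b'\<in>{1..NB}. b \<noteq> b' \<longrightarrow>
            band_elements (N b) (P b) (Q b) \<inter> band_elements (N b') (P b') (Q b') = {}"
        and long: "\<forall>b\<in>{1..NB}. band_length (N b) (P b) \<ge> CL * h powr (2 * \<alpha> / 5)"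
        and comp: "\<forall>b\<in>{1..NB}. \<forall>i\<in>{1..N b}.
            measure lebesgue (band_tri' (P b) (Q b) i)
              \<le> CK * measure lebesgue (band_tri (P b) (Q b) i) \<and>
            measure lebesgue (band_tri' (P b) (Q b) i)
              \<le> CK * measure lebesgue (band_tri (P b) (Q b) (i - 1)) \<and>
            sin (pi - band_angle (P b) (Q b) (i - 1))
              \<le> C\<alpha> * sin (pi - band_angle' (P b) (Q b) i)"
      have h: "0 < h" "h < h0" using h' by auto
      have ms: "mesh_size (\<T> h) = h" using tri h' by blast
      interpret mesh \<Omega> "\<T> h"
        using mesh_of_polygonal_domain[OF assms(1)] tri h' by blast
      \<comment> \<open>The summand 1 keeps \<open>E\<close> positive even if \<open>Cq\<close> is
        0.\<close>
      define E where "E = (\<bar>Cq\<bar> + 1) * h powr \<alpha>"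
      have E: "0 < E" using h by (simp add: E_def)
      let ?S = "\<Sum>b=1..NB.
            Min ((\<lambda>i. 1 / (sin (pi - band_angle' (P b) (Q b) i))\<^sup>2) ` {1..N b}) *
            Min ((\<lambda>i. measure lebesgue (band_tri' (P b) (Q b) i)) ` {1..N b}) *
            (band_length (N b) (P b))\<^sup>2 / real (N b)"
      have "?S \<le> 1152 * (1 + CK) * (2 * E\<^sup>2 + 8 * (mesh_size (\<T> h))\<^sup>2 * measure lebesgue \<Omega>)"
      proof (rule bands_bound[where R = R and e = "Cq * h powr \<alpha>"])
        show "H1_seminorm \<Omega> (\<lambda>x. ((x $ 1)\<^sup>2 + (x $ 2)\<^sup>2) - U x) \<le> Cq * h powr \<alpha>"
          if "discrete_solution \<Omega> (\<T> h) (\<lambda>x. (x $ 1)\<^sup>2 + (x $ 2)\<^sup>2) U" for U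
          using err square_norm_H2 h' that Cq by fastforce
        show "Cq * h powr \<alpha> \<le> E" unfolding E_def by (intro mult_right_mono) auto
        show "54 * ((mesh_size (\<T> h))\<^sup>2 * sqrt (2 * R) + (R + 1) * E) < band_length (N b) (P b) powr (5 / 2)"
          if b: "b \<in> {1..NB}" for b
        proof -
          have "54 * ((mesh_size (\<T> h))\<^sup>2 * sqrt (2 * R) + (R + 1) * E)
              \<le> 54 * ((c * h powr \<alpha>) * sqrt (2 * R) + (R + 1) * E)"
            unfolding ms using h2[OF h] R(1) by (intro mult_left_mono add_right_mono mult_right_mono) auto
          also have "\<dots> = (C0 - 1) * h powr \<alpha>" by (simp add: C0_def E_def algebra_simps)
          also have "\<dots> < CL * h powr \<alpha>" using CL h by (intro mult_strict_right_mono) auto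
          also have "\<dots> \<le> CL powr (5 / 2) * h powr \<alpha>"
            using CL C0 powr_mono[of 1 "5 / 2" CL] by (intro mult_right_mono) auto
          also have "\<dots> = (CL * h powr (2 * \<alpha> / 5)) powr (5 / 2)"
            using CL C0 by (simp add: powr_mult powr_powr)
          also have "\<dots> \<le> band_length (N b) (P b) powr (5 / 2)"
            using long b CL C0 by (intro powr_mono2) auto
          finally show ?thesis .
        qed
      qed (use R E CK band disj comp in auto)
      also have "\<dots> \<le> Z CK * (h powr \<alpha>)\<^sup>2"
      proof -
        have "h\<^sup>2 \<le> h0 powr (2 - 2 * \<alpha>) * (h powr \<alpha>)\<^sup>2"
        proof -
          have "(h powr \<alpha>)\<^sup>2 = h powr (2 * \<alpha>)" by (simp add: power2_eq_square powr_add[symmetric])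
          then have "h\<^sup>2 = h powr (2 - 2 * \<alpha>) * (h powr \<alpha>)\<^sup>2" using h by (simp add: powr_add[symmetric])
          also have "\<dots> \<le> h0 powr (2 - 2 * \<alpha>) * (h powr \<alpha>)\<^sup>2"
            using h assms(5) by (intro mult_right_mono powr_mono2) auto
          finally show ?thesis .
        qed
        then have le8: "8 * h\<^sup>2 * measure lebesgue \<Omega> \<le> 8 * (h0 powr (2 - 2 * \<alpha>) * (h powr \<alpha>)\<^sup>2) * measure lebesgue \<Omega>"
          by (intro mult_right_mono mult_left_mono) auto
        have "2 * E\<^sup>2 + 8 * h\<^sup>2 * measure lebesgue \<Omega>
            \<le> (2 * (\<bar>Cq\<bar> + 1)\<^sup>2 + 8 * h0 powr (2 - 2 * \<alpha>) * measure lebesgue \<Omega>) * (h powr \<alpha>)\<^sup>2"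
        proof -
          have E2: "2 * E\<^sup>2 = 2 * (\<bar>Cq\<bar> + 1)\<^sup>2 * (h powr \<alpha>)\<^sup>2"
            by (simp only: E_def power_mult_distrib mult.assoc)
          have "2 * E\<^sup>2 + 8 * h\<^sup>2 * measure lebesgue \<Omega> \<le> 2 * (\<bar>Cq\<bar> + 1)\<^sup>2 * (h powr \<alpha>)\<^sup>2
              + 8 * (h0 powr (2 - 2 * \<alpha>) * (h powr \<alpha>)\<^sup>2) * measure lebesgue \<Omega>"
            using le8 E2 by linarith
          also have "\<dots> = (2 * (\<bar>Cq\<bar> + 1)\<^sup>2 + 8 * h0 powr (2 - 2 * \<alpha>) * measure lebesgue \<Omega>) * (h powr \<alpha>)\<^sup>2"
            by (subst distrib_right) (simp only: mult_ac)
          finally show ?thesis .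
        qed
        from mult_left_mono[OF this, of "1152 * (1 + CK)"] CK show ?thesis
          unfolding ms Z_def mult.assoc[of "1152 * (1 + CK)"] by simp
      qed
      finally have "sqrt ?S \<le> sqrt (Z CK * (h powr \<alpha>)\<^sup>2)" by (rule real_sqrt_le_mono)
      also have "\<dots> = sqrt (Z CK) * h powr \<alpha>" by (simp add: real_sqrt_mult)
      also have "\<dots> \<le> (sqrt (Z CK) + 1) * h powr \<alpha>" by (intro mult_right_mono) auto
      finally show "sqrt ?S \<le> (sqrt (Z CK) + 1) * h powr \<alpha>" .
    qed
  qed
qed

end
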